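(* Let $R_x(x,y,z)=(x,-y,-z)$, $R_y(x,y,z)=(-x,y,-z)$, $R_z(x,y,z)=(-x,-y,z)$ be the half-turns about the coordinate axes of $\mathbb{R}^3$. Define $24$ points $v_1,\dots,v_{24}\in\mathbb{Q}^3$ by $$v_1=\left(-\tfrac{38}{7},-\tfrac{57}{14},-\tfrac52\right),\quad v_5=\left(\tfrac53,-\tfrac1{15},\tfrac2{15}\right),\quad v_9=\left(-\tfrac{37}{38},-\tfrac54,-\tfrac{111}{76}\right),$$ $$v_{13}=\left(\tfrac{13}{11},-\tfrac35,\tfrac{26}{55}\right),\quad v_{17}=\left(\tfrac32,-\tfrac14,\tfrac14\right),\quad v_{21}=\left(\tfrac{31}{23},-\tfrac{62}{115},\tfrac35\right),$$ and $v_{i+1}=R_z v_i$, $v_{i+2}=R_x v_i$, $v_{i+3}=R_y v_i$ for $i\in\{1,5,9,13,17,21\}$. Consider the following eight polygons, each lying in the indicated plane and bounded by the closed polygonal path through the vertices $v_i$ whose indices $i$ are listed in cyclic order (counter-clockwise as seen from outside the solid): $A_1$: plane $3x-4y-2z=5$, cycle $(1,2,5,7,17,13,21,12,9)$; $A_2=R_z(A_1)$: plane $-3x+4y-2z=5$, cycle $(6,8,18,14,22,11,10,2,1)$; $A_3=R_x(A_1)$: plane $3x+4y+2z=5$, cycle $(7,5,19,15,23,10,11,3,4)$; $A_4=R_y(A_1)$: plane $-3x-4y+2z=5$, cycle $(4,3,8,6,20,16,24,9,12)$; $B_1$: plane $-2x+5y-5z=3$, cycle $(1,9,24,23,15,14,18,20,6)$;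 $B_2=R_z(B_1)$: plane $2x-5y-5z=3$, cycle $(13,17,19,5,2,10,23,24,16)$; $B_3=R_x(B_1)$: plane $-2x-5y+5z=3$, cycle $(21,13,16,20,18,8,3,11,22)$; $B_4=R_y(B_1)$: plane $2x+5y+5z=3$, cycle $(4,12,21,22,14,15,19,17,7)$. Then these eight polygons form a polyhedron $\mathcal{P}$ of genus $3$ with the following properties. 1. $\mathcal{P}$ has $8$ faces, $36$ edges and $24$ vertices; every face is a simple non-convex nonagon and every vertex lies in exactly three faces, so $\mathcal{P}$ is equivelar of type $\{9,3\}$. 2. Every two faces share an edge. The pairs of faces sharing two (collinear) edges are $A_1B_2,\ A_1B_4,\ A_3B_2,\ A_3B_4$ and $A_2B_1,\ A_2B_3,\ A_4B_1,\ A_4B_3$, and each of the remaining $20$ pairs shares exactly one edge. 3. The faces $A_i$ have three reflex corners each and the faces $B_i$ have two reflex corners each. 4. The symmetry group of $\mathcal{P}$ is exactly $D_2=\{\mathrm{id},R_x,R_y,R_z\}$. In particular $\mathcal{P}$ is chiral. 5. The combinatorial automorphism group of $\mathcal{P}$ is the dihedral group of order $8$. It acts simply transitively on the eight faces, and all its elements preserve orientation. 6. The volume of $\mathcal{P}$ is $351105133/18170460$, and the convex hull of $\mathcal{P}$ is the tetrahedron spanned by $v_1,v_2,v_3,v_4$.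
   Context: A polyhedron here is a closed connected polyhedral surface embedded in $\mathbb{R}^3$: a finite collection of planar simple polygons (faces) such that every edge belongs to exactly two faces, the faces around each vertex form a single cycle (so the union is a closed 2-manifold), and any two closed faces intersect exactly in the union of the edges and vertices they have in common in the combinatorial sense. Its genus is the genus of this orientable surface, and its volume is the volume of the bounded solid it encloses. The faces are the closed polygonal regions bounded by the listed cycles; the edges are the segments joining cyclically consecutive vertices of a face. Two faces share an edge if some segment is an edge of both. A corner of a face is reflex if the interior angle of the polygon there exceeds $\pi$. Equivelar of type $\{9,3\}$ means that every face is a $9$-gon and every vertex lies in exactly $3$ faces. The symmetry group is the group of isometries of $\mathbb{R}^3$ that map the polyhedron onto itself, carrying vertices to vertices and faces to faces. The polyhedron is chiral if no orientation-reversing isometry of $\mathbb{R}^3$ maps it to itself. A combinatorial automorphism is a permutation of the vertices that maps the set of face boundary cycles to itself, the cycles being regarded as unoriented (up to rotation and reversal). It is orientation-preserving if it maps the outward-oriented face cycles to outward-oriented face cycles (up to rotation), and orientation-reversing if it maps them to the reversed cycles. *)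

theory Defs
  imports "HOL-Analysis.Analysis" "HOL-Algebra.Group"
begin

section \<open>Polygons\<close>

text \<open>
  A polygon is the list of its vertices in cyclic order. The list carries a starting point and
  a direction of traversal; the two classes below forget the first, respectively both.
\<close>

type_synonym polygon = "(real^3) list"

definition oriented_cycle :: "polygon \<Rightarrow> polygon set" where
  "oriented_cycle f = {rotate k f | k. True}"

definition unoriented_cycle :: "polygon \<Rightarrow> polygon set" where
  "unoriented_cycle f = oriented_cycle f \<union> oriented_cycle (rev f)"

definition directed_edges :: "polygon \<Rightarrow> ((real^3) \<times> (real^3)) set" where
  "directed_edges f = {(f ! i, f ! (Suc i mod length f)) | i. i < length f}"

text \<open>An edge is the two-element set of its end points; the segment itself is its convex hull.\<close>

definition edges_of :: "polygon \<Rightarrow> (real^3) set set" where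
  "edges_of f = (\<lambda>(p, q). {p, q}) ` directed_edges f"

definition boundary_curve :: "polygon \<Rightarrow> (real^3) set" where
  "boundary_curve f = (\<Union>e\<in>edges_of f. convex hull e)"

definition previous_vertex :: "polygon \<Rightarrow> nat \<Rightarrow> real^3" where
  "previous_vertex f i = f ! ((i + length f - 1) mod length f)"

definition next_vertex :: "polygon \<Rightarrow> nat \<Rightarrow> real^3" where
  "next_vertex f i = f ! (Suc i mod length f)"

text \<open>
  Straight angles are excluded, so that an n-gon really has n corners; for the same reason the
  affine hull of the vertices is a plane.
\<close>

definition simple_polygon :: "polygon \<Rightarrow> bool" where
  "simple_polygon f \<longleftrightarrow>
     3 \<le> length f \<and> distinct f \<and> coplanar (set f) \<and>
     (\<forall>i<length f. \<not> collinear {previous_vertex f i, f ! i, next_vertex f i}) \<and>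
     (\<forall>e\<in>edges_of f. \<forall>e'\<in>edges_of f. e \<noteq> e' \<longrightarrow> convex hull e \<inter> convex hull e' = e \<inter> e')"

text \<open>
  The interior is taken relative to the plane of the polygon: it consists of the points of the
  plane that lie in a bounded component of the complement of the boundary curve in that plane.
\<close>

definition polygon_interior :: "polygon \<Rightarrow> (real^3) set" where
  "polygon_interior f =
     {x \<in> affine hull (set f) - boundary_curve f.
        bounded (connected_component_set (affine hull (set f) - boundary_curve f) x)}"

definition region :: "polygon \<Rightarrow> (real^3) set" where
  "region f = boundary_curve f \<union> polygon_interior f"

text \<open>
  The two edges at a corner enclose an angle \<open>\<alpha> \<in> [0, \<pi>]\<close>, and the small diagonal
  \<open>u + w\<close> points into the sector of angle \<open>\<alpha>\<close>. The interior angle is \<open>\<alpha>\<close> or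
  \<open>2\<pi> - \<alpha>\<close> according to which of the two sectors locally belongs to the polygon.
\<close>

definition interior_angle :: "polygon \<Rightarrow> nat \<Rightarrow> real" where
  "interior_angle f i =
     (let p = f ! i; u = previous_vertex f i - p; w = next_vertex f i - p;
          \<alpha> = arccos ((u \<bullet> w) / (norm u * norm w))
      in if \<forall>\<^sub>F t in at_right 0. p + t *\<^sub>R (u + w) \<in> region f then \<alpha> else 2 * pi - \<alpha>)"

definition reflex_corners :: "polygon \<Rightarrow> nat set" where
  "reflex_corners f = {i. i < length f \<and> interior_angle f i > pi}"


section \<open>Polyhedral surfaces\<close>

definition vertices :: "polygon set \<Rightarrow> (real^3) set" where
  "vertices F = (\<Union>f\<in>F. set f)"

definition edges :: "polygon set \<Rightarrow> (real^3) set set" where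
  "edges F = (\<Union>f\<in>F. edges_of f)"

definition surface :: "polygon set \<Rightarrow> (real^3) set" where
  "surface F = (\<Union>f\<in>F. region f)"

definition single_cycle_at :: "polygon set \<Rightarrow> real^3 \<Rightarrow> bool" where
  "single_cycle_at F v \<longleftrightarrow>
     (\<exists>fs. 3 \<le> length fs \<and> distinct fs \<and> set fs = {f \<in> F. v \<in> set f} \<and>
        (\<forall>i<length fs. \<exists>e \<in> edges_of (fs ! i) \<inter> edges_of (fs ! (Suc i mod length fs)). v \<in> e))"

text \<open>
  The intersection condition also ensures that distinct members of \<open>F\<close> are different as
  cycles, so that no face is listed twice.
\<close>

definition polyhedral_surface :: "polygon set \<Rightarrow> bool" where
  "polyhedral_surface F \<longleftrightarrow>
     finite F \<and> F \<noteq> {} \<and>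
     (\<forall>f\<in>F. simple_polygon f) \<and>
     (\<forall>e\<in>edges F. card {f \<in> F. e \<in> edges_of f} = 2) \<and>
     (\<forall>v\<in>vertices F. single_cycle_at F v) \<and>
     (\<forall>f\<in>F. \<forall>g\<in>F. f \<noteq> g \<longrightarrow>
        region f \<inter> region g =
          (\<Union>e \<in> edges_of f \<inter> edges_of g. convex hull e) \<union> (set f \<inter> set g)) \<and>
     connected (surface F)"

text \<open>
  An orientation is a choice of a direction for each face such that every edge is traversed in
  opposite directions by its two faces.
\<close>

definition orientable :: "polygon set \<Rightarrow> bool" where
  "orientable F \<longleftrightarrow>
     (\<exists>c. (\<forall>f\<in>F. c f \<in> unoriented_cycle f) \<and>
          (\<forall>f\<in>F. \<forall>g\<in>F. f \<noteq> g \<longrightarrow> directed_edges (c f) \<inter> directed_edges (c g) = {}))"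

text \<open>
  The Euler characteristic of the surface is computed from its cell decomposition into vertices,
  edges and faces (which are discs); the closed orientable surface of genus \<open>g\<close> is the one
  with Euler characteristic \<open>2 - 2 g\<close>.
\<close>

definition euler_characteristic :: "polygon set \<Rightarrow> int" where
  "euler_characteristic F = int (card (vertices F)) - int (card (edges F)) + int (card F)"

definition has_genus :: "polygon set \<Rightarrow> nat \<Rightarrow> bool" where
  "has_genus F g \<longleftrightarrow> orientable F \<and> euler_characteristic F = 2 - 2 * int g"

definition solid :: "polygon set \<Rightarrow> (real^3) set" where
  "solid F = surface F \<union> inside (surface F)"

text \<open>
  The sum is twice the vector area of the polygon (shoelace formula), the normal vector from
  whose tip the polygon is traversed counter-clockwise.
\<close>

definition right_hand_normal :: "polygon \<Rightarrow> real^3" where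
  "right_hand_normal f = (\<Sum>i<length f. cross3 (f ! i) (next_vertex f i))"

definition outward_oriented :: "polygon set \<Rightarrow> polygon \<Rightarrow> bool" where
  "outward_oriented F f \<longleftrightarrow>
     (\<forall>x\<in>polygon_interior f. \<forall>\<^sub>F t in at_right 0. x + t *\<^sub>R right_hand_normal f \<notin> solid F)"


section \<open>Symmetries\<close>

definition half_turn_x :: "real^3 \<Rightarrow> real^3" where
  "half_turn_x p = vector [p $ 1, - (p $ 2), - (p $ 3)]"

definition half_turn_y :: "real^3 \<Rightarrow> real^3" where
  "half_turn_y p = vector [- (p $ 1), p $ 2, - (p $ 3)]"

definition half_turn_z :: "real^3 \<Rightarrow> real^3" where
  "half_turn_z p = vector [- (p $ 1), - (p $ 2), p $ 3]"

definition isometry :: "(real^3 \<Rightarrow> real^3) \<Rightarrow> bool" where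
  "isometry \<phi> \<longleftrightarrow> (\<forall>x y. dist (\<phi> x) (\<phi> y) = dist x y)"

text \<open>An isometry is affine, with linear part \<open>\<lambda>x. \<phi> x - \<phi> 0\<close>.\<close>

definition orientation_reversing_isometry :: "(real^3 \<Rightarrow> real^3) \<Rightarrow> bool" where
  "orientation_reversing_isometry \<phi> \<longleftrightarrow> isometry \<phi> \<and> det (matrix (\<lambda>x. \<phi> x - \<phi> 0)) < 0"

definition symmetries :: "polygon set \<Rightarrow> (real^3 \<Rightarrow> real^3) set" where
  "symmetries F =
     {\<phi>. isometry \<phi> \<and> \<phi> ` surface F = surface F \<and> \<phi> ` vertices F = vertices F \<and>
         (\<lambda>f. \<phi> ` region f) ` F = region ` F}"

text \<open>
  Here only the point set has to be preserved, which makes chirality the stronger statement.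
\<close>

definition chiral :: "polygon set \<Rightarrow> bool" where
  "chiral F \<longleftrightarrow> \<not> (\<exists>\<phi>. orientation_reversing_isometry \<phi> \<and> \<phi> ` surface F = surface F)"


section \<open>Combinatorial automorphisms\<close>

definition automorphisms :: "polygon set \<Rightarrow> (real^3 \<Rightarrow> real^3) set" where
  "automorphisms F =
     {\<pi>. \<pi> permutes vertices F \<and>
         (\<lambda>f. unoriented_cycle (map \<pi> f)) ` F = unoriented_cycle ` F}"

definition automorphism_group :: "polygon set \<Rightarrow> (real^3 \<Rightarrow> real^3) monoid" where
  "automorphism_group F = \<lparr>carrier = automorphisms F, monoid.mult = (\<circ>), one = id\<rparr>"

text \<open>This set of lists is closed under rotation of its members.\<close>

definition outward_cycles :: "polygon set \<Rightarrow> polygon set" where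
  "outward_cycles F = {g. (\<exists>f\<in>F. g \<in> unoriented_cycle f) \<and> outward_oriented F g}"

definition orientation_preserving :: "polygon set \<Rightarrow> (real^3 \<Rightarrow> real^3) \<Rightarrow> bool" where
  "orientation_preserving F \<pi> \<longleftrightarrow> (\<forall>g\<in>outward_cycles F. map \<pi> g \<in> outward_cycles F)"

text \<open>
  The dihedral group of order \<open>2 n\<close>: the pair \<open>(a, s)\<close> stands for the rotation by
  \<open>a\<close> steps, preceded by a fixed reflection if \<open>s\<close> holds.
\<close>

definition dihedral_group :: "nat \<Rightarrow> (int \<times> bool) monoid" where
  "dihedral_group n =
     \<lparr>carrier = {0..<int n} \<times> UNIV,
      monoid.mult = (\<lambda>(a, s) (b, t). ((a + (if s then - b else b)) mod int n, s \<noteq> t)),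
      one = (0, False)\<rparr>"

end

theory Submission
  imports Defs
begin

text \<open>The eight face planes cut space into cells, and a point is located by the signs of the eight affine
  forms \<open>fa1\<close>, ..., \<open>fb4\<close> (positive on the outer side of the face). The interior and the exterior of each
  nonagon in its plane, and of the surface in space, are unions of convex sets given by sign conditions: the
  interior is bounded, and every exterior point lies on a ray or in a connected unbounded set avoiding the
  boundary, which identifies the bounded components of the complement. All incidences thereby become
  propositional combinations of linear inequalities. The half-turns reduce the faces to \<open>A\<^sub>1\<close> and
  \<open>B\<^sub>1\<close>. An isometry preserving the surface permutes the corners of its convex hull, a tetrahedron with
  three different edge lengths at each corner, and is determined by the image of one corner. An automorphism is determined by the image of one face cycle, because every other
  face is adjacent to that face. The volume is a signed sum of tetrahedra cut out by the face planes.\<close>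

text \<open>The shape behind the sign conditions: the solid is the tetrahedron bounded by the planes
  of the \<open>A\<close> faces, enlarged by four spikes with tips \<open>pt 1\<close>, ...,
  \<open>pt 4\<close>, minus the tetrahedron bounded by the planes of the \<open>B\<close> faces.
  The latter contains the origin, and its four corners poke out through the planes of the
  \<open>A\<close> faces, so it is a cavity with four mouths; this accounts for genus 3, which the
  proof obtains from the Euler characteristic. Each mouth abuts the base of a spike along a line.
  This keeps the \<open>A\<close> faces free of holes and splits edges: \<open>pt 7\<close>,
  \<open>pt 17\<close>, \<open>pt 21\<close>, \<open>pt 12\<close> lie on the line common to the
  planes of \<open>A\<close> 1 and \<open>B\<close> 4, and the mouth interrupts it between
  \<open>pt 17\<close> and \<open>pt 21\<close>. The obstacle is that interior, solid and outward
  direction are defined topologically. All topology is confined to a few general lemmas; what they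
  require of the concrete figure is linear arithmetic over the reals, decided by
  \<open>argo\<close>. Incidences of vertices, edges and faces are instead evaluated on lists of
  indices and transferred along the injectivity of \<open>pt\<close>.\<close>

section \<open>Affine forms, segments and planes\<close>

definition lin :: "real \<Rightarrow> real \<Rightarrow> real \<Rightarrow> real \<Rightarrow> real^3 \<Rightarrow> real" where
  "lin a b c d p = a * p $ 1 + b * p $ 2 + c * p $ 3 + d"

lemma lin_combination:
  "u + w = 1 \<Longrightarrow> lin a b c d (u *\<^sub>R p + w *\<^sub>R q) = u * lin a b c d p + w * lin a b c d q"
proof -
  assume "u + w = 1"
  then have u: "u = 1 - w" by simp
  show ?thesis unfolding lin_def u by (simp add: algebra_simps)
qed

lemma continuous_on_lin [continuous_intros]: "continuous_on S (lin a b c d)"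
  unfolding lin_def by (intro continuous_intros)

lemma open_lin_gt: "open {p. lin a b c d p > 0}"
  and open_lin_lt: "open {p. lin a b c d p < 0}"
  by (auto intro!: open_Collect_less continuous_intros simp: continuous_on_lin)

lemma lin_0_hyperplane:
  "{p. lin a b c d p = 0} = {p. (vector [a, b, c] :: real^3) \<bullet> p = - d}"
  by (auto simp: lin_def inner_vec_def sum_3 vector_3)

lemma vec3_eq_iff: "(p::real^3) = q \<longleftrightarrow> p $ 1 = q $ 1 \<and> p $ 2 = q $ 2 \<and> p $ 3 = q $ 3"
  by (simp add: vec_eq_iff forall_3)

definition det3 :: "real \<Rightarrow> real \<Rightarrow> real \<Rightarrow> real \<Rightarrow> real \<Rightarrow> real \<Rightarrow> real \<Rightarrow> real \<Rightarrow> real \<Rightarrow> real" where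
  "det3 a b c a' b' c' a'' b'' c'' =
     a * (b' * c'' - c' * b'') - b * (a' * c'' - c' * a'') + c * (a' * b'' - b' * a'')"

text \<open>Cramer's rule: the determinant times a coordinate of the difference \<open>p - q\<close>
  is a combination, with cofactors as coefficients, of the three forms, which vanish on that
  difference.\<close>

lemma lin_eq_imp_eq:
  assumes "det3 a b c a' b' c' a'' b'' c'' \<noteq> 0"
    and "lin a b c d p = lin a b c d q" and "lin a' b' c' d' p = lin a' b' c' d' q"
    and "lin a'' b'' c'' d'' p = lin a'' b'' c'' d'' q"
  shows "p = q"
proof -
  define x y z where "x = p $ 1 - q $ 1" and "y = p $ 2 - q $ 2" and "z = p $ 3 - q $ 3"
  have e: "a * x + b * y + c * z = 0" "a' * x + b' * y + c' * z = 0" "a'' * x + b'' * y + c'' * z = 0"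
    using assms(2-4) by (simp_all add: lin_def x_def y_def z_def algebra_simps)
  have "det3 a b c a' b' c' a'' b'' c'' * x =
    (b' * c'' - c' * b'') * (a * x + b * y + c * z) - (b * c'' - c * b'') * (a' * x + b' * y + c' * z) + (b * c' - c * b') * (a'' * x + b'' * y + c'' * z)"
    by (simp add: det3_def algebra_simps)
  then have x: "det3 a b c a' b' c' a'' b'' c'' * x = 0" by (simp only: e)
  have "det3 a b c a' b' c' a'' b'' c'' * y =
    - (a' * c'' - c' * a'') * (a * x + b * y + c * z) + (a * c'' - c * a'') * (a' * x + b' * y + c' * z) - (a * c' - c * a') * (a'' * x + b'' * y + c'' * z)"
    by (simp add: det3_def algebra_simps)
  then have y: "det3 a b c a' b' c' a'' b'' c'' * y = 0" by (simp only: e)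
  have "det3 a b c a' b' c' a'' b'' c'' * z =
    (a' * b'' - b' * a'') * (a * x + b * y + c * z) - (a * b'' - b * a'') * (a' * x + b' * y + c' * z) + (a * b' - b * a') * (a'' * x + b'' * y + c'' * z)"
    by (simp add: det3_def algebra_simps)
  then have z: "det3 a b c a' b' c' a'' b'' c'' * z = 0" by (simp only: e)
  then have "x = 0" "y = 0" "z = 0" using assms(1) x y by simp_all
  then show ?thesis by (simp add: vec3_eq_iff x_def y_def z_def)
qed

text \<open>Two planes cut out the line of the segment; a third form vanishing at \<open>p\<close>
  and a fourth one vanishing at \<open>q\<close> bound it. The signs \<open>s1\<close> and
  \<open>s2\<close> record on which side of these two planes the other end point lies.\<close>

lemma segment_lin_iff:
  assumes "det3 a b c a' b' c' a1 b1 c1 \<noteq> 0"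
    and z: "lin a b c d p = 0" "lin a b c d q = 0" "lin a' b' c' d' p = 0" "lin a' b' c' d' q = 0"
      "lin a1 b1 c1 d1 p = 0" "lin a2 b2 c2 d2 q = 0"
    and s: "lin a1 b1 c1 d1 q * s1 > 0" "lin a2 b2 c2 d2 p * s2 > 0"
  shows "x \<in> convex hull {p, q} \<longleftrightarrow>
    lin a b c d x = 0 \<and> lin a' b' c' d' x = 0 \<and> lin a1 b1 c1 d1 x * s1 \<ge> 0 \<and> lin a2 b2 c2 d2 x * s2 \<ge> 0"
    (is "_ \<longleftrightarrow> ?R")
proof
  assume "x \<in> convex hull {p, q}"
  then obtain u w where "u \<ge> 0" "w \<ge> 0" "u + w = 1" "x = u *\<^sub>R p + w *\<^sub>R q"
    by (auto simp: convex_hull_2)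
  then show ?R using z s by (simp add: lin_combination mult.assoc)
next
  assume R: ?R
  \<comment> \<open>The form that vanishes at \<open>p\<close>, normalised at \<open>q\<close>, is
    the barycentric coordinate of \<open>q\<close>; the form that vanishes at \<open>q\<close> will
    show that the other coordinate \<open>1 - w\<close> is nonnegative.\<close>
  define w where "w = lin a1 b1 c1 d1 x / lin a1 b1 c1 d1 q"
  let ?y = "(1 - w) *\<^sub>R p + w *\<^sub>R q"
  have q0: "lin a1 b1 c1 d1 q \<noteq> 0" using s(1) by auto
  have xy: "x = ?y"
  proof (rule lin_eq_imp_eq[OF assms(1)])
    show "lin a b c d x = lin a b c d ?y" using R z by (simp add: lin_combination)
    show "lin a' b' c' d' x = lin a' b' c' d' ?y" using R z by (simp add: lin_combination)
    show "lin a1 b1 c1 d1 x = lin a1 b1 c1 d1 ?y" using z q0 by (simp add: lin_combination w_def)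
  qed
  have "w = (lin a1 b1 c1 d1 x * s1) / (lin a1 b1 c1 d1 q * s1)" using s(1) by (auto simp: w_def)
  then have "w \<ge> 0" using R s(1) by (metis divide_nonneg_pos)
  have "lin a2 b2 c2 d2 x * s2 = (1 - w) * (lin a2 b2 c2 d2 p * s2)"
    by (subst xy) (simp add: lin_combination z)
  moreover have "0 \<le> lin a2 b2 c2 d2 x * s2" using R by blast
  ultimately have "0 \<le> (1 - w) * (lin a2 b2 c2 d2 p * s2)" by (simp only:)
  then have "1 - w \<ge> 0" using s(2) by (metis mult_neg_pos not_le)
  then show "x \<in> convex hull {p, q}" using \<open>w \<ge> 0\<close>
    unfolding convex_hull_2 by (intro CollectI exI[of _ "1 - w"] exI[of _ w] conjI xy) auto
qed

section \<open>Bounded components of a complement\<close>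

text \<open>A component meeting \<open>U\<close> cannot reach \<open>W\<close>, because the two open
  sets separate \<open>S\<close>; so it stays in a bounded set. A component meeting \<open>W\<close>
  contains a connected unbounded set. \<open>U\<close> and \<open>W\<close> have to be disjoint on
  \<open>S\<close> only, since the sign conditions used for a face exclude each other only in its
  plane. The lemma serves for polygons in their planes and for the surface in space.\<close>

lemma bounded_component_iff:
  fixes S :: "'a::real_normed_vector set"
  assumes "open U" "open W" "S \<subseteq> U \<union> W" "U \<inter> W \<inter> S = {}" "bounded (U \<inter> S)"
    and W: "\<And>x. x \<in> W \<inter> S \<Longrightarrow> \<exists>T. connected T \<and> \<not> bounded T \<and> x \<in> T \<and> T \<subseteq> S"
  shows "{x \<in> S. bounded (connected_component_set S x)} = U \<inter> S"
proof (intro equalityI subsetI)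
  fix x assume "x \<in> {x \<in> S. bounded (connected_component_set S x)}"
  then have x: "x \<in> S" "bounded (connected_component_set S x)" by auto
  show "x \<in> U \<inter> S"
  proof (rule ccontr)
    assume "x \<notin> U \<inter> S"
    then have "x \<in> W \<inter> S" using x assms(3) by auto
    from W[OF this] obtain T where "connected T" "\<not> bounded T" "x \<in> T" "T \<subseteq> S" by auto
    then have "T \<subseteq> connected_component_set S x" by (simp add: connected_component_maximal)
    then show False using x(2) \<open>\<not> bounded T\<close> bounded_subset by blast
  qed
next
  fix x assume x: "x \<in> U \<inter> S"
  let ?C = "connected_component_set S x"
  have C: "?C \<subseteq> S" "connected ?C" by (auto simp: connected_component_subset)
  have "x \<in> ?C" using x by (simp add: connected_component_refl)
  have "U \<inter> ?C = {} \<or> W \<inter> ?C = {}"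
    by (rule connectedD[OF C(2) assms(1,2)]) (use assms(3,4) C(1) in auto)
  then have "W \<inter> ?C = {}" using \<open>x \<in> ?C\<close> x by auto
  then have "?C \<subseteq> U \<inter> S" using C(1) assms(3) by auto
  then show "x \<in> {x \<in> S. bounded (connected_component_set S x)}"
    using x assms(5) bounded_subset by auto
qed

lemma connected_unbounded_ray:
  fixes x d :: "'a::real_normed_vector"
  assumes "d \<noteq> 0"
  shows "connected ((\<lambda>t. x + t *\<^sub>R d) ` {0..})" "\<not> bounded ((\<lambda>t. x + t *\<^sub>R d) ` {0..})"
proof -
  show "connected ((\<lambda>t. x + t *\<^sub>R d) ` {0..})"
    by (intro connected_continuous_image continuous_intros) auto
  show "\<not> bounded ((\<lambda>t. x + t *\<^sub>R d) ` {0..})"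
  proof
    assume "bounded ((\<lambda>t. x + t *\<^sub>R d) ` {0..})"
    then obtain B where B: "\<And>t. t \<ge> 0 \<Longrightarrow> norm (x + t *\<^sub>R d) \<le> B"
      unfolding bounded_iff by auto
    define t where "t = (\<bar>B\<bar> + norm x + 1) / norm d"
    have "t \<ge> 0" by (simp add: t_def)
    have "norm (t *\<^sub>R d) = \<bar>B\<bar> + norm x + 1" using assms by (simp add: t_def)
    moreover have "norm (t *\<^sub>R d) \<le> norm (x + t *\<^sub>R d) + norm x"
      by (metis add_diff_cancel_left' norm_triangle_ineq4)
    ultimately show False using B[OF \<open>t \<ge> 0\<close>] by linarith
  qed
qed

text \<open>\<open>U\<close> and \<open>W\<close> are open in space and matter only through their
  slices with the plane \<open>X\<close>. The escaping ray has to stay in the plane, as the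
  components are taken there.\<close>

lemma polygon_interior_eq:
  assumes X: "affine hull (set f) = X" and C: "boundary_curve f = C"
    and "open U" "open W" "\<And>x. x \<in> X \<Longrightarrow> x \<notin> C \<longleftrightarrow> x \<in> U \<or> x \<in> W"
    and "\<And>x. x \<in> X \<Longrightarrow> x \<in> U \<Longrightarrow> x \<in> W \<Longrightarrow> False" and "bounded (U \<inter> X)"
    and ray: "\<And>x. x \<in> X \<Longrightarrow> x \<in> W \<Longrightarrow> \<exists>d. d \<noteq> 0 \<and> (\<forall>t\<ge>0. x + t *\<^sub>R d \<in> X \<inter> W)"
    and CX: "C \<subseteq> X"
  shows "polygon_interior f = X \<inter> U" "region f = X - W"
proof -
  have "polygon_interior f = U \<inter> (X - C)"
    unfolding polygon_interior_def X C
  proof (rule bounded_component_iff[OF assms(3,4)])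
    fix x assume x: "x \<in> W \<inter> (X - C)"
    then obtain d where d: "d \<noteq> 0" "\<forall>t\<ge>0. x + t *\<^sub>R d \<in> X \<inter> W" using ray by blast
    then have "(\<lambda>t. x + t *\<^sub>R d) ` {0..} \<subseteq> X - C" using assms(5) by auto
    moreover have "x \<in> (\<lambda>t. x + t *\<^sub>R d) ` {0..}" by (auto intro!: image_eqI[of _ _ 0])
    ultimately show "\<exists>T. connected T \<and> \<not> bounded T \<and> x \<in> T \<and> T \<subseteq> X - C"
      using connected_unbounded_ray[OF d(1)] by blast
  qed (use assms in \<open>auto intro: bounded_subset[OF assms(7)]\<close>)
  then show *: "polygon_interior f = X \<inter> U" using assms(5) by auto
  show "region f = X - W" unfolding region_def * C using assms(5,6) CX by blast
qed

text \<open>A dimension count: three noncollinear points force the affine dimension of the hull up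
  to 2, which is that of the plane containing it.\<close>

lemma affine_hull_eq_lin_plane:
  assumes "(a, b, c) \<noteq> (0, 0, 0)" "\<And>p. p \<in> S \<Longrightarrow> lin a b c d p = 0"
    "p \<in> S" "q \<in> S" "r \<in> S" "\<not> collinear {p, q, r}"
  shows "affine hull S = {p. lin a b c d p = 0}"
proof -
  let ?n = "vector [a, b, c] :: real^3"
  have n: "?n \<noteq> 0" using assms(1) by (auto simp: vec3_eq_iff)
  have H: "{p. lin a b c d p = 0} = {p. ?n \<bullet> p = - d}" by (rule lin_0_hyperplane)
  have "affine {p. lin a b c d p = 0}" unfolding H by (rule affine_hyperplane)
  have sub: "affine hull S \<subseteq> {p. lin a b c d p = 0}"
    by (rule hull_minimal) (use assms(2) \<open>affine {p. lin a b c d p = 0}\<close> in auto)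
  have "aff_dim {p. lin a b c d p = 0} = 2" unfolding H using n by (simp add: aff_dim_hyperplane)
  moreover have "aff_dim {p, q, r} \<le> aff_dim S" using assms by (intro aff_dim_subset) auto
  moreover have "aff_dim {p, q, r} \<ge> 2" using assms(6) by (simp add: collinear_aff_dim)
  moreover have "aff_dim S \<le> aff_dim {p. lin a b c d p = 0}"
    using aff_dim_subset[OF sub] by simp
  ultimately have "aff_dim (affine hull S) = aff_dim {p. lin a b c d p = 0}" by simp
  moreover have "affine hull S \<noteq> {}" using assms(3) by auto
  ultimately show ?thesis
    using affine_dim_equal[OF affine_affine_hull \<open>affine {p. lin a b c d p = 0}\<close> _ sub] by blast
qed

lemma not_collinear_3_cross:
  assumes "cross3 (q - p) (r - p) \<noteq> 0"
  shows "\<not> collinear {p, q, r}"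
proof -
  have "\<not> collinear {0, q - p, r - p}" using assms by (simp add: cross_eq_0)
  then have "\<not> collinear {q, p, r}" by (subst collinear_3) (auto simp: NO_MATCH_def)
  then show ?thesis by (simp only: insert_commute[of q p] not_False_eq_True)
qed

section \<open>The vertices and the two model faces\<close>

text \<open>Keeps the index 1 a numeral, so that \<open>pt 1\<close> still matches its rewrite rules
  after simplification.\<close>

declare One_nat_def [simp del]

lemmas segment_lin_ge_ge = segment_lin_iff[where ?s1.0 = 1 and ?s2.0 = 1, simplified]
  and segment_lin_ge_le = segment_lin_iff[where ?s1.0 = 1 and ?s2.0 = "-1", simplified]
  and segment_lin_le_ge = segment_lin_iff[where ?s1.0 = "-1" and ?s2.0 = 1, simplified]
  and segment_lin_le_le = segment_lin_iff[where ?s1.0 = "-1" and ?s2.0 = "-1", simplified]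

text \<open>The leading \<open>0\<close> is padding, because the points are numbered from 1.\<close>

definition pt :: "nat \<Rightarrow> real^3" where
  "pt i = [0,
     vector [- 38/7, - 57/14, - 5/2], vector [38/7, 57/14, - 5/2],
     vector [- 38/7, 57/14, 5/2], vector [38/7, - 57/14, 5/2],
     vector [5/3, - 1/15, 2/15], vector [- 5/3, 1/15, 2/15],
     vector [5/3, 1/15, - 2/15], vector [- 5/3, - 1/15, - 2/15],
     vector [- 37/38, - 5/4, - 111/76], vector [37/38, 5/4, - 111/76],
     vector [- 37/38, 5/4, 111/76], vector [37/38, - 5/4, 111/76],
     vector [13/11, - 3/5, 26/55], vector [- 13/11, 3/5, 26/55],
     vector [13/11, 3/5, - 26/55], vector [- 13/11, - 3/5, - 26/55],
     vector [3/2, - 1/4, 1/4], vector [- 3/2, 1/4, 1/4],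
     vector [3/2, 1/4, - 1/4], vector [- 3/2, - 1/4, - 1/4],
     vector [31/23, - 62/115, 3/5], vector [- 31/23, 62/115, 3/5],
     vector [31/23, 62/115, - 3/5], vector [- 31/23, - 62/115, - 3/5]] ! i"

lemma pt_simps:
  "pt 1 = vector [- 38/7, - 57/14, - 5/2]"
  "pt 2 = vector [38/7, 57/14, - 5/2]"
  "pt 3 = vector [- 38/7, 57/14, 5/2]"
  "pt 4 = vector [38/7, - 57/14, 5/2]"
  "pt 5 = vector [5/3, - 1/15, 2/15]"
  "pt 6 = vector [- 5/3, 1/15, 2/15]"
  "pt 7 = vector [5/3, 1/15, - 2/15]"
  "pt 8 = vector [- 5/3, - 1/15, - 2/15]"
  "pt 9 = vector [- 37/38, - 5/4, - 111/76]"
  "pt 10 = vector [37/38, 5/4, - 111/76]"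
  "pt 11 = vector [- 37/38, 5/4, 111/76]"
  "pt 12 = vector [37/38, - 5/4, 111/76]"
  "pt 13 = vector [13/11, - 3/5, 26/55]"
  "pt 14 = vector [- 13/11, 3/5, 26/55]"
  "pt 15 = vector [13/11, 3/5, - 26/55]"
  "pt 16 = vector [- 13/11, - 3/5, - 26/55]"
  "pt 17 = vector [3/2, - 1/4, 1/4]"
  "pt 18 = vector [- 3/2, 1/4, 1/4]"
  "pt 19 = vector [3/2, 1/4, - 1/4]"
  "pt 20 = vector [- 3/2, - 1/4, - 1/4]"
  "pt 21 = vector [31/23, - 62/115, 3/5]"
  "pt 22 = vector [- 31/23, 62/115, 3/5]"
  "pt 23 = vector [31/23, 62/115, - 3/5]"
  "pt 24 = vector [- 31/23, - 62/115, - 3/5]"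
  by (simp_all add: pt_def One_nat_def)

abbreviation fa1 :: "real^3 \<Rightarrow> real" where "fa1 \<equiv> lin 3 (- 4) (- 2) (- 5)"
abbreviation fa2 :: "real^3 \<Rightarrow> real" where "fa2 \<equiv> lin (- 3) 4 (- 2) (- 5)"
abbreviation fa3 :: "real^3 \<Rightarrow> real" where "fa3 \<equiv> lin 3 4 2 (- 5)"
abbreviation fa4 :: "real^3 \<Rightarrow> real" where "fa4 \<equiv> lin (- 3) (- 4) 2 (- 5)"
text \<open>These four forms are 3 minus the left-hand side of the plane equation of the face: the
  outer side of a \<open>B\<close> face is the one containing the origin.\<close>

abbreviation fb1 :: "real^3 \<Rightarrow> real" where "fb1 \<equiv> lin 2 (- 5) 5 3"
abbreviation fb2 :: "real^3 \<Rightarrow> real" where "fb2 \<equiv> lin (- 2) 5 5 3"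
abbreviation fb3 :: "real^3 \<Rightarrow> real" where "fb3 \<equiv> lin 2 5 (- 5) 3"
abbreviation fb4 :: "real^3 \<Rightarrow> real" where "fb4 \<equiv> lin (- 2) (- 5) (- 5) 3"

text \<open>Every clause is an open convex set. Strictness makes the union open, and then the
  clauses must overlap, or points on the planes of other faces that run through the interior would
  be missed. The equation of the plane of the face is left out on purpose, so that the same
  condition also describes a neighbourhood in space.\<close>

definition inside_A1 :: "real^3 \<Rightarrow> bool" where
  "inside_A1 x \<longleftrightarrow>
     (fa2 x < 0 \<and> fa4 x < 0 \<and> fb2 x < 0 \<and> fb4 x > 0) \<or>
     (fa2 x < 0 \<and> fb1 x < 0 \<and> fb2 x < 0) \<or>
     (fa2 x < 0 \<and> fa3 x > 0 \<and> fb2 x < 0) \<or>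
     (fa4 x < 0 \<and> fb3 x < 0 \<and> fb4 x > 0)"

definition outside_A1 :: "real^3 \<Rightarrow> bool" where
  "outside_A1 x \<longleftrightarrow>
     (fa3 x < 0 \<and> fb4 x < 0) \<or>
     (fb2 x > 0 \<and> fb4 x < 0) \<or>
     (fb2 x > 0 \<and> fb3 x > 0) \<or>
     (fa4 x > 0 \<and> fb1 x > 0) \<or>
     (fa2 x > 0)"

definition inside_B1 :: "real^3 \<Rightarrow> bool" where
  "inside_B1 x \<longleftrightarrow>
     (fa1 x < 0 \<and> fa2 x < 0 \<and> fa4 x > 0) \<or>
     (fa2 x < 0 \<and> fa3 x < 0 \<and> fb2 x > 0 \<and> fb3 x > 0 \<and> fb4 x > 0)"

definition outside_B1 :: "real^3 \<Rightarrow> bool" where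
  "outside_B1 x \<longleftrightarrow>
     (fa4 x < 0 \<and> fb2 x < 0) \<or>
     (fa4 x < 0 \<and> fb3 x < 0) \<or>
     (fb4 x < 0) \<or>
     (fa3 x > 0) \<or>
     (fa2 x > 0) \<or>
     (fa1 x > 0)"

text \<open>The pattern of all edge lemmas: every vertex is the meeting point of three face planes,
  so an edge lies in the planes of its two faces and is bounded by the third plane at each
  end.\<close>

lemma segment_1_2:
  "x \<in> convex hull {pt 1, pt 2} \<longleftrightarrow>
    fa1 x = 0 \<and> fa2 x = 0 \<and> fb1 x \<le> 0 \<and> fb2 x \<le> 0"
  by (rule segment_lin_le_le) (simp_all add: det3_def lin_def pt_simps)

lemma segment_2_5:
  "x \<in> convex hull {pt 2, pt 5} \<longleftrightarrow>
    fa1 x = 0 \<and> fb2 x = 0 \<and> fa2 x \<le> 0 \<and> fa3 x \<ge> 0"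
  by (rule segment_lin_le_ge) (simp_all add: det3_def lin_def pt_simps)

lemma segment_5_7:
  "x \<in> convex hull {pt 5, pt 7} \<longleftrightarrow>
    fa1 x = 0 \<and> fa3 x = 0 \<and> fb2 x \<le> 0 \<and> fb4 x \<le> 0"
  by (rule segment_lin_le_le) (simp_all add: det3_def lin_def pt_simps)

lemma segment_7_17:
  "x \<in> convex hull {pt 7, pt 17} \<longleftrightarrow>
    fa1 x = 0 \<and> fb4 x = 0 \<and> fa3 x \<le> 0 \<and> fb2 x \<le> 0"
  by (rule segment_lin_le_le) (simp_all add: det3_def lin_def pt_simps)

lemma segment_17_13:
  "x \<in> convex hull {pt 17, pt 13} \<longleftrightarrow>
    fa1 x = 0 \<and> fb2 x = 0 \<and> fb4 x \<ge> 0 \<and> fb3 x \<ge> 0"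
  by (rule segment_lin_ge_ge) (simp_all add: det3_def lin_def pt_simps)

lemma segment_13_21:
  "x \<in> convex hull {pt 13, pt 21} \<longleftrightarrow>
    fa1 x = 0 \<and> fb3 x = 0 \<and> fb2 x \<ge> 0 \<and> fb4 x \<ge> 0"
  by (rule segment_lin_ge_ge) (simp_all add: det3_def lin_def pt_simps)

lemma segment_21_12:
  "x \<in> convex hull {pt 21, pt 12} \<longleftrightarrow>
    fa1 x = 0 \<and> fb4 x = 0 \<and> fb3 x \<le> 0 \<and> fa4 x \<le> 0"
  by (rule segment_lin_le_le) (simp_all add: det3_def lin_def pt_simps)

lemma segment_12_9:
  "x \<in> convex hull {pt 12, pt 9} \<longleftrightarrow>
    fa1 x = 0 \<and> fa4 x = 0 \<and> fb4 x \<ge> 0 \<and> fb1 x \<ge> 0"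
  by (rule segment_lin_ge_ge) (simp_all add: det3_def lin_def pt_simps)

lemma segment_9_1:
  "x \<in> convex hull {pt 9, pt 1} \<longleftrightarrow>
    fa1 x = 0 \<and> fb1 x = 0 \<and> fa4 x \<ge> 0 \<and> fa2 x \<le> 0"
  by (rule segment_lin_ge_le) (simp_all add: det3_def lin_def pt_simps)

lemma segment_1_9:
  "x \<in> convex hull {pt 1, pt 9} \<longleftrightarrow>
    fb1 x = 0 \<and> fa1 x = 0 \<and> fa2 x \<le> 0 \<and> fa4 x \<ge> 0"
  by (rule segment_lin_le_ge) (simp_all add: det3_def lin_def pt_simps)

lemma segment_9_24:
  "x \<in> convex hull {pt 9, pt 24} \<longleftrightarrow>
    fb1 x = 0 \<and> fa4 x = 0 \<and> fa1 x \<le> 0 \<and> fb2 x \<le> 0"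
  by (rule segment_lin_le_le) (simp_all add: det3_def lin_def pt_simps)

lemma segment_24_23:
  "x \<in> convex hull {pt 24, pt 23} \<longleftrightarrow>
    fb1 x = 0 \<and> fb2 x = 0 \<and> fa4 x \<le> 0 \<and> fa3 x \<le> 0"
  by (rule segment_lin_le_le) (simp_all add: det3_def lin_def pt_simps)

lemma segment_23_15:
  "x \<in> convex hull {pt 23, pt 15} \<longleftrightarrow>
    fb1 x = 0 \<and> fa3 x = 0 \<and> fb2 x \<ge> 0 \<and> fb4 x \<ge> 0"
  by (rule segment_lin_ge_ge) (simp_all add: det3_def lin_def pt_simps)

lemma segment_15_14:
  "x \<in> convex hull {pt 15, pt 14} \<longleftrightarrow>
    fb1 x = 0 \<and> fb4 x = 0 \<and> fa3 x \<le> 0 \<and> fa2 x \<le> 0"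
  by (rule segment_lin_le_le) (simp_all add: det3_def lin_def pt_simps)

lemma segment_14_18:
  "x \<in> convex hull {pt 14, pt 18} \<longleftrightarrow>
    fb1 x = 0 \<and> fa2 x = 0 \<and> fb4 x \<ge> 0 \<and> fb3 x \<ge> 0"
  by (rule segment_lin_ge_ge) (simp_all add: det3_def lin_def pt_simps)

lemma segment_18_20:
  "x \<in> convex hull {pt 18, pt 20} \<longleftrightarrow>
    fb1 x = 0 \<and> fb3 x = 0 \<and> fa2 x \<le> 0 \<and> fa4 x \<le> 0"
  by (rule segment_lin_le_le) (simp_all add: det3_def lin_def pt_simps)

lemma segment_20_6:
  "x \<in> convex hull {pt 20, pt 6} \<longleftrightarrow>
    fb1 x = 0 \<and> fa4 x = 0 \<and> fb3 x \<le> 0 \<and> fa2 x \<le> 0"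
  by (rule segment_lin_le_le) (simp_all add: det3_def lin_def pt_simps)

lemma segment_6_1:
  "x \<in> convex hull {pt 6, pt 1} \<longleftrightarrow>
    fb1 x = 0 \<and> fa2 x = 0 \<and> fa4 x \<ge> 0 \<and> fa1 x \<le> 0"
  by (rule segment_lin_ge_le) (simp_all add: det3_def lin_def pt_simps)


lemma directed_edges_eq_zip: "directed_edges f = set (zip f (rotate1 f))"
proof (cases f)
  case (Cons a l)
  then show ?thesis unfolding directed_edges_def set_zip by (auto simp: nth_rotate1 simp del: rotate1.simps)
qed (simp add: directed_edges_def)

definition face_A1 :: polygon where
  "face_A1 = map pt [1, 2, 5, 7, 17, 13, 21, 12, 9]"

lemma boundary_curve_A1:
  "x \<in> boundary_curve face_A1 \<longleftrightarrow>
    (fa1 x = 0 \<and> fa2 x = 0 \<and> fb1 x \<le> 0 \<and> fb2 x \<le> 0) \<or>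
    (fa1 x = 0 \<and> fb2 x = 0 \<and> fa2 x \<le> 0 \<and> fa3 x \<ge> 0) \<or>
    (fa1 x = 0 \<and> fa3 x = 0 \<and> fb2 x \<le> 0 \<and> fb4 x \<le> 0) \<or>
    (fa1 x = 0 \<and> fb4 x = 0 \<and> fa3 x \<le> 0 \<and> fb2 x \<le> 0) \<or>
    (fa1 x = 0 \<and> fb2 x = 0 \<and> fb4 x \<ge> 0 \<and> fb3 x \<ge> 0) \<or>
    (fa1 x = 0 \<and> fb3 x = 0 \<and> fb2 x \<ge> 0 \<and> fb4 x \<ge> 0) \<or>
    (fa1 x = 0 \<and> fb4 x = 0 \<and> fb3 x \<le> 0 \<and> fa4 x \<le> 0) \<or>
    (fa1 x = 0 \<and> fa4 x = 0 \<and> fb4 x \<ge> 0 \<and> fb1 x \<ge> 0) \<or>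
    (fa1 x = 0 \<and> fb1 x = 0 \<and> fa4 x \<ge> 0 \<and> fa2 x \<le> 0)"
  by (simp add: boundary_curve_def edges_of_def directed_edges_eq_zip face_A1_def)
     (simp add: segment_1_2 segment_2_5 segment_5_7 segment_7_17 segment_17_13 segment_13_21 segment_21_12 segment_12_9 segment_9_1)

lemma outside_A1_unbounded:
  assumes "outside_A1 x" "fa1 x = 0"
  shows "\<exists>d. d \<noteq> 0 \<and> (\<forall>t\<ge>0. fa1 (x + t *\<^sub>R d) = 0 \<and> outside_A1 (x + t *\<^sub>R d))"
proof -
  consider "fa3 x < 0 \<and> fb4 x < 0" | "fb2 x > 0 \<and> fb4 x < 0" | "fb2 x > 0 \<and> fb3 x > 0" | "fa4 x > 0 \<and> fb1 x > 0" | "fa2 x > 0"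
    using assms(1) unfolding outside_A1_def by blast
  then show ?thesis
  proof cases
    case 1
    then show ?thesis using assms(2)
      \<comment> \<open>The direction in every case is parallel to the plane of the face, and along
        it no form of the clause moves towards zero; the ray therefore never leaves the
        clause.\<close>
      by (intro exI[of _ "vector [0, - 1, 2]"])
         (auto simp: vec3_eq_iff lin_def outside_A1_def algebra_simps)
  next
    case 2
    then show ?thesis using assms(2)
      by (intro exI[of _ "vector [0, - 1, 2]"])
         (auto simp: vec3_eq_iff lin_def outside_A1_def algebra_simps)
  next
    case 3
    then show ?thesis using assms(2)
      by (intro exI[of _ "vector [2, 1, 1]"])
         (auto simp: vec3_eq_iff lin_def outside_A1_def algebra_simps)
  next
    case 4
    then show ?thesis using assms(2)
      by (intro exI[of _ "vector [0, - 1, 2]"])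
         (auto simp: vec3_eq_iff lin_def outside_A1_def algebra_simps)
  next
    case 5
    then show ?thesis using assms(2)
      by (intro exI[of _ "vector [0, 1, - 2]"])
         (auto simp: vec3_eq_iff lin_def outside_A1_def algebra_simps)
  qed
qed

lemma complement_A1:
  "fa1 x = 0 \<Longrightarrow> x \<notin> boundary_curve face_A1 \<longleftrightarrow> inside_A1 x \<or> outside_A1 x"
  unfolding boundary_curve_A1 inside_A1_def outside_A1_def lin_def by argo

lemma inside_outside_A1: "fa1 x = 0 \<Longrightarrow> inside_A1 x \<Longrightarrow> outside_A1 x \<Longrightarrow> False"
  unfolding inside_A1_def outside_A1_def lin_def by argo

text \<open>The largest coordinate of a vertex is 38/7, so 10 is a comfortable bound.\<close>

lemma inside_A1_bounded:
  "fa1 x = 0 \<Longrightarrow> inside_A1 x \<Longrightarrow> \<bar>x $ 1\<bar> \<le> 10 \<and> \<bar>x $ 2\<bar> \<le> 10 \<and> \<bar>x $ 3\<bar> \<le> 10"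
  unfolding inside_A1_def lin_def abs_le_iff by argo

definition face_B1 :: polygon where
  "face_B1 = map pt [1, 9, 24, 23, 15, 14, 18, 20, 6]"

lemma boundary_curve_B1:
  "x \<in> boundary_curve face_B1 \<longleftrightarrow>
    (fb1 x = 0 \<and> fa1 x = 0 \<and> fa2 x \<le> 0 \<and> fa4 x \<ge> 0) \<or>
    (fb1 x = 0 \<and> fa4 x = 0 \<and> fa1 x \<le> 0 \<and> fb2 x \<le> 0) \<or>
    (fb1 x = 0 \<and> fb2 x = 0 \<and> fa4 x \<le> 0 \<and> fa3 x \<le> 0) \<or>
    (fb1 x = 0 \<and> fa3 x = 0 \<and> fb2 x \<ge> 0 \<and> fb4 x \<ge> 0) \<or>
    (fb1 x = 0 \<and> fb4 x = 0 \<and> fa3 x \<le> 0 \<and> fa2 x \<le> 0) \<or>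
    (fb1 x = 0 \<and> fa2 x = 0 \<and> fb4 x \<ge> 0 \<and> fb3 x \<ge> 0) \<or>
    (fb1 x = 0 \<and> fb3 x = 0 \<and> fa2 x \<le> 0 \<and> fa4 x \<le> 0) \<or>
    (fb1 x = 0 \<and> fa4 x = 0 \<and> fb3 x \<le> 0 \<and> fa2 x \<le> 0) \<or>
    (fb1 x = 0 \<and> fa2 x = 0 \<and> fa4 x \<ge> 0 \<and> fa1 x \<le> 0)"
  by (simp add: boundary_curve_def edges_of_def directed_edges_eq_zip face_B1_def)
     (simp add: segment_1_9 segment_9_24 segment_24_23 segment_23_15 segment_15_14 segment_14_18 segment_18_20 segment_20_6 segment_6_1)

lemma outside_B1_unbounded:
  assumes "outside_B1 x" "fb1 x = 0"
  shows "\<exists>d. d \<noteq> 0 \<and> (\<forall>t\<ge>0. fb1 (x + t *\<^sub>R d) = 0 \<and> outside_B1 (x + t *\<^sub>R d))"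
proof -
  consider "fa4 x < 0 \<and> fb2 x < 0" | "fa4 x < 0 \<and> fb3 x < 0" | "fb4 x < 0" | "fa3 x > 0" | "fa2 x > 0" | "fa1 x > 0"
    using assms(1) unfolding outside_B1_def by blast
  then show ?thesis
  proof cases
    case 1
    then show ?thesis using assms(2)
      by (intro exI[of _ "vector [5, 0, - 2]"])
         (auto simp: vec3_eq_iff lin_def outside_B1_def algebra_simps)
  next
    case 2
    then show ?thesis using assms(2)
      by (intro exI[of _ "vector [0, 1, 1]"])
         (auto simp: vec3_eq_iff lin_def outside_B1_def algebra_simps)
  next
    case 3
    then show ?thesis using assms(2)
      by (intro exI[of _ "vector [0, 1, 1]"])
         (auto simp: vec3_eq_iff lin_def outside_B1_def algebra_simps)
  next
    case 4
    then show ?thesis using assms(2)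
      by (intro exI[of _ "vector [0, 1, 1]"])
         (auto simp: vec3_eq_iff lin_def outside_B1_def algebra_simps)
  next
    case 5
    then show ?thesis using assms(2)
      by (intro exI[of _ "vector [0, 1, 1]"])
         (auto simp: vec3_eq_iff lin_def outside_B1_def algebra_simps)
  next
    case 6
    then show ?thesis using assms(2)
      by (intro exI[of _ "vector [0, - 1, - 1]"])
         (auto simp: vec3_eq_iff lin_def outside_B1_def algebra_simps)
  qed
qed

lemma complement_B1:
  "fb1 x = 0 \<Longrightarrow> x \<notin> boundary_curve face_B1 \<longleftrightarrow> inside_B1 x \<or> outside_B1 x"
  unfolding boundary_curve_B1 inside_B1_def outside_B1_def lin_def by argo

lemma inside_outside_B1: "fb1 x = 0 \<Longrightarrow> inside_B1 x \<Longrightarrow> outside_B1 x \<Longrightarrow> False"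
  unfolding inside_B1_def outside_B1_def lin_def by argo

lemma inside_B1_bounded:
  "fb1 x = 0 \<Longrightarrow> inside_B1 x \<Longrightarrow> \<bar>x $ 1\<bar> \<le> 10 \<and> \<bar>x $ 2\<bar> \<le> 10 \<and> \<bar>x $ 3\<bar> \<le> 10"
  unfolding inside_B1_def lin_def abs_le_iff by argo

lemma bounded_coordinates:
  assumes "\<And>x. x \<in> S \<Longrightarrow> \<bar>x $ 1\<bar> \<le> c \<and> \<bar>x $ 2\<bar> \<le> c \<and> \<bar>x $ 3\<bar> \<le> c"
  shows "bounded (S :: (real^3) set)"
proof (rule bounded_subset)
  show "S \<subseteq> cbox (vector [- c, - c, - c]) (vector [c, c, c])"
    using assms by (fastforce simp: mem_box_cart forall_3 abs_le_iff)
qed (rule bounded_cbox)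

lemma less_9_iff: "(i::nat) < 9 \<longleftrightarrow> i = 0 \<or> i = 1 \<or> i = 2 \<or> i = 3 \<or> i = 4 \<or> i = 5 \<or> i = 6 \<or> i = 7 \<or> i = 8"
  by arith

text \<open>Without collinearity the Cauchy-Schwarz inequality is strict, so the enclosed angle lies
  strictly between 0 and \<open>pi\<close>; then reflexivity of the corner depends only on whether
  the small diagonal starts into the region.\<close>

lemma interior_angle_gt_pi_iff:
  assumes "\<not> collinear {previous_vertex f i, f ! i, next_vertex f i}"
  shows "interior_angle f i > pi \<longleftrightarrow>
    \<not> (\<forall>\<^sub>F t in at_right 0. f ! i + t *\<^sub>R (previous_vertex f i - f ! i + (next_vertex f i - f ! i)) \<in> region f)"
proof -
  define u w where "u = previous_vertex f i - f ! i" and "w = next_vertex f i - f ! i"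
  have "\<not> collinear {0, u, w}"
    using assms by (subst (asm) collinear_3) (auto simp: u_def w_def NO_MATCH_def)
  then have "\<bar>u \<bullet> w\<bar> \<noteq> norm u * norm w" "u \<noteq> 0" "w \<noteq> 0"
    by (auto simp: norm_cauchy_schwarz_equal insert_commute)
  then have "\<bar>u \<bullet> w\<bar> < norm u * norm w" "norm u * norm w > 0"
    using Cauchy_Schwarz_ineq2[of u w] by auto
  then have "- 1 < (u \<bullet> w) / (norm u * norm w)" "(u \<bullet> w) / (norm u * norm w) < 1"
    by (auto simp: field_simps abs_less_iff)
  then have "0 < arccos ((u \<bullet> w) / (norm u * norm w))" "arccos ((u \<bullet> w) / (norm u * norm w)) < pi"
    using arccos_lt_bounded by blast+
  then show ?thesis unfolding interior_angle_def Let_def u_def w_def by simp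
qed

lemma in_meet_edges:
  shows "x = q \<Longrightarrow> x \<in> {p, q} \<inter> {q, r}" and "x = q \<Longrightarrow> x \<in> {q, r} \<inter> {p, q}"
  by auto

text \<open>Trades equality with a vertex for linear equations, which linear arithmetic can prove
  from the descriptions of two segments meeting there.\<close>

lemma eq_pt_iff:
  "x = pt 1 \<longleftrightarrow> fa1 x = 0 \<and> fa2 x = 0 \<and> fb1 x = 0"
  "x = pt 2 \<longleftrightarrow> fa1 x = 0 \<and> fa2 x = 0 \<and> fb2 x = 0"
  "x = pt 3 \<longleftrightarrow> fa3 x = 0 \<and> fa4 x = 0 \<and> fb3 x = 0"
  "x = pt 4 \<longleftrightarrow> fa3 x = 0 \<and> fa4 x = 0 \<and> fb4 x = 0"
  "x = pt 5 \<longleftrightarrow> fa1 x = 0 \<and> fa3 x = 0 \<and> fb2 x = 0"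
  "x = pt 6 \<longleftrightarrow> fa2 x = 0 \<and> fa4 x = 0 \<and> fb1 x = 0"
  "x = pt 7 \<longleftrightarrow> fa1 x = 0 \<and> fa3 x = 0 \<and> fb4 x = 0"
  "x = pt 8 \<longleftrightarrow> fa2 x = 0 \<and> fa4 x = 0 \<and> fb3 x = 0"
  "x = pt 9 \<longleftrightarrow> fa1 x = 0 \<and> fa4 x = 0 \<and> fb1 x = 0"
  "x = pt 10 \<longleftrightarrow> fa2 x = 0 \<and> fa3 x = 0 \<and> fb2 x = 0"
  "x = pt 11 \<longleftrightarrow> fa2 x = 0 \<and> fa3 x = 0 \<and> fb3 x = 0"
  "x = pt 12 \<longleftrightarrow> fa1 x = 0 \<and> fa4 x = 0 \<and> fb4 x = 0"
  "x = pt 13 \<longleftrightarrow> fa1 x = 0 \<and> fb2 x = 0 \<and> fb3 x = 0"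
  "x = pt 14 \<longleftrightarrow> fa2 x = 0 \<and> fb1 x = 0 \<and> fb4 x = 0"
  "x = pt 15 \<longleftrightarrow> fa3 x = 0 \<and> fb1 x = 0 \<and> fb4 x = 0"
  "x = pt 16 \<longleftrightarrow> fa4 x = 0 \<and> fb2 x = 0 \<and> fb3 x = 0"
  "x = pt 17 \<longleftrightarrow> fa1 x = 0 \<and> fb2 x = 0 \<and> fb4 x = 0"
  "x = pt 18 \<longleftrightarrow> fa2 x = 0 \<and> fb1 x = 0 \<and> fb3 x = 0"
  "x = pt 19 \<longleftrightarrow> fa3 x = 0 \<and> fb2 x = 0 \<and> fb4 x = 0"
  "x = pt 20 \<longleftrightarrow> fa4 x = 0 \<and> fb1 x = 0 \<and> fb3 x = 0"
  "x = pt 21 \<longleftrightarrow> fa1 x = 0 \<and> fb3 x = 0 \<and> fb4 x = 0"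
  "x = pt 22 \<longleftrightarrow> fa2 x = 0 \<and> fb3 x = 0 \<and> fb4 x = 0"
  "x = pt 23 \<longleftrightarrow> fa3 x = 0 \<and> fb1 x = 0 \<and> fb2 x = 0"
  "x = pt 24 \<longleftrightarrow> fa4 x = 0 \<and> fb1 x = 0 \<and> fb2 x = 0"
  unfolding vec3_eq_iff pt_simps vector_3 lin_def by argo+

lemma set_face_A1: "set face_A1 = {pt 1, pt 2, pt 5, pt 7, pt 17, pt 13, pt 21, pt 12, pt 9}"
  by (simp add: face_A1_def)

lemma edges_of_A1: "edges_of face_A1 = {{pt 1, pt 2}, {pt 2, pt 5}, {pt 5, pt 7}, {pt 7, pt 17}, {pt 17, pt 13}, {pt 13, pt 21}, {pt 21, pt 12}, {pt 12, pt 9}, {pt 9, pt 1}}"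
  by (simp add: edges_of_def directed_edges_eq_zip face_A1_def)

text \<open>The hull of three corners is wanted as well, because \<open>coplanar\<close> asks for
  three points whose affine hull contains the set.\<close>

lemma corner_A1:
  assumes "\<not> collinear {pt 1, pt 2, pt 5}"
  shows "affine hull {pt 1, pt 2, pt 5} = {x. fa1 x = 0}" "affine hull (set face_A1) = {x. fa1 x = 0}"
  by (rule affine_hull_eq_lin_plane[OF _ _ _ _ _ assms]; auto simp: set_face_A1 lin_def pt_simps)+

lemma not_collinear_A1:
  "i < 9 \<Longrightarrow> \<not> collinear {previous_vertex face_A1 i, face_A1 ! i, next_vertex face_A1 i}"
  unfolding less_9_iff
  by (elim disjE; hypsubst; rule not_collinear_3_cross; simp add: previous_vertex_def next_vertex_def face_A1_def;
      simp add: pt_simps cross3_def vec3_eq_iff)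

lemma affine_hull_A1: "affine hull (set face_A1) = {x. fa1 x = 0}"
  and coplanar_A1: "coplanar (set face_A1)"
proof -
  have "\<not> collinear {pt 1, pt 2, pt 5}"
    by (rule not_collinear_3_cross) (simp add: pt_simps cross3_def vec3_eq_iff)
  note * = corner_A1[OF this]
  show "affine hull (set face_A1) = {x. fa1 x = 0}" by (rule *)
  then have "set face_A1 \<subseteq> affine hull {pt 1, pt 2, pt 5}" using hull_subset unfolding *(1) by metis
  then show "coplanar (set face_A1)" unfolding coplanar_def by blast
qed

lemma edges_meet_A1:
  "\<forall>e\<in>edges_of face_A1. \<forall>e'\<in>edges_of face_A1. e \<noteq> e' \<longrightarrow> convex hull e \<inter> convex hull e' = e \<inter> e'"
proof -
  have "\<forall>e\<in>edges_of face_A1. \<forall>e'\<in>edges_of face_A1. e = e' \<or>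
      (\<forall>x. x \<in> convex hull e \<longrightarrow> x \<in> convex hull e' \<longrightarrow> x \<in> e \<inter> e')"
    unfolding edges_of_A1 ball_simps(5,7) simp_thms
    \<comment> \<open>Each of the 81 ordered pairs falls to one of four alternatives: equal edges,
      edges without a common point (the linear conditions contradict each other), and consecutive
      edges in either order, where the conditions force the shared vertex.\<close>
    by (intro conjI;
        ((rule disjI1, rule refl) |
        (rule disjI2, intro allI impI, simp only: segment_1_2 segment_2_5 segment_5_7 segment_7_17 segment_17_13 segment_13_21 segment_21_12 segment_12_9 segment_9_1 lin_def, elim conjE, linarith) |
        (rule disjI2, intro allI impI, rule in_meet_edges(1); simp only: segment_1_2 segment_2_5 segment_5_7 segment_7_17 segment_17_13 segment_13_21 segment_21_12 segment_12_9 segment_9_1 eq_pt_iff lin_def;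
          (elim conjE)?; (intro conjI)?; linarith) |
        (rule disjI2, intro allI impI, rule in_meet_edges(2); simp only: segment_1_2 segment_2_5 segment_5_7 segment_7_17 segment_17_13 segment_13_21 segment_21_12 segment_12_9 segment_9_1 eq_pt_iff lin_def;
          (elim conjE)?; (intro conjI)?; linarith)))
  note meet = this
  show ?thesis
  proof (intro ballI impI equalityI subsetI)
    fix e e' x assume "e \<in> edges_of face_A1" "e' \<in> edges_of face_A1" "e \<noteq> e'"
      and "x \<in> convex hull e \<inter> convex hull e'"
    with bspec[OF bspec[OF meet]] show "x \<in> e \<inter> e'" by (metis IntD1 IntD2)
  qed (auto intro: hull_inc)
qed

lemma simple_polygon_A1: "simple_polygon face_A1"
  unfolding simple_polygon_def
  using coplanar_A1 not_collinear_A1 edges_meet_A1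
  by (auto simp: face_A1_def pt_simps vec3_eq_iff)

lemma polygon_interior_A1: "polygon_interior face_A1 = {x. fa1 x = 0 \<and> inside_A1 x}"
  and region_A1: "region face_A1 = {x. fa1 x = 0 \<and> \<not> outside_A1 x}"
proof -
  have "open {x. inside_A1 x}" "open {x. outside_A1 x}"
    unfolding inside_A1_def outside_A1_def
    by (intro open_Collect_disj open_Collect_conj open_lin_lt open_lin_gt)+
  note opens = this
  have b: "bounded ({x. inside_A1 x} \<inter> {x. fa1 x = 0})"
    by (rule bounded_coordinates[of _ 10]) (use inside_A1_bounded in simp)
  have c: "x \<in> {x. fa1 x = 0} \<Longrightarrow>
      x \<notin> boundary_curve face_A1 \<longleftrightarrow> x \<in> {x. inside_A1 x} \<or> x \<in> {x. outside_A1 x}" for x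
    by (simp add: complement_A1)
  have d: "x \<in> {x. fa1 x = 0} \<Longrightarrow> x \<in> {x. inside_A1 x} \<Longrightarrow> x \<in> {x. outside_A1 x} \<Longrightarrow> False" for x
    using inside_outside_A1 by simp
  have r: "x \<in> {x. fa1 x = 0} \<Longrightarrow> x \<in> {x. outside_A1 x} \<Longrightarrow>
      \<exists>d. d \<noteq> 0 \<and> (\<forall>t\<ge>0. x + t *\<^sub>R d \<in> {x. fa1 x = 0} \<inter> {x. outside_A1 x})" for x
    using outside_A1_unbounded by simp
  have s: "boundary_curve face_A1 \<subseteq> {x. fa1 x = 0}"
    unfolding boundary_curve_A1 subset_iff mem_Collect_eq by blast
  have "polygon_interior face_A1 = {x. fa1 x = 0} \<inter> {x. inside_A1 x}"
    by (rule polygon_interior_eq(1)[OF affine_hull_A1 refl opens c d b r s])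
  moreover have "region face_A1 = {x. fa1 x = 0} - {x. outside_A1 x}"
    by (rule polygon_interior_eq(2)[OF affine_hull_A1 refl opens c d b r s])
  ultimately show "polygon_interior face_A1 = {x. fa1 x = 0 \<and> inside_A1 x}"
    "region face_A1 = {x. fa1 x = 0 \<and> \<not> outside_A1 x}" by auto
qed


lemma set_face_B1: "set face_B1 = {pt 1, pt 9, pt 24, pt 23, pt 15, pt 14, pt 18, pt 20, pt 6}"
  by (simp add: face_B1_def)

lemma edges_of_B1: "edges_of face_B1 = {{pt 1, pt 9}, {pt 9, pt 24}, {pt 24, pt 23}, {pt 23, pt 15}, {pt 15, pt 14}, {pt 14, pt 18}, {pt 18, pt 20}, {pt 20, pt 6}, {pt 6, pt 1}}"
  by (simp add: edges_of_def directed_edges_eq_zip face_B1_def)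

lemma corner_B1:
  assumes "\<not> collinear {pt 1, pt 9, pt 24}"
  shows "affine hull {pt 1, pt 9, pt 24} = {x. fb1 x = 0}" "affine hull (set face_B1) = {x. fb1 x = 0}"
  by (rule affine_hull_eq_lin_plane[OF _ _ _ _ _ assms]; auto simp: set_face_B1 lin_def pt_simps)+

lemma not_collinear_B1:
  "i < 9 \<Longrightarrow> \<not> collinear {previous_vertex face_B1 i, face_B1 ! i, next_vertex face_B1 i}"
  unfolding less_9_iff
  by (elim disjE; hypsubst; rule not_collinear_3_cross; simp add: previous_vertex_def next_vertex_def face_B1_def;
      simp add: pt_simps cross3_def vec3_eq_iff)

lemma affine_hull_B1: "affine hull (set face_B1) = {x. fb1 x = 0}"
  and coplanar_B1: "coplanar (set face_B1)"
proof -
  have "\<not> collinear {pt 1, pt 9, pt 24}"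
    by (rule not_collinear_3_cross) (simp add: pt_simps cross3_def vec3_eq_iff)
  note * = corner_B1[OF this]
  show "affine hull (set face_B1) = {x. fb1 x = 0}" by (rule *)
  then have "set face_B1 \<subseteq> affine hull {pt 1, pt 9, pt 24}" using hull_subset unfolding *(1) by metis
  then show "coplanar (set face_B1)" unfolding coplanar_def by blast
qed

lemma edges_meet_B1:
  "\<forall>e\<in>edges_of face_B1. \<forall>e'\<in>edges_of face_B1. e \<noteq> e' \<longrightarrow> convex hull e \<inter> convex hull e' = e \<inter> e'"
proof -
  have "\<forall>e\<in>edges_of face_B1. \<forall>e'\<in>edges_of face_B1. e = e' \<or>
      (\<forall>x. x \<in> convex hull e \<longrightarrow> x \<in> convex hull e' \<longrightarrow> x \<in> e \<inter> e')"
    unfolding edges_of_B1 ball_simps(5,7) simp_thms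
    by (intro conjI;
        ((rule disjI1, rule refl) |
        (rule disjI2, intro allI impI, simp only: segment_1_9 segment_9_24 segment_24_23 segment_23_15 segment_15_14 segment_14_18 segment_18_20 segment_20_6 segment_6_1 lin_def, elim conjE, linarith) |
        (rule disjI2, intro allI impI, rule in_meet_edges(1); simp only: segment_1_9 segment_9_24 segment_24_23 segment_23_15 segment_15_14 segment_14_18 segment_18_20 segment_20_6 segment_6_1 eq_pt_iff lin_def;
          (elim conjE)?; (intro conjI)?; linarith) |
        (rule disjI2, intro allI impI, rule in_meet_edges(2); simp only: segment_1_9 segment_9_24 segment_24_23 segment_23_15 segment_15_14 segment_14_18 segment_18_20 segment_20_6 segment_6_1 eq_pt_iff lin_def;
          (elim conjE)?; (intro conjI)?; linarith)))
  note meet = this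
  show ?thesis
  proof (intro ballI impI equalityI subsetI)
    fix e e' x assume "e \<in> edges_of face_B1" "e' \<in> edges_of face_B1" "e \<noteq> e'"
      and "x \<in> convex hull e \<inter> convex hull e'"
    with bspec[OF bspec[OF meet]] show "x \<in> e \<inter> e'" by (metis IntD1 IntD2)
  qed (auto intro: hull_inc)
qed

lemma simple_polygon_B1: "simple_polygon face_B1"
  unfolding simple_polygon_def
  using coplanar_B1 not_collinear_B1 edges_meet_B1
  by (auto simp: face_B1_def pt_simps vec3_eq_iff)

lemma polygon_interior_B1: "polygon_interior face_B1 = {x. fb1 x = 0 \<and> inside_B1 x}"
  and region_B1: "region face_B1 = {x. fb1 x = 0 \<and> \<not> outside_B1 x}"
proof -
  have "open {x. inside_B1 x}" "open {x. outside_B1 x}"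
    unfolding inside_B1_def outside_B1_def
    by (intro open_Collect_disj open_Collect_conj open_lin_lt open_lin_gt)+
  note opens = this
  have b: "bounded ({x. inside_B1 x} \<inter> {x. fb1 x = 0})"
    by (rule bounded_coordinates[of _ 10]) (use inside_B1_bounded in simp)
  have c: "x \<in> {x. fb1 x = 0} \<Longrightarrow>
      x \<notin> boundary_curve face_B1 \<longleftrightarrow> x \<in> {x. inside_B1 x} \<or> x \<in> {x. outside_B1 x}" for x
    by (simp add: complement_B1)
  have d: "x \<in> {x. fb1 x = 0} \<Longrightarrow> x \<in> {x. inside_B1 x} \<Longrightarrow> x \<in> {x. outside_B1 x} \<Longrightarrow> False" for x
    using inside_outside_B1 by simp
  have r: "x \<in> {x. fb1 x = 0} \<Longrightarrow> x \<in> {x. outside_B1 x} \<Longrightarrow>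
      \<exists>d. d \<noteq> 0 \<and> (\<forall>t\<ge>0. x + t *\<^sub>R d \<in> {x. fb1 x = 0} \<inter> {x. outside_B1 x})" for x
    using outside_B1_unbounded by simp
  have s: "boundary_curve face_B1 \<subseteq> {x. fb1 x = 0}"
    unfolding boundary_curve_B1 subset_iff mem_Collect_eq by blast
  have "polygon_interior face_B1 = {x. fb1 x = 0} \<inter> {x. inside_B1 x}"
    by (rule polygon_interior_eq(1)[OF affine_hull_B1 refl opens c d b r s])
  moreover have "region face_B1 = {x. fb1 x = 0} - {x. outside_B1 x}"
    by (rule polygon_interior_eq(2)[OF affine_hull_B1 refl opens c d b r s])
  ultimately show "polygon_interior face_B1 = {x. fb1 x = 0 \<and> inside_B1 x}"
    "region face_B1 = {x. fb1 x = 0 \<and> \<not> outside_B1 x}" by auto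
qed

text \<open>Positions count from 0; the reflex corners are \<open>pt 7\<close>, \<open>pt 13\<close>
  and \<open>pt 9\<close>.\<close>

lemma reflex_corners_A1: "reflex_corners face_A1 = {3, 5, 8}"
proof -
  let ?d = "\<lambda>i. previous_vertex face_A1 i - face_A1 ! i + (next_vertex face_A1 i - face_A1 ! i)"
  have convex: "\<forall>\<^sub>F t in at_right 0. face_A1 ! i + t *\<^sub>R ?d i \<in> region face_A1"
    if "i = 0 \<or> i = 1 \<or> i = 2 \<or> i = 4 \<or> i = 6 \<or> i = 7" for i
    unfolding eventually_at_right_field
  \<comment> \<open>The diagonal is formed from whole edges and may run across other edges further
    out; a thousandth of it is short enough to test the sector at the corner only.\<close>
  proof (intro exI[of _ "1 / 1000"] conjI allI impI)
    fix t :: real assume "0 < t" "t < 1 / 1000"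
    with that show "face_A1 ! i + t *\<^sub>R ?d i \<in> region face_A1"
      unfolding region_A1 outside_A1_def lin_def mem_Collect_eq vector_add_component vector_minus_component vector_scaleR_component
      by (elim disjE; hypsubst; simp add: previous_vertex_def next_vertex_def face_A1_def; simp add: pt_simps)
  qed simp
  have reflex: "\<not> (\<forall>\<^sub>F t in at_right 0. face_A1 ! i + t *\<^sub>R ?d i \<in> region face_A1)"
    if "i = 3 \<or> i = 5 \<or> i = 8" for i
  proof
    assume "\<forall>\<^sub>F t in at_right 0. face_A1 ! i + t *\<^sub>R ?d i \<in> region face_A1"
    moreover have "\<forall>\<^sub>F t in at_right 0. face_A1 ! i + t *\<^sub>R ?d i \<notin> region face_A1"
      unfolding eventually_at_right_field
  proof (intro exI[of _ "1 / 1000"] conjI allI impI)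
    fix t :: real assume "0 < t" "t < 1 / 1000"
    with that show "face_A1 ! i + t *\<^sub>R ?d i \<notin> region face_A1"
      unfolding region_A1 outside_A1_def lin_def mem_Collect_eq vector_add_component vector_minus_component vector_scaleR_component
      by (elim disjE; hypsubst; simp add: previous_vertex_def next_vertex_def face_A1_def; simp add: pt_simps)
  qed simp
    ultimately have "\<forall>\<^sub>F t in at_right (0::real). False" by eventually_elim simp
    then show False by (simp add: trivial_limit_at_right_real)
  qed
  have 9: "length face_A1 = 9" by (simp add: face_A1_def)
  have "i \<in> reflex_corners face_A1 \<longleftrightarrow> i = 3 \<or> i = 5 \<or> i = 8" for i
  proof (cases "i < 9")
    case True
    then have "(i = 0 \<or> i = 1 \<or> i = 2 \<or> i = 4 \<or> i = 6 \<or> i = 7) \<noteq> (i = 3 \<or> i = 5 \<or> i = 8)" by (auto simp: less_9_iff)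
    then show ?thesis using convex[of i] reflex[of i] True
      unfolding reflex_corners_def mem_Collect_eq 9 interior_angle_gt_pi_iff[OF not_collinear_A1[OF True]] by blast
  qed (auto simp: reflex_corners_def 9)
  then show ?thesis by auto
qed

text \<open>The positions are those of \<open>pt 24\<close> and \<open>pt 20\<close>.\<close>

lemma reflex_corners_B1: "reflex_corners face_B1 = {2, 7}"
proof -
  let ?d = "\<lambda>i. previous_vertex face_B1 i - face_B1 ! i + (next_vertex face_B1 i - face_B1 ! i)"
  have convex: "\<forall>\<^sub>F t in at_right 0. face_B1 ! i + t *\<^sub>R ?d i \<in> region face_B1"
    if "i = 0 \<or> i = 1 \<or> i = 3 \<or> i = 4 \<or> i = 5 \<or> i = 6 \<or> i = 8" for i
    unfolding eventually_at_right_field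
  proof (intro exI[of _ "1 / 1000"] conjI allI impI)
    fix t :: real assume "0 < t" "t < 1 / 1000"
    with that show "face_B1 ! i + t *\<^sub>R ?d i \<in> region face_B1"
      unfolding region_B1 outside_B1_def lin_def mem_Collect_eq vector_add_component vector_minus_component vector_scaleR_component
      by (elim disjE; hypsubst; simp add: previous_vertex_def next_vertex_def face_B1_def; simp add: pt_simps)
  qed simp
  have reflex: "\<not> (\<forall>\<^sub>F t in at_right 0. face_B1 ! i + t *\<^sub>R ?d i \<in> region face_B1)"
    if "i = 2 \<or> i = 7" for i
  proof
    assume "\<forall>\<^sub>F t in at_right 0. face_B1 ! i + t *\<^sub>R ?d i \<in> region face_B1"
    moreover have "\<forall>\<^sub>F t in at_right 0. face_B1 ! i + t *\<^sub>R ?d i \<notin> region face_B1"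
      unfolding eventually_at_right_field
  proof (intro exI[of _ "1 / 1000"] conjI allI impI)
    fix t :: real assume "0 < t" "t < 1 / 1000"
    with that show "face_B1 ! i + t *\<^sub>R ?d i \<notin> region face_B1"
      unfolding region_B1 outside_B1_def lin_def mem_Collect_eq vector_add_component vector_minus_component vector_scaleR_component
      by (elim disjE; hypsubst; simp add: previous_vertex_def next_vertex_def face_B1_def; simp add: pt_simps)
  qed simp
    ultimately have "\<forall>\<^sub>F t in at_right (0::real). False" by eventually_elim simp
    then show False by (simp add: trivial_limit_at_right_real)
  qed
  have 9: "length face_B1 = 9" by (simp add: face_B1_def)
  have "i \<in> reflex_corners face_B1 \<longleftrightarrow> i = 2 \<or> i = 7" for i
  proof (cases "i < 9")
    case True
    then have "(i = 0 \<or> i = 1 \<or> i = 3 \<or> i = 4 \<or> i = 5 \<or> i = 6 \<or> i = 8) \<noteq> (i = 2 \<or> i = 7)" by (auto simp: less_9_iff)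
    then show ?thesis using convex[of i] reflex[of i] True
      unfolding reflex_corners_def mem_Collect_eq 9 interior_angle_gt_pi_iff[OF not_collinear_B1[OF True]] by blast
  qed (auto simp: reflex_corners_def 9)
  then show ?thesis by auto
qed

subsection \<open>Rotations and isometries\<close>

lemma directed_edges_rotate1: "directed_edges (rotate1 f) = directed_edges f"
proof -
  have "zip (rotate1 xs) (rotate1 ys) = rotate1 (zip xs ys)" if "length xs = length ys"
    for xs ys :: polygon
    using that by (cases xs; cases ys) auto
  then show ?thesis by (simp add: directed_edges_eq_zip)
qed

lemma edges_of_rotate1: "edges_of (rotate1 f) = edges_of f"
  by (simp add: edges_of_def directed_edges_rotate1)

lemma region_rotate1: "region (rotate1 f) = region f" "polygon_interior (rotate1 f) = polygon_interior f"
  by (simp_all add: region_def polygon_interior_def boundary_curve_def edges_of_rotate1)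

lemma vertices_rotate1:
  assumes "i < length f"
  shows "rotate1 f ! i = f ! (Suc i mod length f)"
    "next_vertex (rotate1 f) i = next_vertex f (Suc i mod length f)"
    "previous_vertex (rotate1 f) i = previous_vertex f (Suc i mod length f)"
proof -
  show "rotate1 f ! i = f ! (Suc i mod length f)" using assms by (simp add: nth_rotate1)
  have "Suc i mod length f < length f" "(i + length f - 1) mod length f < length f"
    using assms by (auto intro: mod_less_divisor)
  then show "next_vertex (rotate1 f) i = next_vertex f (Suc i mod length f)"
    by (simp add: next_vertex_def nth_rotate1)
  have "(Suc i mod length f + length f - 1) mod length f = i"
    using assms by (cases "Suc i = length f") auto
  moreover have "Suc ((i + length f - 1) mod length f) mod length f = i"
    using assms by (metis Suc_pred' add_gr_0 length_greater_0_conv list.size(3) mod_Suc_eq mod_add_self2 mod_less not_less_zero)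
  ultimately show "previous_vertex (rotate1 f) i = previous_vertex f (Suc i mod length f)"
    using \<open>(i + length f - 1) mod length f < length f\<close>
    by (simp add: previous_vertex_def nth_rotate1)
qed

lemma bij_betw_Suc_mod: "bij_betw (\<lambda>i. Suc i mod n) {..<n} {..<n}"
proof (cases n)
  case (Suc m)
  have "inj_on (\<lambda>i. Suc i mod n) {..<n}"
    by (auto simp: inj_on_def mod_Suc Suc split: if_splits)
  moreover have "(\<lambda>i. Suc i mod n) ` {..<n} \<subseteq> {..<n}" using Suc by auto
  ultimately show ?thesis by (simp add: bij_betw_def endo_inj_surj)
qed simp

text \<open>A rotation of the list shifts the positions of the corners cyclically, so their set
  changes but not their number.\<close>

lemma card_reflex_corners_rotate1: "card (reflex_corners (rotate1 f)) = card (reflex_corners f)"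
proof -
  let ?s = "\<lambda>i. Suc i mod length f"
  have "interior_angle (rotate1 f) i = interior_angle f (?s i)" if "i < length f" for i
    unfolding interior_angle_def vertices_rotate1[OF that] region_rotate1 ..
  moreover have "?s i < length f" if "i < length f" for i
    using that mod_less_divisor[of "length f"] by (metis length_greater_0_conv list.size(3) not_less_zero)
  ultimately have 1: "reflex_corners (rotate1 f) = {i \<in> {..<length f}. ?s i \<in> reflex_corners f}"
    by (auto simp: reflex_corners_def)
  have b: "bij_betw ?s {..<length f} {..<length f}" by (rule bij_betw_Suc_mod)
  have "?s ` {i \<in> {..<length f}. ?s i \<in> reflex_corners f} = {..<length f} \<inter> reflex_corners f"
    using bij_betw_imp_surj_on[OF b] by auto
  then have 2: "?s ` reflex_corners (rotate1 f) = reflex_corners f"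
    unfolding 1 by (auto simp: reflex_corners_def)
  have "inj_on ?s (reflex_corners (rotate1 f))"
    unfolding 1 by (rule inj_on_subset[OF bij_betw_imp_inj_on[OF b]]) auto
  then show ?thesis using card_image 2 by metis
qed

lemma simple_polygon_rotate1:
  assumes "simple_polygon f"
  shows "simple_polygon (rotate1 f)"
proof -
  have "\<not> collinear {previous_vertex (rotate1 f) i, rotate1 f ! i, next_vertex (rotate1 f) i}"
    if "i < length f" for i
  proof -
    have "Suc i mod length f < length f"
      using that mod_less_divisor[of "length f"] by (metis length_greater_0_conv list.size(3) not_less_zero)
    then show ?thesis using assms unfolding vertices_rotate1[OF that] simple_polygon_def by blast
  qed
  then show ?thesis using assms by (simp add: simple_polygon_def edges_of_rotate1)
qed

lemma oriented_cycle_rotate: "oriented_cycle (rotate k f) = oriented_cycle f"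
proof (intro equalityI subsetI)
  fix g assume "g \<in> oriented_cycle (rotate k f)"
  then show "g \<in> oriented_cycle f" by (auto simp: oriented_cycle_def rotate_rotate)
next
  fix g assume "g \<in> oriented_cycle f"
  then obtain j where j: "g = rotate j f" by (auto simp: oriented_cycle_def)
  have "rotate (length f - k mod length f) (rotate k f) = f"
  proof (cases "f = []")
    case False
    then have "k mod length f \<le> length f" by (simp add: less_imp_le)
    then have "rotate (length f - k mod length f) (rotate (k mod length f) f) = f"
      by (simp add: rotate_rotate rotate_id)
    then show ?thesis by (simp only: rotate_conv_mod[of k f, symmetric])
  qed simp
  then have "g = rotate (j + (length f - k mod length f)) (rotate k f)"
    unfolding j by (metis rotate_rotate)
  then show "g \<in> oriented_cycle (rotate k f)" unfolding oriented_cycle_def by blast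
qed

text \<open>Continuity gives one inclusion for every set; for an involution the other one is the
  same inclusion applied to the image set.\<close>

lemma connected_component_set_involution:
  fixes T :: "'a::real_normed_vector \<Rightarrow> 'a"
  assumes "continuous_on UNIV T" "\<And>x. T (T x) = x" "x \<in> S"
  shows "connected_component_set (T ` S) (T x) = T ` connected_component_set S x"
proof -
  have *: "T ` connected_component_set S x \<subseteq> connected_component_set (T ` S) (T x)" if "x \<in> S" for S x
  proof (rule connected_component_maximal)
    show "connected (T ` connected_component_set S x)"
      by (intro connected_continuous_image continuous_on_subset[OF assms(1)]) auto
    show "T ` connected_component_set S x \<subseteq> T ` S"
      by (intro image_mono connected_component_subset)
  qed (use that in \<open>auto simp: connected_component_refl\<close>)
  have TT: "T ` T ` X = X" for X using assms(2) by (force simp: image_image)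
  have "T ` connected_component_set (T ` S) (T x) \<subseteq> connected_component_set S x"
    using *[of "T x" "T ` S"] assms(2,3) by (simp add: TT)
  then have "connected_component_set (T ` S) (T x) \<subseteq> T ` connected_component_set S x"
    using TT by blast
  then show ?thesis using *[OF assms(3)] by blast
qed

locale orthogonal_involution =
  fixes T :: "real^3 \<Rightarrow> real^3"
  assumes orthogonal: "orthogonal_transformation T" and involution: "T (T x) = x"
begin

lemma linear: "linear T"
  using orthogonal by (rule orthogonal_transformation_linear)

lemma inj: "inj T"
  using orthogonal by (rule orthogonal_transformation_inj)

text \<open>Being its own inverse, the map turns a set given by sign conditions into the set given
  by the same conditions at \<open>T x\<close>, with no existential quantifier left.\<close>

lemma image_eq_vimage: "T ` S = {x. T x \<in> S}"
proof (intro equalityI subsetI)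
  fix x assume "x \<in> {x. T x \<in> S}"
  then have "T (T x) \<in> T ` S" by blast
  then show "x \<in> T ` S" by (simp add: involution)
qed (auto simp: involution)

lemma edges_of_map: "edges_of (map T f) = (`) T ` edges_of f"
proof -
  have "directed_edges (map T f) = map_prod T T ` directed_edges f"
    unfolding directed_edges_eq_zip by (simp add: rotate1_map zip_map_map map_prod_def)
  then show ?thesis unfolding edges_of_def by (simp add: image_image split_beta)
qed

lemma boundary_curve_map: "boundary_curve (map T f) = T ` boundary_curve f"
  unfolding boundary_curve_def edges_of_map
  by (simp add: convex_hull_linear_image[OF linear] image_UN)

lemma polygon_interior_map: "polygon_interior (map T f) = T ` polygon_interior f"
proof -
  let ?S = "affine hull (set f) - boundary_curve f"
  have S: "affine hull (set (map T f)) - boundary_curve (map T f) = T ` ?S"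
    using affine_hull_linear_image[of T "set f"] linear inj
    by (simp add: boundary_curve_map image_set_diff linear_conv_bounded_linear)
  have "continuous_on UNIV T" using linear by (simp add: linear_continuous_on linear_conv_bounded_linear)
  then have *: "connected_component_set (T ` ?S) (T x) = T ` connected_component_set ?S x" if "x \<in> ?S" for x
    using connected_component_set_involution[OF _ involution that] by blast
  have b: "bounded (T ` X) \<longleftrightarrow> bounded X" for X
  proof -
    have "T ` T ` X = X" using involution by (force simp: image_image)
    then show ?thesis using linear bounded_linear_image
      by (metis linear_conv_bounded_linear)
  qed
  show ?thesis unfolding polygon_interior_def S using * b by auto
qed

lemma region_map: "region (map T f) = T ` region f"
  by (simp add: region_def boundary_curve_map polygon_interior_map image_Un)

lemma collinear_map: "collinear (T ` S) \<longleftrightarrow> collinear S"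
  by (simp add: collinear_aff_dim aff_dim_injective_linear_image[OF linear inj])

lemma vertices_map:
  assumes "i < length f"
  shows "map T f ! i = T (f ! i)" "next_vertex (map T f) i = T (next_vertex f i)"
    "previous_vertex (map T f) i = T (previous_vertex f i)"
proof -
  have "Suc i mod length f < length f" "(i + length f - 1) mod length f < length f"
    using assms by (auto intro: mod_less_divisor)
  then show "map T f ! i = T (f ! i)" "next_vertex (map T f) i = T (next_vertex f i)"
    "previous_vertex (map T f) i = T (previous_vertex f i)"
    using assms by (simp_all add: next_vertex_def previous_vertex_def)
qed

lemma simple_polygon_map:
  assumes "simple_polygon f"
  shows "simple_polygon (map T f)"
proof -
  have "distinct (map T f)"
    using assms inj_on_subset[OF inj subset_UNIV] by (simp add: simple_polygon_def distinct_map)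
  moreover have "coplanar (set (map T f))"
    using assms linear unfolding simple_polygon_def by (simp add: coplanar_linear_image)
  moreover have "\<not> collinear {previous_vertex (map T f) i, map T f ! i, next_vertex (map T f) i}"
    if "i < length f" for i
    using assms that collinear_map[of "{previous_vertex f i, f ! i, next_vertex f i}"]
    unfolding vertices_map[OF that] simple_polygon_def by simp
  moreover have "convex hull (T ` e) \<inter> convex hull (T ` e') = T ` e \<inter> T ` e'"
    if "e \<in> edges_of f" "e' \<in> edges_of f" "T ` e \<noteq> T ` e'" for e e'
  proof -
    have "convex hull e \<inter> convex hull e' = e \<inter> e'"
      using assms that unfolding simple_polygon_def by metis
    then show ?thesis
      using image_Int[OF inj] by (metis convex_hull_linear_image[OF linear])
  qed
  ultimately show ?thesis
    using assms unfolding simple_polygon_def edges_of_map by auto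
qed

lemma reflex_corners_map: "reflex_corners (map T f) = reflex_corners f"
proof -
  have "interior_angle (map T f) i = interior_angle f i" if "i < length f" for i
  proof -
    have "T x - T y = T (x - y)" "T x + T y = T (x + y)" "t *\<^sub>R T x = T (t *\<^sub>R x)" for x y t
      using linear by (simp_all add: linear_diff linear_add linear_scale)
    moreover have "T x \<bullet> T y = x \<bullet> y" "norm (T x) = norm x" for x y
      using orthogonal by (simp_all add: orthogonal_transformation_def orthogonal_transformation_norm[OF orthogonal])
    moreover have "T x \<in> region (map T f) \<longleftrightarrow> x \<in> region f" for x
      unfolding region_map by (rule inj_image_mem_iff[OF inj])
    ultimately show ?thesis unfolding interior_angle_def vertices_map[OF that] Let_def by simp
  qed
  then show ?thesis by (auto simp: reflex_corners_def)
qed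

end

lemma orthogonal_transformation_half_turn:
  "orthogonal_transformation half_turn_x" "orthogonal_transformation half_turn_y" "orthogonal_transformation half_turn_z"
  unfolding orthogonal_transformation_def half_turn_x_def half_turn_y_def half_turn_z_def
  by (auto intro!: linearI simp: vec3_eq_iff inner_vec_def sum_3 vector_3)

interpretation half_turn_x: orthogonal_involution half_turn_x
  by unfold_locales (simp_all add: orthogonal_transformation_half_turn, simp add: half_turn_x_def vec3_eq_iff)

interpretation half_turn_y: orthogonal_involution half_turn_y
  by unfold_locales (simp_all add: orthogonal_transformation_half_turn, simp add: half_turn_y_def vec3_eq_iff)

interpretation half_turn_z: orthogonal_involution half_turn_z
  by unfold_locales (simp_all add: orthogonal_transformation_half_turn, simp add: half_turn_z_def vec3_eq_iff)

text \<open>A half-turn changes two signs of the coefficients, and the eight face forms are permuted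
  among themselves. Conditions transported from a model face are thus again conditions on the eight
  forms.\<close>

lemma lin_half_turn:
  "lin a b c d (half_turn_x p) = lin a (- b) (- c) d p"
  "lin a b c d (half_turn_y p) = lin (- a) b (- c) d p"
  "lin a b c d (half_turn_z p) = lin (- a) (- b) c d p"
  by (simp_all add: lin_def half_turn_x_def half_turn_y_def half_turn_z_def)

lemma half_turn_pt:
  "half_turn_x (pt 1) = pt 3" "half_turn_x (pt 2) = pt 4" "half_turn_x (pt 3) = pt 1" "half_turn_x (pt 4) = pt 2" "half_turn_x (pt 5) = pt 7" "half_turn_x (pt 6) = pt 8" "half_turn_x (pt 7) = pt 5" "half_turn_x (pt 8) = pt 6" "half_turn_x (pt 9) = pt 11" "half_turn_x (pt 10) = pt 12" "half_turn_x (pt 11) = pt 9" "half_turn_x (pt 12) = pt 10" "half_turn_x (pt 13) = pt 15" "half_turn_x (pt 14) = pt 16" "half_turn_x (pt 15) = pt 13" "half_turn_x (pt 16) = pt 14" "half_turn_x (pt 17) = pt 19" "half_turn_x (pt 18) = pt 20" "half_turn_x (pt 19) = pt 17" "half_turn_x (pt 20) = pt 18" "half_turn_x (pt 21) = pt 23" "half_turn_x (pt 22) = pt 24" "half_turn_x (pt 23) = pt 21" "half_turn_x (pt 24) = pt 22"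
  "half_turn_y (pt 1) = pt 4" "half_turn_y (pt 2) = pt 3" "half_turn_y (pt 3) = pt 2" "half_turn_y (pt 4) = pt 1" "half_turn_y (pt 5) = pt 8" "half_turn_y (pt 6) = pt 7" "half_turn_y (pt 7) = pt 6" "half_turn_y (pt 8) = pt 5" "half_turn_y (pt 9) = pt 12" "half_turn_y (pt 10) = pt 11" "half_turn_y (pt 11) = pt 10" "half_turn_y (pt 12) = pt 9" "half_turn_y (pt 13) = pt 16" "half_turn_y (pt 14) = pt 15" "half_turn_y (pt 15) = pt 14" "half_turn_y (pt 16) = pt 13" "half_turn_y (pt 17) = pt 20" "half_turn_y (pt 18) = pt 19" "half_turn_y (pt 19) = pt 18" "half_turn_y (pt 20) = pt 17" "half_turn_y (pt 21) = pt 24" "half_turn_y (pt 22) = pt 23" "half_turn_y (pt 23) = pt 22" "half_turn_y (pt 24) = pt 21"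
  "half_turn_z (pt 1) = pt 2" "half_turn_z (pt 2) = pt 1" "half_turn_z (pt 3) = pt 4" "half_turn_z (pt 4) = pt 3" "half_turn_z (pt 5) = pt 6" "half_turn_z (pt 6) = pt 5" "half_turn_z (pt 7) = pt 8" "half_turn_z (pt 8) = pt 7" "half_turn_z (pt 9) = pt 10" "half_turn_z (pt 10) = pt 9" "half_turn_z (pt 11) = pt 12" "half_turn_z (pt 12) = pt 11" "half_turn_z (pt 13) = pt 14" "half_turn_z (pt 14) = pt 13" "half_turn_z (pt 15) = pt 16" "half_turn_z (pt 16) = pt 15" "half_turn_z (pt 17) = pt 18" "half_turn_z (pt 18) = pt 17" "half_turn_z (pt 19) = pt 20" "half_turn_z (pt 20) = pt 19" "half_turn_z (pt 21) = pt 22" "half_turn_z (pt 22) = pt 21" "half_turn_z (pt 23) = pt 24" "half_turn_z (pt 24) = pt 23"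
  by (simp_all add: half_turn_x_def half_turn_y_def half_turn_z_def pt_simps vec3_eq_iff)

subsection \<open>The eight faces\<close>

lemma rotate_invariants:
  "region (rotate k f) = region f" "polygon_interior (rotate k f) = polygon_interior f"
  "card (reflex_corners (rotate k f)) = card (reflex_corners f)"
  "simple_polygon f \<Longrightarrow> simple_polygon (rotate k f)"
  by (induction k) (simp_all add: rotate_Suc region_rotate1 card_reflex_corners_rotate1 simple_polygon_rotate1)

definition face_A2 :: polygon where
  "face_A2 = map pt [6, 8, 18, 14, 22, 11, 10, 2, 1]"

text \<open>The rotation only accounts for the vertex at which the prescribed list starts; the same
  holds for the other five images.\<close>

lemma face_A2_eq: "face_A2 = rotate 2 (map half_turn_z face_A1)"
  by (simp add: face_A2_def face_A1_def half_turn_pt rotate_drop_take)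

lemma half_turn_A2:
  "polygon_interior face_A2 = {x. fa2 x = 0 \<and> inside_A1 (half_turn_z x)}"
  "region face_A2 = {x. fa2 x = 0 \<and> \<not> outside_A1 (half_turn_z x)}"
  "simple_polygon face_A2" "card (reflex_corners face_A2) = card (reflex_corners face_A1)"
  unfolding face_A2_eq rotate_invariants
  by (simp_all add: half_turn_z.region_map half_turn_z.polygon_interior_map half_turn_z.image_eq_vimage
      polygon_interior_A1 region_A1 lin_half_turn half_turn_z.reflex_corners_map
      rotate_invariants half_turn_z.simple_polygon_map simple_polygon_A1)

definition face_A3 :: polygon where
  "face_A3 = map pt [7, 5, 19, 15, 23, 10, 11, 3, 4]"

lemma face_A3_eq: "face_A3 = rotate 2 (map half_turn_x face_A1)"
  by (simp add: face_A3_def face_A1_def half_turn_pt rotate_drop_take)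

lemma half_turn_A3:
  "polygon_interior face_A3 = {x. fa3 x = 0 \<and> inside_A1 (half_turn_x x)}"
  "region face_A3 = {x. fa3 x = 0 \<and> \<not> outside_A1 (half_turn_x x)}"
  "simple_polygon face_A3" "card (reflex_corners face_A3) = card (reflex_corners face_A1)"
  unfolding face_A3_eq rotate_invariants
  by (simp_all add: half_turn_x.region_map half_turn_x.polygon_interior_map half_turn_x.image_eq_vimage
      polygon_interior_A1 region_A1 lin_half_turn half_turn_x.reflex_corners_map
      rotate_invariants half_turn_x.simple_polygon_map simple_polygon_A1)

definition face_A4 :: polygon where
  "face_A4 = map pt [4, 3, 8, 6, 20, 16, 24, 9, 12]"

lemma face_A4_eq: "face_A4 = rotate 0 (map half_turn_y face_A1)"
  by (simp add: face_A4_def face_A1_def half_turn_pt rotate_drop_take)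

lemma half_turn_A4:
  "polygon_interior face_A4 = {x. fa4 x = 0 \<and> inside_A1 (half_turn_y x)}"
  "region face_A4 = {x. fa4 x = 0 \<and> \<not> outside_A1 (half_turn_y x)}"
  "simple_polygon face_A4" "card (reflex_corners face_A4) = card (reflex_corners face_A1)"
  unfolding face_A4_eq rotate_invariants
  by (simp_all add: half_turn_y.region_map half_turn_y.polygon_interior_map half_turn_y.image_eq_vimage
      polygon_interior_A1 region_A1 lin_half_turn half_turn_y.reflex_corners_map
      rotate_invariants half_turn_y.simple_polygon_map simple_polygon_A1)

definition face_B2 :: polygon where
  "face_B2 = map pt [13, 17, 19, 5, 2, 10, 23, 24, 16]"

lemma face_B2_eq: "face_B2 = rotate 5 (map half_turn_z face_B1)"
  by (simp add: face_B2_def face_B1_def half_turn_pt rotate_drop_take)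

lemma half_turn_B2:
  "polygon_interior face_B2 = {x. fb2 x = 0 \<and> inside_B1 (half_turn_z x)}"
  "region face_B2 = {x. fb2 x = 0 \<and> \<not> outside_B1 (half_turn_z x)}"
  "simple_polygon face_B2" "card (reflex_corners face_B2) = card (reflex_corners face_B1)"
  unfolding face_B2_eq rotate_invariants
  by (simp_all add: half_turn_z.region_map half_turn_z.polygon_interior_map half_turn_z.image_eq_vimage
      polygon_interior_B1 region_B1 lin_half_turn half_turn_z.reflex_corners_map
      rotate_invariants half_turn_z.simple_polygon_map simple_polygon_B1)

definition face_B3 :: polygon where
  "face_B3 = map pt [21, 13, 16, 20, 18, 8, 3, 11, 22]"

lemma face_B3_eq: "face_B3 = rotate 3 (map half_turn_x face_B1)"
  by (simp add: face_B3_def face_B1_def half_turn_pt rotate_drop_take)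

lemma half_turn_B3:
  "polygon_interior face_B3 = {x. fb3 x = 0 \<and> inside_B1 (half_turn_x x)}"
  "region face_B3 = {x. fb3 x = 0 \<and> \<not> outside_B1 (half_turn_x x)}"
  "simple_polygon face_B3" "card (reflex_corners face_B3) = card (reflex_corners face_B1)"
  unfolding face_B3_eq rotate_invariants
  by (simp_all add: half_turn_x.region_map half_turn_x.polygon_interior_map half_turn_x.image_eq_vimage
      polygon_interior_B1 region_B1 lin_half_turn half_turn_x.reflex_corners_map
      rotate_invariants half_turn_x.simple_polygon_map simple_polygon_B1)

definition face_B4 :: polygon where
  "face_B4 = map pt [4, 12, 21, 22, 14, 15, 19, 17, 7]"

lemma face_B4_eq: "face_B4 = rotate 0 (map half_turn_y face_B1)"
  by (simp add: face_B4_def face_B1_def half_turn_pt rotate_drop_take)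

lemma half_turn_B4:
  "polygon_interior face_B4 = {x. fb4 x = 0 \<and> inside_B1 (half_turn_y x)}"
  "region face_B4 = {x. fb4 x = 0 \<and> \<not> outside_B1 (half_turn_y x)}"
  "simple_polygon face_B4" "card (reflex_corners face_B4) = card (reflex_corners face_B1)"
  unfolding face_B4_eq rotate_invariants
  by (simp_all add: half_turn_y.region_map half_turn_y.polygon_interior_map half_turn_y.image_eq_vimage
      polygon_interior_B1 region_B1 lin_half_turn half_turn_y.reflex_corners_map
      rotate_invariants half_turn_y.simple_polygon_map simple_polygon_B1)

lemmas polygon_interior_faces = polygon_interior_A1 half_turn_A2(1) half_turn_A3(1) half_turn_A4(1) polygon_interior_B1 half_turn_B2(1) half_turn_B3(1) half_turn_B4(1)
  and region_faces = region_A1 half_turn_A2(2) half_turn_A3(2) half_turn_A4(2) region_B1 half_turn_B2(2) half_turn_B3(2) half_turn_B4(2)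

lemmas sign_simps = inside_A1_def outside_A1_def inside_B1_def outside_B1_def lin_half_turn minus_minus

subsection \<open>The solid\<close>

text \<open>Each clause is an intersection of four open half-spaces. As for the faces, the clauses
  have to overlap, since the planes of the faces also run through the interior of the solid.\<close>

definition in_solid :: "real^3 \<Rightarrow> bool" where
  "in_solid x \<longleftrightarrow>
     (fa1 x < 0 \<and> fa2 x < 0 \<and> fa3 x < 0 \<and> fb1 x < 0) \<or>
     (fa1 x < 0 \<and> fa2 x < 0 \<and> fa4 x < 0 \<and> fb2 x < 0) \<or>
     (fa1 x < 0 \<and> fa2 x < 0 \<and> fb1 x < 0 \<and> fb2 x < 0) \<or>
     (fa1 x < 0 \<and> fa3 x < 0 \<and> fa4 x < 0 \<and> fb3 x < 0) \<or>
     (fa2 x < 0 \<and> fa3 x < 0 \<and> fa4 x < 0 \<and> fb4 x < 0) \<or>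
     (fa3 x < 0 \<and> fa4 x < 0 \<and> fb3 x < 0 \<and> fb4 x < 0)"

text \<open>The first fourteen clauses are wedges between two planes and extend to infinity. The
  last one is the cavity: the open tetrahedron of the \<open>B\<close> planes, which contains the
  origin.\<close>

definition off_solid :: "real^3 \<Rightarrow> bool" where
  "off_solid x \<longleftrightarrow>
     (fa4 x > 0 \<and> fb4 x < 0) \<or>
     (fa4 x > 0 \<and> fb1 x > 0) \<or>
     (fa3 x > 0 \<and> fb3 x < 0) \<or>
     (fa3 x > 0 \<and> fb2 x > 0) \<or>
     (fa3 x > 0 \<and> fa4 x > 0) \<or>
     (fa2 x > 0 \<and> fb2 x < 0) \<or>
     (fa2 x > 0 \<and> fb3 x > 0) \<or>
     (fa2 x > 0 \<and> fa4 x > 0) \<or>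
     (fa2 x > 0 \<and> fa3 x > 0) \<or>
     (fa1 x > 0 \<and> fb1 x < 0) \<or>
     (fa1 x > 0 \<and> fb4 x > 0) \<or>
     (fa1 x > 0 \<and> fa4 x > 0) \<or>
     (fa1 x > 0 \<and> fa3 x > 0) \<or>
     (fa1 x > 0 \<and> fa2 x > 0) \<or>
     (fb1 x > 0 \<and> fb2 x > 0 \<and> fb3 x > 0 \<and> fb4 x > 0)"

definition nonagon_faces :: "polygon set" where
  "nonagon_faces = {face_A1, face_A2, face_A3, face_A4, face_B1, face_B2, face_B3, face_B4}"

text \<open>Without the equation of the plane, \<open>inside_A1\<close> describes an open
  neighbourhood of the face interior on which the sign of the form of the face alone decides between
  solid and exterior. This yields the outward orientation later; the third claim keeps the face off
  both open sets.\<close>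

lemma sides_A1:
  "inside_A1 x \<Longrightarrow> fa1 x > 0 \<Longrightarrow> off_solid x"
  "inside_A1 x \<Longrightarrow> fa1 x < 0 \<Longrightarrow> in_solid x"
  "x \<in> region face_A1 \<Longrightarrow> \<not> in_solid x \<and> \<not> off_solid x"
  unfolding in_solid_def off_solid_def sign_simps region_faces mem_Collect_eq unfolding lin_def by argo+

lemma sides_A2:
  "inside_A1 (half_turn_z x) \<Longrightarrow> fa2 x > 0 \<Longrightarrow> off_solid x"
  "inside_A1 (half_turn_z x) \<Longrightarrow> fa2 x < 0 \<Longrightarrow> in_solid x"
  "x \<in> region face_A2 \<Longrightarrow> \<not> in_solid x \<and> \<not> off_solid x"
  unfolding in_solid_def off_solid_def sign_simps region_faces mem_Collect_eq unfolding lin_def by argo+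

lemma sides_A3:
  "inside_A1 (half_turn_x x) \<Longrightarrow> fa3 x > 0 \<Longrightarrow> off_solid x"
  "inside_A1 (half_turn_x x) \<Longrightarrow> fa3 x < 0 \<Longrightarrow> in_solid x"
  "x \<in> region face_A3 \<Longrightarrow> \<not> in_solid x \<and> \<not> off_solid x"
  unfolding in_solid_def off_solid_def sign_simps region_faces mem_Collect_eq unfolding lin_def by argo+

lemma sides_A4:
  "inside_A1 (half_turn_y x) \<Longrightarrow> fa4 x > 0 \<Longrightarrow> off_solid x"
  "inside_A1 (half_turn_y x) \<Longrightarrow> fa4 x < 0 \<Longrightarrow> in_solid x"
  "x \<in> region face_A4 \<Longrightarrow> \<not> in_solid x \<and> \<not> off_solid x"
  unfolding in_solid_def off_solid_def sign_simps region_faces mem_Collect_eq unfolding lin_def by argo+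

lemma sides_B1:
  "inside_B1 x \<Longrightarrow> fb1 x > 0 \<Longrightarrow> off_solid x"
  "inside_B1 x \<Longrightarrow> fb1 x < 0 \<Longrightarrow> in_solid x"
  "x \<in> region face_B1 \<Longrightarrow> \<not> in_solid x \<and> \<not> off_solid x"
  unfolding in_solid_def off_solid_def sign_simps region_faces mem_Collect_eq unfolding lin_def by argo+

lemma sides_B2:
  "inside_B1 (half_turn_z x) \<Longrightarrow> fb2 x > 0 \<Longrightarrow> off_solid x"
  "inside_B1 (half_turn_z x) \<Longrightarrow> fb2 x < 0 \<Longrightarrow> in_solid x"
  "x \<in> region face_B2 \<Longrightarrow> \<not> in_solid x \<and> \<not> off_solid x"
  unfolding in_solid_def off_solid_def sign_simps region_faces mem_Collect_eq unfolding lin_def by argo+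

lemma sides_B3:
  "inside_B1 (half_turn_x x) \<Longrightarrow> fb3 x > 0 \<Longrightarrow> off_solid x"
  "inside_B1 (half_turn_x x) \<Longrightarrow> fb3 x < 0 \<Longrightarrow> in_solid x"
  "x \<in> region face_B3 \<Longrightarrow> \<not> in_solid x \<and> \<not> off_solid x"
  unfolding in_solid_def off_solid_def sign_simps region_faces mem_Collect_eq unfolding lin_def by argo+

lemma sides_B4:
  "inside_B1 (half_turn_y x) \<Longrightarrow> fb4 x > 0 \<Longrightarrow> off_solid x"
  "inside_B1 (half_turn_y x) \<Longrightarrow> fb4 x < 0 \<Longrightarrow> in_solid x"
  "x \<in> region face_B4 \<Longrightarrow> \<not> in_solid x \<and> \<not> off_solid x"
  unfolding in_solid_def off_solid_def sign_simps region_faces mem_Collect_eq unfolding lin_def by argo+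

lemma in_or_off_solid: "\<not> in_solid x \<and> \<not> off_solid x \<Longrightarrow> x \<in> surface nonagon_faces"
  unfolding surface_def nonagon_faces_def UN_insert UN_empty Un_iff empty_iff simp_thms
    in_solid_def off_solid_def sign_simps region_faces mem_Collect_eq unfolding lin_def by argo

lemma in_solid_not_off_solid: "in_solid x \<Longrightarrow> \<not> off_solid x"
  unfolding in_solid_def off_solid_def lin_def by argo

lemma in_solid_bounded: "in_solid x \<Longrightarrow> \<bar>x $ 1\<bar> \<le> 10 \<and> \<bar>x $ 2\<bar> \<le> 10 \<and> \<bar>x $ 3\<bar> \<le> 10"
  unfolding in_solid_def lin_def abs_le_iff by argo

lemma segment_6_8:
  "x \<in> convex hull {pt 6, pt 8} \<longleftrightarrow>
    fa2 x = 0 \<and> fa4 x = 0 \<and> fb1 x \<le> 0 \<and> fb3 x \<le> 0"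
  by (rule segment_lin_le_le) (simp_all add: det3_def lin_def pt_simps)

lemma segment_8_18:
  "x \<in> convex hull {pt 8, pt 18} \<longleftrightarrow>
    fa2 x = 0 \<and> fb3 x = 0 \<and> fa4 x \<le> 0 \<and> fb1 x \<le> 0"
  by (rule segment_lin_le_le) (simp_all add: det3_def lin_def pt_simps)

lemma segment_14_22:
  "x \<in> convex hull {pt 14, pt 22} \<longleftrightarrow>
    fa2 x = 0 \<and> fb4 x = 0 \<and> fb1 x \<ge> 0 \<and> fb3 x \<ge> 0"
  by (rule segment_lin_ge_ge) (simp_all add: det3_def lin_def pt_simps)

lemma segment_22_11:
  "x \<in> convex hull {pt 22, pt 11} \<longleftrightarrow>
    fa2 x = 0 \<and> fb3 x = 0 \<and> fb4 x \<le> 0 \<and> fa3 x \<le> 0"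
  by (rule segment_lin_le_le) (simp_all add: det3_def lin_def pt_simps)

lemma segment_11_10:
  "x \<in> convex hull {pt 11, pt 10} \<longleftrightarrow>
    fa2 x = 0 \<and> fa3 x = 0 \<and> fb3 x \<ge> 0 \<and> fb2 x \<ge> 0"
  by (rule segment_lin_ge_ge) (simp_all add: det3_def lin_def pt_simps)

lemma segment_10_2:
  "x \<in> convex hull {pt 10, pt 2} \<longleftrightarrow>
    fa2 x = 0 \<and> fb2 x = 0 \<and> fa3 x \<ge> 0 \<and> fa1 x \<le> 0"
  by (rule segment_lin_ge_le) (simp_all add: det3_def lin_def pt_simps)

lemma segment_5_19:
  "x \<in> convex hull {pt 5, pt 19} \<longleftrightarrow>
    fa3 x = 0 \<and> fb2 x = 0 \<and> fa1 x \<le> 0 \<and> fb4 x \<le> 0"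
  by (rule segment_lin_le_le) (simp_all add: det3_def lin_def pt_simps)

lemma segment_19_15:
  "x \<in> convex hull {pt 19, pt 15} \<longleftrightarrow>
    fa3 x = 0 \<and> fb4 x = 0 \<and> fb2 x \<ge> 0 \<and> fb1 x \<ge> 0"
  by (rule segment_lin_ge_ge) (simp_all add: det3_def lin_def pt_simps)

lemma segment_23_10:
  "x \<in> convex hull {pt 23, pt 10} \<longleftrightarrow>
    fa3 x = 0 \<and> fb2 x = 0 \<and> fb1 x \<le> 0 \<and> fa2 x \<le> 0"
  by (rule segment_lin_le_le) (simp_all add: det3_def lin_def pt_simps)

lemma segment_11_3:
  "x \<in> convex hull {pt 11, pt 3} \<longleftrightarrow>
    fa3 x = 0 \<and> fb3 x = 0 \<and> fa2 x \<ge> 0 \<and> fa4 x \<le> 0"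
  by (rule segment_lin_ge_le) (simp_all add: det3_def lin_def pt_simps)

lemma segment_3_4:
  "x \<in> convex hull {pt 3, pt 4} \<longleftrightarrow>
    fa3 x = 0 \<and> fa4 x = 0 \<and> fb3 x \<le> 0 \<and> fb4 x \<le> 0"
  by (rule segment_lin_le_le) (simp_all add: det3_def lin_def pt_simps)

lemma segment_4_7:
  "x \<in> convex hull {pt 4, pt 7} \<longleftrightarrow>
    fa3 x = 0 \<and> fb4 x = 0 \<and> fa4 x \<le> 0 \<and> fa1 x \<ge> 0"
  by (rule segment_lin_le_ge) (simp_all add: det3_def lin_def pt_simps)

lemma segment_3_8:
  "x \<in> convex hull {pt 3, pt 8} \<longleftrightarrow>
    fa4 x = 0 \<and> fb3 x = 0 \<and> fa3 x \<le> 0 \<and> fa2 x \<ge> 0"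
  by (rule segment_lin_le_ge) (simp_all add: det3_def lin_def pt_simps)

lemma segment_20_16:
  "x \<in> convex hull {pt 20, pt 16} \<longleftrightarrow>
    fa4 x = 0 \<and> fb3 x = 0 \<and> fb1 x \<ge> 0 \<and> fb2 x \<ge> 0"
  by (rule segment_lin_ge_ge) (simp_all add: det3_def lin_def pt_simps)

lemma segment_16_24:
  "x \<in> convex hull {pt 16, pt 24} \<longleftrightarrow>
    fa4 x = 0 \<and> fb2 x = 0 \<and> fb3 x \<ge> 0 \<and> fb1 x \<ge> 0"
  by (rule segment_lin_ge_ge) (simp_all add: det3_def lin_def pt_simps)

lemma segment_12_4:
  "x \<in> convex hull {pt 12, pt 4} \<longleftrightarrow>
    fa4 x = 0 \<and> fb4 x = 0 \<and> fa1 x \<ge> 0 \<and> fa3 x \<le> 0"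
  by (rule segment_lin_ge_le) (simp_all add: det3_def lin_def pt_simps)

lemma segment_17_19:
  "x \<in> convex hull {pt 17, pt 19} \<longleftrightarrow>
    fb2 x = 0 \<and> fb4 x = 0 \<and> fa1 x \<le> 0 \<and> fa3 x \<le> 0"
  by (rule segment_lin_le_le) (simp_all add: det3_def lin_def pt_simps)

lemma segment_16_13:
  "x \<in> convex hull {pt 16, pt 13} \<longleftrightarrow>
    fb2 x = 0 \<and> fb3 x = 0 \<and> fa4 x \<le> 0 \<and> fa1 x \<le> 0"
  by (rule segment_lin_le_le) (simp_all add: det3_def lin_def pt_simps)

lemma segment_22_21:
  "x \<in> convex hull {pt 22, pt 21} \<longleftrightarrow>
    fb3 x = 0 \<and> fb4 x = 0 \<and> fa2 x \<le> 0 \<and> fa1 x \<le> 0"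
  by (rule segment_lin_le_le) (simp_all add: det3_def lin_def pt_simps)

text \<open>Only this inclusion needs the geometry of the two faces; that common edges and vertices
  belong to both regions holds for any polygons.\<close>

lemma meet_A1_A2:
  "x \<in> region face_A1 \<Longrightarrow> x \<in> region face_A2 \<Longrightarrow>
    x \<in> convex hull {pt 1, pt 2}"
  unfolding sign_simps region_faces mem_Collect_eq segment_1_2  unfolding lin_def by argo

lemma meet_A1_A3:
  "x \<in> region face_A1 \<Longrightarrow> x \<in> region face_A3 \<Longrightarrow>
    x \<in> convex hull {pt 5, pt 7}"
  unfolding sign_simps region_faces mem_Collect_eq segment_5_7  unfolding lin_def by argo

lemma meet_A1_A4:
  "x \<in> region face_A1 \<Longrightarrow> x \<in> region face_A4 \<Longrightarrow>
    x \<in> convex hull {pt 12, pt 9}"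
  unfolding sign_simps region_faces mem_Collect_eq segment_12_9  unfolding lin_def by argo

lemma meet_A1_B1:
  "x \<in> region face_A1 \<Longrightarrow> x \<in> region face_B1 \<Longrightarrow>
    x \<in> convex hull {pt 9, pt 1}"
  unfolding sign_simps region_faces mem_Collect_eq segment_9_1  unfolding lin_def by argo

lemma meet_A1_B2:
  "x \<in> region face_A1 \<Longrightarrow> x \<in> region face_B2 \<Longrightarrow>
    x \<in> convex hull {pt 2, pt 5} \<or> x \<in> convex hull {pt 17, pt 13}"
  unfolding sign_simps region_faces mem_Collect_eq segment_2_5 segment_17_13  unfolding lin_def by argo

lemma meet_A1_B3:
  "x \<in> region face_A1 \<Longrightarrow> x \<in> region face_B3 \<Longrightarrow>
    x \<in> convex hull {pt 13, pt 21}"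
  unfolding sign_simps region_faces mem_Collect_eq segment_13_21  unfolding lin_def by argo

lemma meet_A1_B4:
  "x \<in> region face_A1 \<Longrightarrow> x \<in> region face_B4 \<Longrightarrow>
    x \<in> convex hull {pt 7, pt 17} \<or> x \<in> convex hull {pt 21, pt 12}"
  unfolding sign_simps region_faces mem_Collect_eq segment_7_17 segment_21_12  unfolding lin_def by argo

lemma meet_A2_A3:
  "x \<in> region face_A2 \<Longrightarrow> x \<in> region face_A3 \<Longrightarrow>
    x \<in> convex hull {pt 11, pt 10}"
  unfolding sign_simps region_faces mem_Collect_eq segment_11_10  unfolding lin_def by argo

lemma meet_A2_A4:
  "x \<in> region face_A2 \<Longrightarrow> x \<in> region face_A4 \<Longrightarrow>
    x \<in> convex hull {pt 6, pt 8}"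
  unfolding sign_simps region_faces mem_Collect_eq segment_6_8  unfolding lin_def by argo

lemma meet_A2_B1:
  "x \<in> region face_A2 \<Longrightarrow> x \<in> region face_B1 \<Longrightarrow>
    x \<in> convex hull {pt 14, pt 18} \<or> x \<in> convex hull {pt 6, pt 1}"
  unfolding sign_simps region_faces mem_Collect_eq segment_14_18 segment_6_1  unfolding lin_def by argo

lemma meet_A2_B2:
  "x \<in> region face_A2 \<Longrightarrow> x \<in> region face_B2 \<Longrightarrow>
    x \<in> convex hull {pt 10, pt 2}"
  unfolding sign_simps region_faces mem_Collect_eq segment_10_2  unfolding lin_def by argo

lemma meet_A2_B3:
  "x \<in> region face_A2 \<Longrightarrow> x \<in> region face_B3 \<Longrightarrow>
    x \<in> convex hull {pt 8, pt 18} \<or> x \<in> convex hull {pt 22, pt 11}"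
  unfolding sign_simps region_faces mem_Collect_eq segment_8_18 segment_22_11  unfolding lin_def by argo

lemma meet_A2_B4:
  "x \<in> region face_A2 \<Longrightarrow> x \<in> region face_B4 \<Longrightarrow>
    x \<in> convex hull {pt 14, pt 22}"
  unfolding sign_simps region_faces mem_Collect_eq segment_14_22  unfolding lin_def by argo

lemma meet_A3_A4:
  "x \<in> region face_A3 \<Longrightarrow> x \<in> region face_A4 \<Longrightarrow>
    x \<in> convex hull {pt 3, pt 4}"
  unfolding sign_simps region_faces mem_Collect_eq segment_3_4  unfolding lin_def by argo

lemma meet_A3_B1:
  "x \<in> region face_A3 \<Longrightarrow> x \<in> region face_B1 \<Longrightarrow>
    x \<in> convex hull {pt 23, pt 15}"
  unfolding sign_simps region_faces mem_Collect_eq segment_23_15  unfolding lin_def by argo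

lemma meet_A3_B2:
  "x \<in> region face_A3 \<Longrightarrow> x \<in> region face_B2 \<Longrightarrow>
    x \<in> convex hull {pt 5, pt 19} \<or> x \<in> convex hull {pt 23, pt 10}"
  unfolding sign_simps region_faces mem_Collect_eq segment_5_19 segment_23_10  unfolding lin_def by argo

lemma meet_A3_B3:
  "x \<in> region face_A3 \<Longrightarrow> x \<in> region face_B3 \<Longrightarrow>
    x \<in> convex hull {pt 11, pt 3}"
  unfolding sign_simps region_faces mem_Collect_eq segment_11_3  unfolding lin_def by argo

lemma meet_A3_B4:
  "x \<in> region face_A3 \<Longrightarrow> x \<in> region face_B4 \<Longrightarrow>
    x \<in> convex hull {pt 19, pt 15} \<or> x \<in> convex hull {pt 4, pt 7}"
  unfolding sign_simps region_faces mem_Collect_eq segment_19_15 segment_4_7  unfolding lin_def by argo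

lemma meet_A4_B1:
  "x \<in> region face_A4 \<Longrightarrow> x \<in> region face_B1 \<Longrightarrow>
    x \<in> convex hull {pt 9, pt 24} \<or> x \<in> convex hull {pt 20, pt 6}"
  unfolding sign_simps region_faces mem_Collect_eq segment_9_24 segment_20_6  unfolding lin_def by argo

lemma meet_A4_B2:
  "x \<in> region face_A4 \<Longrightarrow> x \<in> region face_B2 \<Longrightarrow>
    x \<in> convex hull {pt 16, pt 24}"
  unfolding sign_simps region_faces mem_Collect_eq segment_16_24  unfolding lin_def by argo

lemma meet_A4_B3:
  "x \<in> region face_A4 \<Longrightarrow> x \<in> region face_B3 \<Longrightarrow>
    x \<in> convex hull {pt 3, pt 8} \<or> x \<in> convex hull {pt 20, pt 16}"
  unfolding sign_simps region_faces mem_Collect_eq segment_3_8 segment_20_16  unfolding lin_def by argo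

lemma meet_A4_B4:
  "x \<in> region face_A4 \<Longrightarrow> x \<in> region face_B4 \<Longrightarrow>
    x \<in> convex hull {pt 12, pt 4}"
  unfolding sign_simps region_faces mem_Collect_eq segment_12_4  unfolding lin_def by argo

lemma meet_B1_B2:
  "x \<in> region face_B1 \<Longrightarrow> x \<in> region face_B2 \<Longrightarrow>
    x \<in> convex hull {pt 24, pt 23}"
  unfolding sign_simps region_faces mem_Collect_eq segment_24_23  unfolding lin_def by argo

lemma meet_B1_B3:
  "x \<in> region face_B1 \<Longrightarrow> x \<in> region face_B3 \<Longrightarrow>
    x \<in> convex hull {pt 18, pt 20}"
  unfolding sign_simps region_faces mem_Collect_eq segment_18_20  unfolding lin_def by argo

lemma meet_B1_B4:
  "x \<in> region face_B1 \<Longrightarrow> x \<in> region face_B4 \<Longrightarrow>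
    x \<in> convex hull {pt 15, pt 14}"
  unfolding sign_simps region_faces mem_Collect_eq segment_15_14  unfolding lin_def by argo

lemma meet_B2_B3:
  "x \<in> region face_B2 \<Longrightarrow> x \<in> region face_B3 \<Longrightarrow>
    x \<in> convex hull {pt 16, pt 13}"
  unfolding sign_simps region_faces mem_Collect_eq segment_16_13  unfolding lin_def by argo

lemma meet_B2_B4:
  "x \<in> region face_B2 \<Longrightarrow> x \<in> region face_B4 \<Longrightarrow>
    x \<in> convex hull {pt 17, pt 19}"
  unfolding sign_simps region_faces mem_Collect_eq segment_17_19  unfolding lin_def by argo

lemma meet_B3_B4:
  "x \<in> region face_B3 \<Longrightarrow> x \<in> region face_B4 \<Longrightarrow>
    x \<in> convex hull {pt 22, pt 21}"
  unfolding sign_simps region_faces mem_Collect_eq segment_22_21  unfolding lin_def by argo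

lemma convex_lin: "convex {x. lin a b c d x \<le> 0}" "convex {x. lin a b c d x \<ge> 0}" "convex {x. lin a b c d x = 0}"
    "convex {x. lin a b c d x > 0}"
  unfolding convex_def
  by (auto simp: lin_combination intro!: add_nonpos_nonpos mult_nonneg_nonpos)
    (metis add.right_neutral add_nonneg_pos add_pos_nonneg mult_nonneg_nonneg mult_pos_pos order_le_less zero_less_one)+

lemma convex_Collect_conj: "convex {x. P x} \<Longrightarrow> convex {x. Q x} \<Longrightarrow> convex {x. P x \<and> Q x}"
  by (metis Collect_conj_eq convex_Int)

lemma connected_Un_common: "connected S \<Longrightarrow> connected T \<Longrightarrow> x \<in> S \<Longrightarrow> x \<in> T \<Longrightarrow> connected (S \<union> T)"
  by (rule connected_Un) auto

text \<open>The closed versions of the clauses of \<open>inside_A1\<close> are convex, fill the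
  region together, and are chained by common vertices.\<close>

lemma connected_region_A1: "connected (region face_A1)"
proof -
  \<comment> \<open>Strict inequalities are relaxed, since the region includes the boundary
    curve.\<close>
  let ?C0 = "{x. fa1 x = 0 \<and> fa2 x \<le> 0 \<and> fa4 x \<le> 0 \<and> fb2 x \<le> 0 \<and> fb4 x \<ge> 0}"
  let ?C1 = "{x. fa1 x = 0 \<and> fa2 x \<le> 0 \<and> fb1 x \<le> 0 \<and> fb2 x \<le> 0}"
  let ?C2 = "{x. fa1 x = 0 \<and> fa2 x \<le> 0 \<and> fa3 x \<ge> 0 \<and> fb2 x \<le> 0}"
  let ?C3 = "{x. fa1 x = 0 \<and> fa4 x \<le> 0 \<and> fb3 x \<le> 0 \<and> fb4 x \<ge> 0}"
  have c0: "connected ?C0"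
    by (intro convex_connected convex_Collect_conj convex_lin)
  have c1: "connected ?C1"
    by (intro convex_connected convex_Collect_conj convex_lin)
  have c2: "connected ?C2"
    by (intro convex_connected convex_Collect_conj convex_lin)
  have c3: "connected ?C3"
    by (intro convex_connected convex_Collect_conj convex_lin)
  have d1: "connected (?C0 \<union> ?C1)"
    by (rule connected_Un_common[OF c0 c1, of "pt 9"]) (simp_all add: lin_def pt_simps)
  have d2: "connected ((?C0 \<union> ?C1) \<union> ?C2)"
    by (rule connected_Un_common[OF d1 c2, of "pt 7"]) (simp_all add: lin_def pt_simps)
  have d3: "connected (((?C0 \<union> ?C1) \<union> ?C2) \<union> ?C3)"
    by (rule connected_Un_common[OF d2 c3, of "pt 13"]) (simp_all add: lin_def pt_simps)
  have "((?C0 \<union> ?C1) \<union> ?C2) \<union> ?C3 = region face_A1"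
  proof (rule Set.set_eqI)
    fix x show "x \<in> ((?C0 \<union> ?C1) \<union> ?C2) \<union> ?C3 \<longleftrightarrow> x \<in> region face_A1"
      unfolding region_A1 outside_A1_def Un_iff mem_Collect_eq lin_def by argo
  qed
  then show ?thesis using d3 by (simp only:)
qed

lemma connected_region_B1: "connected (region face_B1)"
proof -
  let ?C0 = "{x. fb1 x = 0 \<and> fa1 x \<le> 0 \<and> fa2 x \<le> 0 \<and> fa4 x \<ge> 0}"
  let ?C1 = "{x. fb1 x = 0 \<and> fa2 x \<le> 0 \<and> fa3 x \<le> 0 \<and> fb2 x \<ge> 0 \<and> fb3 x \<ge> 0 \<and> fb4 x \<ge> 0}"
  have c0: "connected ?C0"
    by (intro convex_connected convex_Collect_conj convex_lin)
  have c1: "connected ?C1"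
    by (intro convex_connected convex_Collect_conj convex_lin)
  have d1: "connected (?C0 \<union> ?C1)"
    by (rule connected_Un_common[OF c0 c1, of "pt 24"]) (simp_all add: lin_def pt_simps)
  have "?C0 \<union> ?C1 = region face_B1"
  proof (rule Set.set_eqI)
    fix x show "x \<in> ?C0 \<union> ?C1 \<longleftrightarrow> x \<in> region face_B1"
      unfolding region_B1 outside_B1_def Un_iff mem_Collect_eq lin_def by argo
  qed
  then show ?thesis using d1 by (simp only:)
qed

lemma (in orthogonal_involution) connected_region_map: "connected (region f) \<Longrightarrow> connected (region (map T f))"
  unfolding region_map
  by (intro connected_continuous_image) (use linear in \<open>simp_all add: linear_continuous_on linear_conv_bounded_linear\<close>)

lemma (in orthogonal_involution) convex_region_map: "convex (region (map T f)) \<Longrightarrow> convex (region f)"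
proof -
  assume "convex (region (map T f))"
  then have "convex (T ` T ` region f)" unfolding region_map by (rule convex_linear_image[OF linear])
  moreover have "T ` T ` region f = region f" by (force simp: image_image involution)
  ultimately show ?thesis by simp
qed

lemma midpoint_not_convex:
  assumes "p \<in> S" "q \<in> S" "(1/2) *\<^sub>R p + (1/2) *\<^sub>R q \<notin> S"
  shows "\<not> convex S"
  using assms convexD[of S p q "1/2" "1/2"] by auto

lemma not_convex_A1: "\<not> convex (region face_A1)"
  by (rule midpoint_not_convex[of "pt 1" _ "pt 5"])
    (simp_all add: region_A1 outside_A1_def lin_combination, simp_all add: lin_def pt_simps)

lemma not_convex_B1: "\<not> convex (region face_B1)"
  by (rule midpoint_not_convex[of "pt 9" _ "pt 23"])
    (simp_all add: region_B1 outside_B1_def lin_combination, simp_all add: lin_def pt_simps)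

lemma connected_region_faces:
  "connected (region face_A1)" "connected (region face_A2)" "connected (region face_A3)" "connected (region face_A4)" "connected (region face_B1)" "connected (region face_B2)" "connected (region face_B3)" "connected (region face_B4)"
  unfolding face_A2_eq face_A3_eq face_A4_eq face_B2_eq face_B3_eq face_B4_eq rotate_invariants
  by (simp_all add: connected_region_A1 connected_region_B1 half_turn_x.connected_region_map
      half_turn_y.connected_region_map half_turn_z.connected_region_map)

lemma not_convex_faces:
  "\<not> convex (region face_A1)" "\<not> convex (region face_A2)" "\<not> convex (region face_A3)" "\<not> convex (region face_A4)" "\<not> convex (region face_B1)" "\<not> convex (region face_B2)" "\<not> convex (region face_B3)" "\<not> convex (region face_B4)"
  unfolding face_A2_eq face_A3_eq face_A4_eq face_B2_eq face_B3_eq face_B4_eq rotate_invariants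
  using not_convex_A1 not_convex_B1 half_turn_x.convex_region_map half_turn_y.convex_region_map
    half_turn_z.convex_region_map by blast+

lemma vertex_in_region: "p \<in> set f \<Longrightarrow> p \<in> region f"
proof -
  assume "p \<in> set f"
  then obtain i where "i < length f" "p = f ! i" by (auto simp: in_set_conv_nth)
  then have "{p, f ! (Suc i mod length f)} \<in> edges_of f"
    unfolding edges_of_def directed_edges_def by force
  moreover have "p \<in> convex hull {p, f ! (Suc i mod length f)}" by (simp add: hull_inc)
  ultimately show ?thesis unfolding region_def boundary_curve_def by blast
qed

lemma connected_surface: "connected (surface nonagon_faces)"
proof -
  note v = vertex_in_region
  have c2: "connected (region face_A1 \<union> region face_A2)"
    by (rule connected_Un_common[OF connected_region_faces(1) connected_region_faces(2), of "pt 1"])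
      (simp_all add: v face_A1_def face_A2_def)
  have c3: "connected (region face_A1 \<union> region face_A2 \<union> region face_A3)"
    by (rule connected_Un_common[OF c2 connected_region_faces(3), of "pt 5"])
      (simp_all add: v face_A1_def face_A3_def)
  have c4: "connected (region face_A1 \<union> region face_A2 \<union> region face_A3 \<union> region face_A4)"
    by (rule connected_Un_common[OF c3 connected_region_faces(4), of "pt 12"])
      (simp_all add: v face_A1_def face_A4_def)
  have c5: "connected (region face_A1 \<union> region face_A2 \<union> region face_A3 \<union> region face_A4 \<union> region face_B1)"
    by (rule connected_Un_common[OF c4 connected_region_faces(5), of "pt 1"])
      (simp_all add: v face_A1_def face_B1_def)
  have c6: "connected (region face_A1 \<union> region face_A2 \<union> region face_A3 \<union> region face_A4 \<union> region face_B1 \<union> region face_B2)"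
    by (rule connected_Un_common[OF c5 connected_region_faces(6), of "pt 2"])
      (simp_all add: v face_A1_def face_B2_def)
  have c7: "connected (region face_A1 \<union> region face_A2 \<union> region face_A3 \<union> region face_A4 \<union> region face_B1 \<union> region face_B2 \<union> region face_B3)"
    by (rule connected_Un_common[OF c6 connected_region_faces(7), of "pt 13"])
      (simp_all add: v face_A1_def face_B3_def)
  have c8: "connected (region face_A1 \<union> region face_A2 \<union> region face_A3 \<union> region face_A4 \<union> region face_B1 \<union> region face_B2 \<union> region face_B3 \<union> region face_B4)"
    by (rule connected_Un_common[OF c7 connected_region_faces(8), of "pt 7"])
      (simp_all add: v face_A1_def face_B4_def)
  have "surface nonagon_faces = region face_A1 \<union> region face_A2 \<union> region face_A3 \<union> region face_A4 \<union> region face_B1 \<union> region face_B2 \<union> region face_B3 \<union> region face_B4"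
    unfolding surface_def nonagon_faces_def by blast
  then show ?thesis using c8 by (simp only:)
qed

text \<open>A wedge contains a ray from each of its points. The cavity is bounded, so there the
  connected unbounded set is the whole cavity together with a ray that leaves it through a
  mouth.\<close>

lemma off_solid_unbounded:
  assumes "off_solid x"
  shows "\<exists>T. connected T \<and> \<not> bounded T \<and> x \<in> T \<and> T \<subseteq> {x. off_solid x}"
proof -
  have ray: ?thesis if "d \<noteq> 0" "\<And>t. t \<ge> 0 \<Longrightarrow> off_solid (x + t *\<^sub>R d)" for d
  proof (intro exI conjI)
    show "connected ((\<lambda>t. x + t *\<^sub>R d) ` {0..})" "\<not> bounded ((\<lambda>t. x + t *\<^sub>R d) ` {0..})"
      by (rule connected_unbounded_ray[OF that(1)])+
    show "x \<in> (\<lambda>t. x + t *\<^sub>R d) ` {0..}" by (auto intro!: image_eqI[of _ _ 0])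
  qed (use that(2) in auto)
  consider "fa4 x > 0 \<and> fb4 x < 0" |
    "fa4 x > 0 \<and> fb1 x > 0" |
    "fa3 x > 0 \<and> fb3 x < 0" |
    "fa3 x > 0 \<and> fb2 x > 0" |
    "fa3 x > 0 \<and> fa4 x > 0" |
    "fa2 x > 0 \<and> fb2 x < 0" |
    "fa2 x > 0 \<and> fb3 x > 0" |
    "fa2 x > 0 \<and> fa4 x > 0" |
    "fa2 x > 0 \<and> fa3 x > 0" |
    "fa1 x > 0 \<and> fb1 x < 0" |
    "fa1 x > 0 \<and> fb4 x > 0" |
    "fa1 x > 0 \<and> fa4 x > 0" |
    "fa1 x > 0 \<and> fa3 x > 0" |
    "fa1 x > 0 \<and> fa2 x > 0" |
    "fb1 x > 0 \<and> fb2 x > 0 \<and> fb3 x > 0 \<and> fb4 x > 0"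
    using assms unfolding off_solid_def by (elim disjE) (erule that)+
  then show ?thesis
  proof cases
    case 1
    then show ?thesis
      by (intro ray[of "vector [0, 0, 1]"]) (auto simp: vec3_eq_iff lin_def off_solid_def algebra_simps)
  next
    case 2
    then show ?thesis
      by (intro ray[of "vector [0, - 1, 0]"]) (auto simp: vec3_eq_iff lin_def off_solid_def algebra_simps)
  next
    case 3
    then show ?thesis
      by (intro ray[of "vector [0, 0, 1]"]) (auto simp: vec3_eq_iff lin_def off_solid_def algebra_simps)
  next
    case 4
    then show ?thesis
      by (intro ray[of "vector [0, 0, 1]"]) (auto simp: vec3_eq_iff lin_def off_solid_def algebra_simps)
  next
    case 5
    then show ?thesis
      by (intro ray[of "vector [0, 0, 1]"]) (auto simp: vec3_eq_iff lin_def off_solid_def algebra_simps)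
  next
    case 6
    then show ?thesis
      by (intro ray[of "vector [0, 0, - 1]"]) (auto simp: vec3_eq_iff lin_def off_solid_def algebra_simps)
  next
    case 7
    then show ?thesis
      by (intro ray[of "vector [0, 0, - 1]"]) (auto simp: vec3_eq_iff lin_def off_solid_def algebra_simps)
  next
    case 8
    then show ?thesis
      by (intro ray[of "vector [- 1, 0, 0]"]) (auto simp: vec3_eq_iff lin_def off_solid_def algebra_simps)
  next
    case 9
    then show ?thesis
      by (intro ray[of "vector [0, 1, 0]"]) (auto simp: vec3_eq_iff lin_def off_solid_def algebra_simps)
  next
    case 10
    then show ?thesis
      by (intro ray[of "vector [0, 0, - 1]"]) (auto simp: vec3_eq_iff lin_def off_solid_def algebra_simps)
  next
    case 11
    then show ?thesis
      by (intro ray[of "vector [0, - 1, 0]"]) (auto simp: vec3_eq_iff lin_def off_solid_def algebra_simps)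
  next
    case 12
    then show ?thesis
      by (intro ray[of "vector [0, - 1, 0]"]) (auto simp: vec3_eq_iff lin_def off_solid_def algebra_simps)
  next
    case 13
    then show ?thesis
      by (intro ray[of "vector [1, 0, 0]"]) (auto simp: vec3_eq_iff lin_def off_solid_def algebra_simps)
  next
    case 14
    then show ?thesis
      by (intro ray[of "vector [0, 0, - 1]"]) (auto simp: vec3_eq_iff lin_def off_solid_def algebra_simps)
  next
    case 15
    \<comment> \<open>A point close to the corner (-3/2, -3/5, -3/5) of the cavity, already beyond
      the plane of the face \<open>A\<close> 4; the ray from it stays in the wedge
      \<open>fa4\<close> > 0, \<open>fb1\<close> > 0.\<close>
    let ?p = "vector [- 149/100, - 59/100, - 59/100] :: real^3" and ?d = "vector [0, - 1, 0] :: real^3"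
    let ?R = "(\<lambda>t. ?p + t *\<^sub>R ?d) ` {0..}" and ?B = "{x. fb1 x > 0 \<and> fb2 x > 0 \<and> fb3 x > 0 \<and> fb4 x > 0}"
    have "?d \<noteq> 0" by (simp add: vec3_eq_iff)
    note r = connected_unbounded_ray[OF this, of ?p]
    have "?p \<in> ?R" by (auto intro!: image_eqI[of _ _ 0])
    moreover have "?p \<in> ?B" by (simp add: lin_def)
    moreover have "connected ?B"
      by (intro convex_connected convex_Collect_conj convex_lin)
    ultimately have "connected (?B \<union> ?R)" using r(1) by (intro connected_Un_common)
    moreover have "\<not> bounded (?B \<union> ?R)" using r(2) by simp
    moreover have "fa4 (?p + t *\<^sub>R ?d) > 0 \<and> fb1 (?p + t *\<^sub>R ?d) > 0" if "t \<ge> 0" for t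
      using that by (simp add: lin_def)
    then have "off_solid (?p + t *\<^sub>R ?d)" if "t \<ge> 0" for t
      unfolding off_solid_def using that by simp
    then have "?R \<subseteq> {x. off_solid x}" by (intro image_subsetI CollectI) simp
    moreover have "?B \<subseteq> {x. off_solid x}"
      by (intro Collect_mono impI) (simp add: off_solid_def)
    moreover have "x \<in> ?B" using 15 by simp
    ultimately show ?thesis by (intro exI[of _ "?B \<union> ?R"] conjI Un_least UnI1)
  qed
qed

lemma open_in_solid: "open {x. in_solid x}" and open_off_solid: "open {x. off_solid x}"
  unfolding in_solid_def off_solid_def
  by (intro open_Collect_disj open_Collect_conj open_lin_lt open_lin_gt)+

lemma surface_iff: "x \<in> surface nonagon_faces \<longleftrightarrow> \<not> in_solid x \<and> \<not> off_solid x"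
proof
  assume "x \<in> surface nonagon_faces"
  then show "\<not> in_solid x \<and> \<not> off_solid x"
    unfolding surface_def nonagon_faces_def
    using sides_A1(3) sides_A2(3) sides_A3(3) sides_A4(3) sides_B1(3) sides_B2(3) sides_B3(3) sides_B4(3) by blast
qed (rule in_or_off_solid)

lemma inside_surface: "inside (surface nonagon_faces) = {x. in_solid x}"
proof -
  have S: "- surface nonagon_faces = {x. in_solid x \<or> off_solid x}" using surface_iff by blast
  have "{x \<in> - surface nonagon_faces. bounded (connected_component_set (- surface nonagon_faces) x)} =
      {x. in_solid x} \<inter> - surface nonagon_faces"
  proof (rule bounded_component_iff[OF open_in_solid open_off_solid])
    show "bounded ({x. in_solid x} \<inter> - surface nonagon_faces)"
      by (rule bounded_coordinates[of _ 10]) (use in_solid_bounded in simp)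
    fix x assume "x \<in> {x. off_solid x} \<inter> - surface nonagon_faces"
    then obtain T where "connected T" "\<not> bounded T" "x \<in> T" "T \<subseteq> {x. off_solid x}"
      using off_solid_unbounded[of x] by blast
    then show "\<exists>T. connected T \<and> \<not> bounded T \<and> x \<in> T \<and> T \<subseteq> - surface nonagon_faces"
      unfolding S by blast
  qed (use in_solid_not_off_solid in \<open>auto simp: S\<close>)
  also have "{x. in_solid x} \<inter> - surface nonagon_faces = {x. in_solid x}" unfolding S by blast
  finally show ?thesis by (simp add: inside_def)
qed

lemma solid_nonagon_faces: "solid nonagon_faces = {x. \<not> off_solid x}"
  unfolding solid_def inside_surface using surface_iff in_solid_not_off_solid by blast

subsection \<open>Combinatorics\<close>

text \<open>The index version of the eight faces. Combinatorial facts are evaluated on these lists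
  by \<open>code_simp\<close>, which never has to touch real coordinates.\<close>

definition face_lists :: "nat list list" where
  "face_lists =
     [[1, 2, 5, 7, 17, 13, 21, 12, 9],
      [6, 8, 18, 14, 22, 11, 10, 2, 1],
      [7, 5, 19, 15, 23, 10, 11, 3, 4],
      [4, 3, 8, 6, 20, 16, 24, 9, 12],
      [1, 9, 24, 23, 15, 14, 18, 20, 6],
      [13, 17, 19, 5, 2, 10, 23, 24, 16],
      [21, 13, 16, 20, 18, 8, 3, 11, 22],
      [4, 12, 21, 22, 14, 15, 19, 17, 7]]"

definition directed_pairs :: "nat list \<Rightarrow> (nat \<times> nat) list" where
  "directed_pairs l = zip l (rotate1 l)"

text \<open>The smaller index comes first, so that an undirected edge has a single code and list
  membership decides equality of edges.\<close>

definition sorted_pairs :: "nat list \<Rightarrow> (nat \<times> nat) list" where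
  "sorted_pairs l = map (\<lambda>(a, b). (min a b, max a b)) (directed_pairs l)"

definition pt_edge :: "nat \<times> nat \<Rightarrow> (real^3) set" where
  "pt_edge e = {pt (fst e), pt (snd e)}"

lemma nonagon_faces_eq: "nonagon_faces = map pt ` set face_lists"
  by (simp add: nonagon_faces_def face_lists_def face_A1_def face_A2_def face_A3_def face_A4_def face_B1_def face_B2_def face_B3_def face_B4_def)

lemma inj_on_pt: "inj_on pt {1..24}"
proof -
  have "[1..<25] = [1, 2, 3, 4, 5, 6, 7, 8, 9, 10, 11, 12, 13, 14, 15, 16, 17, 18, 19, 20, 21, 22, 23, 24]"
    by code_simp
  moreover have "distinct (map pt [1, 2, 3, 4, 5, 6, 7, 8, 9, 10, 11, 12, 13, 14, 15, 16, 17, 18, 19, 20, 21, 22, 23, 24])"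
    by (simp add: pt_simps vec3_eq_iff)
  ultimately have "distinct (map pt [1..<25])" by (simp only:)
  moreover have "set [1..<25] = {1..24}" by auto
  ultimately show ?thesis by (simp only: distinct_map)
qed

lemma pt_eq_iff: "i \<in> {1..24} \<Longrightarrow> j \<in> {1..24} \<Longrightarrow> pt i = pt j \<longleftrightarrow> i = j"
  using inj_on_pt by (rule inj_on_eq_iff)

lemma face_lists_facts:
  assumes "l \<in> set face_lists"
  shows "length l = 9" "distinct l" "set l \<subseteq> {1..24}"
proof -
  have "list_all (\<lambda>l. length l = 9 \<and> distinct l \<and> list_all (\<lambda>i. 1 \<le> i \<and> i \<le> 24) l) face_lists"
    by code_simp
  then have "length l = 9 \<and> distinct l \<and> (\<forall>i\<in>set l. 1 \<le> i \<and> i \<le> 24)"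
    using assms by (simp add: list_all_iff)
  then show "length l = 9" "distinct l" "set l \<subseteq> {1..24}" by auto
qed

lemma map_pt_eq_iff:
  "set l \<subseteq> {1..24} \<Longrightarrow> set m \<subseteq> {1..24} \<Longrightarrow> map pt l = map pt m \<longleftrightarrow> l = m"
  using inj_on_map_eq_map[of pt l m] inj_on_subset[OF inj_on_pt] by (metis Un_least)

lemma inj_on_map_pt: "inj_on (map pt) (set face_lists)"
  by (rule inj_onI) (use map_pt_eq_iff face_lists_facts(3) in blast)

lemma directed_edges_map_pt: "directed_edges (map pt l) = map_prod pt pt ` set (directed_pairs l)"
  unfolding directed_edges_eq_zip directed_pairs_def
  by (simp add: rotate1_map zip_map_map map_prod_def)

lemma edges_of_map_pt: "edges_of (map pt l) = pt_edge ` set (sorted_pairs l)"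
  unfolding edges_of_def directed_edges_map_pt sorted_pairs_def
  by (auto simp: image_image pt_edge_def min_def max_def insert_commute intro!: image_cong)

lemma directed_pairs_subset: "set (directed_pairs l) \<subseteq> set l \<times> set l"
proof (rule subrelI)
  fix a b assume "(a, b) \<in> set (directed_pairs l)"
  then have "(a, b) \<in> set (zip l (rotate1 l))" by (simp add: directed_pairs_def)
  from set_zip_leftD[OF this] set_zip_rightD[OF this] show "(a, b) \<in> set l \<times> set l" by simp
qed

lemma sorted_pairs_subset:
  assumes "l \<in> set face_lists"
  shows "set (sorted_pairs l) \<subseteq> {(a, b). a \<le> b \<and> a \<in> {1..24} \<and> b \<in> {1..24}}"
proof -
  have "set (directed_pairs l) \<subseteq> {1..24} \<times> {1..24}"
    using directed_pairs_subset face_lists_facts(3)[OF assms] by blast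
  then show ?thesis unfolding sorted_pairs_def by (fastforce simp: min_def max_def)
qed

lemma inj_on_pt_edge: "inj_on pt_edge {(a, b). a \<le> b \<and> a \<in> {1..24} \<and> b \<in> {1..24}}"
  by (rule inj_onI) (auto simp: pt_edge_def doubleton_eq_iff pt_eq_iff)

lemma pt_edge_mem_iff:
  assumes "l \<in> set face_lists" "m \<in> set face_lists" "e \<in> set (sorted_pairs m)"
  shows "pt_edge e \<in> edges_of (map pt l) \<longleftrightarrow> e \<in> set (sorted_pairs l)"
  unfolding edges_of_map_pt
  by (rule inj_on_image_mem_iff[OF inj_on_pt_edge])
    (use assms sorted_pairs_subset in blast)+

lemma edges_Int:
  assumes "l \<in> set face_lists" "m \<in> set face_lists"
  shows "edges_of (map pt l) \<inter> edges_of (map pt m) =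
      pt_edge ` set (filter (\<lambda>e. e \<in> set (sorted_pairs m)) (sorted_pairs l))"
    "card (edges_of (map pt l) \<inter> edges_of (map pt m)) =
      card (set (filter (\<lambda>e. e \<in> set (sorted_pairs m)) (sorted_pairs l)))"
proof -
  let ?S = "set (filter (\<lambda>e. e \<in> set (sorted_pairs m)) (sorted_pairs l))"
  show 1: "edges_of (map pt l) \<inter> edges_of (map pt m) = pt_edge ` ?S"
    unfolding edges_of_map_pt
    using inj_on_image_Int[OF inj_on_pt_edge sorted_pairs_subset[OF assms(1)] sorted_pairs_subset[OF assms(2)]]
    by (simp add: Int_def conj_commute)
  have "inj_on pt_edge ?S"
    by (rule inj_on_subset[OF inj_on_pt_edge]) (use sorted_pairs_subset[OF assms(1)] in auto)
  then show "card (edges_of (map pt l) \<inter> edges_of (map pt m)) = card ?S"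
    unfolding 1 by (rule card_image)
qed

lemma edges_nonagon_faces: "edges nonagon_faces = pt_edge ` set (concat (map sorted_pairs face_lists))"
  unfolding edges_def nonagon_faces_eq by (auto simp: edges_of_map_pt)

lemma card_edges: "card (edges nonagon_faces) = 36"
proof -
  have "inj_on pt_edge (set (concat (map sorted_pairs face_lists)))"
    by (rule inj_on_subset[OF inj_on_pt_edge]) (use sorted_pairs_subset in auto)
  then have "card (edges nonagon_faces) = card (set (concat (map sorted_pairs face_lists)))"
    unfolding edges_nonagon_faces by (rule card_image)
  also have "\<dots> = length (remdups (concat (map sorted_pairs face_lists)))"
    by (rule length_remdups_card_conv[symmetric])
  also have "\<dots> = 36" by code_simp
  finally show ?thesis .
qed

lemma vertices_nonagon_faces: "vertices nonagon_faces = pt ` {1..24}"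
proof -
  have "list_all (\<lambda>i. i \<in> set (concat face_lists)) [1..<25]" by code_simp
  then have "{1..24} \<subseteq> set (concat face_lists)" unfolding list_all_iff by auto
  moreover have "set (concat face_lists) \<subseteq> {1..24}" using face_lists_facts(3) by auto
  ultimately have "set (concat face_lists) = {1..24}" by blast
  moreover have "vertices nonagon_faces = pt ` set (concat face_lists)"
    unfolding vertices_def nonagon_faces_eq by auto
  ultimately show ?thesis by simp
qed

lemma card_vertices: "card (vertices nonagon_faces) = 24"
  unfolding vertices_nonagon_faces by (simp add: card_image inj_on_pt)

lemma card_nonagon_faces: "card nonagon_faces = 8"
proof -
  have "distinct face_lists" "length face_lists = 8" by code_simp+
  then show ?thesis unfolding nonagon_faces_eq
    by (simp add: card_image[OF inj_on_map_pt] distinct_card)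
qed

lemma faces_with:
  "{f \<in> nonagon_faces. Q f} = map pt ` set (filter (\<lambda>l. Q (map pt l)) face_lists)"
  "card {f \<in> nonagon_faces. Q f} = length (filter (\<lambda>l. Q (map pt l)) face_lists)"
proof -
  show 1: "{f \<in> nonagon_faces. Q f} = map pt ` set (filter (\<lambda>l. Q (map pt l)) face_lists)"
    unfolding nonagon_faces_eq by auto
  have "distinct face_lists" by code_simp
  moreover have "inj_on (map pt) (set (filter (\<lambda>l. Q (map pt l)) face_lists))"
    by (rule inj_on_subset[OF inj_on_map_pt]) auto
  ultimately show "card {f \<in> nonagon_faces. Q f} = length (filter (\<lambda>l. Q (map pt l)) face_lists)"
    unfolding 1 by (simp only: card_image distinct_card distinct_filter)
qed

lemma card_faces_at_edge:
  assumes "e \<in> edges nonagon_faces"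
  shows "card {f \<in> nonagon_faces. e \<in> edges_of f} = 2"
proof -
  obtain m p where m: "m \<in> set face_lists" "p \<in> set (sorted_pairs m)" "e = pt_edge p"
    using assms unfolding edges_nonagon_faces by auto
  have "list_all (\<lambda>p. length (filter (\<lambda>l. p \<in> set (sorted_pairs l)) face_lists) = 2)
      (concat (map sorted_pairs face_lists))" by code_simp
  then have "length (filter (\<lambda>l. p \<in> set (sorted_pairs l)) face_lists) = 2"
    using m unfolding list_all_iff by auto
  moreover have "filter (\<lambda>l. e \<in> edges_of (map pt l)) face_lists = filter (\<lambda>l. p \<in> set (sorted_pairs l)) face_lists"
    unfolding m(3) by (rule filter_cong[OF refl]) (rule pt_edge_mem_iff[OF _ m(1,2)])
  ultimately show ?thesis unfolding faces_with(2) by simp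
qed

lemma pt_in_face:
  assumes "i \<in> {1..24}" "l \<in> set face_lists"
  shows "pt i \<in> set (map pt l) \<longleftrightarrow> i \<in> set l"
  using inj_on_image_mem_iff[OF inj_on_pt assms(1) face_lists_facts(3)[OF assms(2)]] by simp

lemma filter_faces_at:
  "i \<in> {1..24} \<Longrightarrow> filter (\<lambda>l. pt i \<in> set (map pt l)) face_lists = filter (\<lambda>l. i \<in> set l) face_lists"
  by (rule filter_cong[OF refl]) (rule pt_in_face)

lemma card_faces_at_vertex:
  assumes "x \<in> vertices nonagon_faces"
  shows "card {f \<in> nonagon_faces. x \<in> set f} = 3"
proof -
  obtain i where i: "i \<in> {1..24}" "x = pt i" using assms unfolding vertices_nonagon_faces by auto
  have "list_all (\<lambda>i. length (filter (\<lambda>l. i \<in> set l) face_lists) = 3) [1..<25]" by code_simp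
  then have "length (filter (\<lambda>l. i \<in> set l) face_lists) = 3" using i(1) unfolding list_all_iff by auto
  then show ?thesis unfolding faces_with(2) i(2) filter_faces_at[OF i(1)] .
qed

definition consecutive_at :: "nat \<Rightarrow> nat list \<Rightarrow> nat list \<Rightarrow> bool" where
  "consecutive_at i l m = list_ex (\<lambda>e. e \<in> set (sorted_pairs m) \<and> (fst e = i \<or> snd e = i)) (sorted_pairs l)"

lemma single_cycle_at_vertex:
  assumes "x \<in> vertices nonagon_faces"
  shows "single_cycle_at nonagon_faces x"
proof -
  obtain i where i: "i \<in> {1..24}" "x = pt i" using assms unfolding vertices_nonagon_faces by auto
  let ?ls = "filter (\<lambda>l. i \<in> set l) face_lists"
  \<comment> \<open>With three faces at a vertex that share edges pairwise, the order in which the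
    filter lists them is already a cyclic one.\<close>
  have "list_all (\<lambda>i. let ls = filter (\<lambda>l. i \<in> set l) face_lists in length ls = 3 \<and>
      consecutive_at i (ls ! 0) (ls ! 1) \<and> consecutive_at i (ls ! 1) (ls ! 2) \<and> consecutive_at i (ls ! 2) (ls ! 0)) [1..<25]"
    by code_simp
  then have 3: "length ?ls = 3" and c: "consecutive_at i (?ls ! 0) (?ls ! 1)" "consecutive_at i (?ls ! 1) (?ls ! 2)"
    "consecutive_at i (?ls ! 2) (?ls ! 0)"
    using i(1) unfolding list_all_iff Let_def by auto
  have shared: "\<exists>e\<in>edges_of (map pt l) \<inter> edges_of (map pt m). x \<in> e"
    if "consecutive_at i l m" for l m
  proof -
    obtain e where "e \<in> set (sorted_pairs l)" "e \<in> set (sorted_pairs m)" "fst e = i \<or> snd e = i"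
      using \<open>consecutive_at i l m\<close> unfolding consecutive_at_def list_ex_iff by auto
    then show ?thesis unfolding edges_of_map_pt i(2)
      by (intro bexI[of _ "pt_edge e"]) (auto simp: pt_edge_def)
  qed
  show ?thesis unfolding single_cycle_at_def
  proof (intro exI[of _ "map (map pt) ?ls"] conjI allI impI)
    have "distinct face_lists" by code_simp
    then show "distinct (map (map pt) ?ls)"
      using inj_on_subset[OF inj_on_map_pt, of "set ?ls"] by (simp add: distinct_map)
    show "set (map (map pt) ?ls) = {f \<in> nonagon_faces. x \<in> set f}"
      unfolding faces_with(1) i(2) filter_faces_at[OF i(1)] by simp
    fix k assume "k < length (map (map pt) ?ls)"
    then have "k = 0 \<or> k = 1 \<or> k = 2" using 3 by auto
    then show "\<exists>e\<in>edges_of (map (map pt) ?ls ! k) \<inter> edges_of (map (map pt) ?ls ! (Suc k mod length (map (map pt) ?ls))). x \<in> e"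
      using shared c 3 by (elim disjE) (simp_all add: numeral_2_eq_2 One_nat_def)
  qed (use 3 in simp)
qed

text \<open>As listed, the faces are coherently oriented: no directed edge occurs twice. The
  orientation of the surface can therefore leave each list as it is.\<close>

lemma directed_edges_disjoint:
  assumes "f \<in> nonagon_faces" "g \<in> nonagon_faces" "f \<noteq> g"
  shows "directed_edges f \<inter> directed_edges g = {}"
proof -
  obtain l m where lm: "l \<in> set face_lists" "f = map pt l" "m \<in> set face_lists" "g = map pt m" "l \<noteq> m"
    using assms unfolding nonagon_faces_eq by auto
  have "list_all (\<lambda>l. list_all (\<lambda>m. l = m \<or> list_all (\<lambda>e. e \<notin> set (directed_pairs m)) (directed_pairs l)) face_lists) face_lists"
    by code_simp
  then have "set (directed_pairs l) \<inter> set (directed_pairs m) = {}"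
    using lm unfolding list_all_iff by blast
  moreover have "set (directed_pairs l) \<subseteq> {1..24} \<times> {1..24}" if "l \<in> set face_lists" for l
    using face_lists_facts(3)[OF that] directed_pairs_subset by blast
  moreover have "inj_on (map_prod pt pt) ({1..24} \<times> {1..24})" by (intro map_prod_inj_on inj_on_pt)
  ultimately show ?thesis unfolding lm directed_edges_map_pt
    using lm(1,3) by (metis image_empty inj_on_image_Int)
qed

text \<open>Positions 0 to 3 stand for \<open>A\<close> 1 to \<open>A\<close> 4 and positions 4 to 7
  for \<open>B\<close> 1 to \<open>B\<close> 4.\<close>

definition double_pairs :: "(nat \<times> nat) list" where
  "double_pairs = [(0, 5), (0, 7), (2, 5), (2, 7), (1, 4), (1, 6), (3, 4), (3, 6)]"

definition nth_face :: "nat \<Rightarrow> polygon" where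
  "nth_face k = map pt (face_lists ! k)"

lemma nth_face_inj: "i < 8 \<Longrightarrow> j < 8 \<Longrightarrow> nth_face i = nth_face j \<longleftrightarrow> i = j"
proof -
  assume ij: "i < 8" "j < 8"
  have d: "distinct face_lists" "length face_lists = 8" by code_simp+
  then show ?thesis unfolding nth_face_def
    using ij inj_on_eq_iff[OF inj_on_map_pt, of "face_lists ! i" "face_lists ! j"] nth_eq_iff_index_eq[OF d(1)] by simp
qed

lemma nonagon_faces_nth: "nonagon_faces = nth_face ` {..<8}"
proof -
  have d: "length face_lists = 8" by code_simp
  have "set face_lists = (!) face_lists ` {..<8}" unfolding set_conv_nth d by blast
  then show ?thesis unfolding nonagon_faces_eq nth_face_def by (simp add: image_image)
qed

lemma card_common_edges:
  assumes "i < j" "j < 8"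
  shows "card (edges_of (nth_face i) \<inter> edges_of (nth_face j)) = (if (i, j) \<in> set double_pairs then 2 else 1)"
proof -
  have "list_all (\<lambda>i. list_all (\<lambda>j. i < j \<longrightarrow>
      length (remdups (filter (\<lambda>e. e \<in> set (sorted_pairs (face_lists ! j))) (sorted_pairs (face_lists ! i)))) =
        (if (i, j) \<in> set double_pairs then 2 else 1)) [0..<8]) [0..<8]"
    by code_simp
  then have "length (remdups (filter (\<lambda>e. e \<in> set (sorted_pairs (face_lists ! j))) (sorted_pairs (face_lists ! i)))) =
        (if (i, j) \<in> set double_pairs then 2 else 1)"
    using assms unfolding list_all_iff by auto
  moreover have "length face_lists = 8" by code_simp
  ultimately show ?thesis unfolding nth_face_def
    using assms edges_Int(2)[of "face_lists ! i" "face_lists ! j"]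
    by (simp add: length_remdups_card_conv del: set_filter)
qed

text \<open>Unordered pairs of faces correspond to index pairs \<open>i < j\<close>; removing the 8
  double pairs from these 28 leaves 20.\<close>

lemma card_simple_pairs:
  assumes "D = (\<lambda>(i, j). {nth_face i, nth_face j}) ` set double_pairs"
  shows "i < j \<Longrightarrow> j < 8 \<Longrightarrow> {nth_face i, nth_face j} \<in> D \<longleftrightarrow> (i, j) \<in> set double_pairs"
    and "card {{f, g} | f g. f \<in> nonagon_faces \<and> g \<in> nonagon_faces \<and> f \<noteq> g \<and> {f, g} \<notin> D} = 20"
proof -
  let ?h = "\<lambda>(i, j). {nth_face i, nth_face j}"
  let ?S = "{(i, j). i < j \<and> j < (8::nat)}"
  let ?l = "filter (\<lambda>(i, j). i < j \<and> (i, j) \<notin> set double_pairs) (List.product [0..<8] [0..<8])"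
  have inj: "inj_on ?h ?S"
    by (rule inj_onI) (auto simp: doubleton_eq_iff nth_face_inj)
  have "list_all (\<lambda>(i, j). i < j \<and> j < 8) double_pairs" by code_simp
  then have sub: "set double_pairs \<subseteq> ?S" by (auto simp: list_all_iff)
  have mem: "?h e \<in> D \<longleftrightarrow> e \<in> set double_pairs" if "e \<in> ?S" for e
    unfolding assms by (rule inj_on_image_mem_iff[OF inj that sub])
  show "{nth_face i, nth_face j} \<in> D \<longleftrightarrow> (i, j) \<in> set double_pairs" if "i < j" "j < 8"
    using mem[of "(i, j)"] that by simp
  have "{{f, g} | f g. f \<in> nonagon_faces \<and> g \<in> nonagon_faces \<and> f \<noteq> g \<and> {f, g} \<notin> D} = ?h ` set ?l"
  proof (intro equalityI subsetI)
    fix s assume "s \<in> {{f, g} | f g. f \<in> nonagon_faces \<and> g \<in> nonagon_faces \<and> f \<noteq> g \<and> {f, g} \<notin> D}"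
    then obtain f g where fg: "s = {f, g}" "f \<in> nonagon_faces" "g \<in> nonagon_faces" "f \<noteq> g" "{f, g} \<notin> D" by blast
    then obtain i j where ij: "i < 8" "f = nth_face i" "j < 8" "g = nth_face j" unfolding nonagon_faces_nth by auto
    then have "i \<noteq> j" using fg by auto
    then consider "i < j" | "j < i" by linarith
    then show "s \<in> ?h ` set ?l"
    proof cases
      case 1
      then show ?thesis using fg ij mem[of "(i, j)"] by (intro image_eqI[of _ _ "(i, j)"]) auto
    next
      case 2
      then show ?thesis using fg ij mem[of "(j, i)"] by (intro image_eqI[of _ _ "(j, i)"]) (auto simp: insert_commute)
    qed
  next
    fix s assume "s \<in> ?h ` set ?l"
    then obtain i j where ij: "i < j" "j < 8" "(i, j) \<notin> set double_pairs" "s = {nth_face i, nth_face j}" by auto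
    then have "nth_face i \<noteq> nth_face j" by (simp add: nth_face_inj)
    then show "s \<in> {{f, g} | f g. f \<in> nonagon_faces \<and> g \<in> nonagon_faces \<and> f \<noteq> g \<and> {f, g} \<notin> D}"
      using ij mem[of "(i, j)"] unfolding nonagon_faces_nth
      by (intro CollectI exI[of _ "nth_face i"] exI[of _ "nth_face j"]) auto
  qed
  moreover have "inj_on ?h (set ?l)" by (rule inj_on_subset[OF inj]) auto
  moreover have "distinct ?l" "length ?l = 20" by code_simp+
  ultimately show "card {{f, g} | f g. f \<in> nonagon_faces \<and> g \<in> nonagon_faces \<and> f \<noteq> g \<and> {f, g} \<notin> D} = 20"
    by (simp only: card_image distinct_card)
qed

subsection \<open>The polyhedral surface\<close>

definition meet_properly :: "polygon \<Rightarrow> polygon \<Rightarrow> bool" where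
  "meet_properly f g \<longleftrightarrow> region f \<inter> region g =
     (\<Union>e \<in> edges_of f \<inter> edges_of g. convex hull e) \<union> (set f \<inter> set g)"

lemma meet_properly_sym: "meet_properly f g \<Longrightarrow> meet_properly g f"
  by (simp add: meet_properly_def Int_commute)

text \<open>Common edges and vertices lie in both regions anyway, so it suffices to cover the
  intersection of the regions by some of them.\<close>

lemma meet_properlyI:
  assumes "\<And>x. x \<in> region f \<Longrightarrow> x \<in> region g \<Longrightarrow> x \<in> (\<Union>e\<in>E. convex hull e) \<union> W"
    and "E \<subseteq> edges_of f" "E \<subseteq> edges_of g" "W \<subseteq> set f" "W \<subseteq> set g"
  shows "meet_properly f g"
proof -
  have "(\<Union>e \<in> edges_of f \<inter> edges_of g. convex hull e) \<subseteq> region f \<inter> region g"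
    unfolding region_def boundary_curve_def by blast
  moreover have "set f \<inter> set g \<subseteq> region f \<inter> region g" using vertex_in_region by blast
  moreover have "region f \<inter> region g \<subseteq> (\<Union>e\<in>E. convex hull e) \<union> W" using assms(1) by blast
  moreover have "(\<Union>e\<in>E. convex hull e) \<subseteq> (\<Union>e \<in> edges_of f \<inter> edges_of g. convex hull e)"
    using assms(2,3) by (intro UN_mono) auto
  moreover have "W \<subseteq> set f \<inter> set g" using assms(4,5) by blast
  ultimately show ?thesis unfolding meet_properly_def by (intro equalityI Un_least; (rule order_trans, assumption)?; blast)
qed

lemma edges_of_faces:
  "edges_of face_A1 = {{pt 1, pt 2}, {pt 2, pt 5}, {pt 5, pt 7}, {pt 7, pt 17}, {pt 17, pt 13}, {pt 13, pt 21}, {pt 21, pt 12}, {pt 12, pt 9}, {pt 9, pt 1}}"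
  "edges_of face_A2 = {{pt 6, pt 8}, {pt 8, pt 18}, {pt 14, pt 18}, {pt 14, pt 22}, {pt 22, pt 11}, {pt 11, pt 10}, {pt 10, pt 2}, {pt 1, pt 2}, {pt 6, pt 1}}"
  "edges_of face_A3 = {{pt 5, pt 7}, {pt 5, pt 19}, {pt 19, pt 15}, {pt 23, pt 15}, {pt 23, pt 10}, {pt 11, pt 10}, {pt 11, pt 3}, {pt 3, pt 4}, {pt 4, pt 7}}"
  "edges_of face_A4 = {{pt 3, pt 4}, {pt 3, pt 8}, {pt 6, pt 8}, {pt 20, pt 6}, {pt 20, pt 16}, {pt 16, pt 24}, {pt 9, pt 24}, {pt 12, pt 9}, {pt 12, pt 4}}"
  "edges_of face_B1 = {{pt 9, pt 1}, {pt 9, pt 24}, {pt 24, pt 23}, {pt 23, pt 15}, {pt 15, pt 14}, {pt 14, pt 18}, {pt 18, pt 20}, {pt 20, pt 6}, {pt 6, pt 1}}"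
  "edges_of face_B2 = {{pt 17, pt 13}, {pt 17, pt 19}, {pt 5, pt 19}, {pt 2, pt 5}, {pt 10, pt 2}, {pt 23, pt 10}, {pt 24, pt 23}, {pt 16, pt 24}, {pt 16, pt 13}}"
  "edges_of face_B3 = {{pt 13, pt 21}, {pt 16, pt 13}, {pt 20, pt 16}, {pt 18, pt 20}, {pt 8, pt 18}, {pt 3, pt 8}, {pt 11, pt 3}, {pt 22, pt 11}, {pt 22, pt 21}}"
  "edges_of face_B4 = {{pt 12, pt 4}, {pt 21, pt 12}, {pt 22, pt 21}, {pt 14, pt 22}, {pt 15, pt 14}, {pt 19, pt 15}, {pt 17, pt 19}, {pt 7, pt 17}, {pt 4, pt 7}}"
  by (simp_all add: edges_of_def directed_edges_eq_zip face_A1_def face_A2_def face_A3_def face_A4_def face_B1_def face_B2_def face_B3_def face_B4_def, simp_all add: insert_commute)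

lemma set_faces:
  "set face_A1 = {pt 1, pt 2, pt 5, pt 7, pt 17, pt 13, pt 21, pt 12, pt 9}"
  "set face_A2 = {pt 6, pt 8, pt 18, pt 14, pt 22, pt 11, pt 10, pt 2, pt 1}"
  "set face_A3 = {pt 7, pt 5, pt 19, pt 15, pt 23, pt 10, pt 11, pt 3, pt 4}"
  "set face_A4 = {pt 4, pt 3, pt 8, pt 6, pt 20, pt 16, pt 24, pt 9, pt 12}"
  "set face_B1 = {pt 1, pt 9, pt 24, pt 23, pt 15, pt 14, pt 18, pt 20, pt 6}"
  "set face_B2 = {pt 13, pt 17, pt 19, pt 5, pt 2, pt 10, pt 23, pt 24, pt 16}"
  "set face_B3 = {pt 21, pt 13, pt 16, pt 20, pt 18, pt 8, pt 3, pt 11, pt 22}"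
  "set face_B4 = {pt 4, pt 12, pt 21, pt 22, pt 14, pt 15, pt 19, pt 17, pt 7}"
  by (simp_all add: face_A1_def face_A2_def face_A3_def face_A4_def face_B1_def face_B2_def face_B3_def face_B4_def)

lemma meet_properly_faces:
  "meet_properly face_A1 face_A2"
  "meet_properly face_A1 face_A3"
  "meet_properly face_A1 face_A4"
  "meet_properly face_A1 face_B1"
  "meet_properly face_A1 face_B2"
  "meet_properly face_A1 face_B3"
  "meet_properly face_A1 face_B4"
  "meet_properly face_A2 face_A3"
  "meet_properly face_A2 face_A4"
  "meet_properly face_A2 face_B1"
  "meet_properly face_A2 face_B2"
  "meet_properly face_A2 face_B3"
  "meet_properly face_A2 face_B4"
  "meet_properly face_A3 face_A4"
  "meet_properly face_A3 face_B1"
  "meet_properly face_A3 face_B2"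
  "meet_properly face_A3 face_B3"
  "meet_properly face_A3 face_B4"
  "meet_properly face_A4 face_B1"
  "meet_properly face_A4 face_B2"
  "meet_properly face_A4 face_B3"
  "meet_properly face_A4 face_B4"
  "meet_properly face_B1 face_B2"
  "meet_properly face_B1 face_B3"
  "meet_properly face_B1 face_B4"
  "meet_properly face_B2 face_B3"
  "meet_properly face_B2 face_B4"
  "meet_properly face_B3 face_B4"
  subgoal by (rule meet_properlyI[of _ _ "{{pt 1, pt 2}}" "{}"]) (use meet_A1_A2 in \<open>auto simp: edges_of_faces set_faces\<close>)
  subgoal by (rule meet_properlyI[of _ _ "{{pt 5, pt 7}}" "{}"]) (use meet_A1_A3 in \<open>auto simp: edges_of_faces set_faces\<close>)
  subgoal by (rule meet_properlyI[of _ _ "{{pt 12, pt 9}}" "{}"]) (use meet_A1_A4 in \<open>auto simp: edges_of_faces set_faces\<close>)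
  subgoal by (rule meet_properlyI[of _ _ "{{pt 9, pt 1}}" "{}"]) (use meet_A1_B1 in \<open>auto simp: edges_of_faces set_faces\<close>)
  subgoal by (rule meet_properlyI[of _ _ "{{pt 2, pt 5}, {pt 17, pt 13}}" "{}"]) (use meet_A1_B2 in \<open>auto simp: edges_of_faces set_faces\<close>)
  subgoal by (rule meet_properlyI[of _ _ "{{pt 13, pt 21}}" "{}"]) (use meet_A1_B3 in \<open>auto simp: edges_of_faces set_faces\<close>)
  subgoal by (rule meet_properlyI[of _ _ "{{pt 7, pt 17}, {pt 21, pt 12}}" "{}"]) (use meet_A1_B4 in \<open>auto simp: edges_of_faces set_faces\<close>)
  subgoal by (rule meet_properlyI[of _ _ "{{pt 11, pt 10}}" "{}"]) (use meet_A2_A3 in \<open>auto simp: edges_of_faces set_faces\<close>)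
  subgoal by (rule meet_properlyI[of _ _ "{{pt 6, pt 8}}" "{}"]) (use meet_A2_A4 in \<open>auto simp: edges_of_faces set_faces\<close>)
  subgoal by (rule meet_properlyI[of _ _ "{{pt 14, pt 18}, {pt 6, pt 1}}" "{}"]) (use meet_A2_B1 in \<open>auto simp: edges_of_faces set_faces\<close>)
  subgoal by (rule meet_properlyI[of _ _ "{{pt 10, pt 2}}" "{}"]) (use meet_A2_B2 in \<open>auto simp: edges_of_faces set_faces\<close>)
  subgoal by (rule meet_properlyI[of _ _ "{{pt 8, pt 18}, {pt 22, pt 11}}" "{}"]) (use meet_A2_B3 in \<open>auto simp: edges_of_faces set_faces\<close>)
  subgoal by (rule meet_properlyI[of _ _ "{{pt 14, pt 22}}" "{}"]) (use meet_A2_B4 in \<open>auto simp: edges_of_faces set_faces\<close>)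
  subgoal by (rule meet_properlyI[of _ _ "{{pt 3, pt 4}}" "{}"]) (use meet_A3_A4 in \<open>auto simp: edges_of_faces set_faces\<close>)
  subgoal by (rule meet_properlyI[of _ _ "{{pt 23, pt 15}}" "{}"]) (use meet_A3_B1 in \<open>auto simp: edges_of_faces set_faces\<close>)
  subgoal by (rule meet_properlyI[of _ _ "{{pt 5, pt 19}, {pt 23, pt 10}}" "{}"]) (use meet_A3_B2 in \<open>auto simp: edges_of_faces set_faces\<close>)
  subgoal by (rule meet_properlyI[of _ _ "{{pt 11, pt 3}}" "{}"]) (use meet_A3_B3 in \<open>auto simp: edges_of_faces set_faces\<close>)
  subgoal by (rule meet_properlyI[of _ _ "{{pt 19, pt 15}, {pt 4, pt 7}}" "{}"]) (use meet_A3_B4 in \<open>auto simp: edges_of_faces set_faces\<close>)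
  subgoal by (rule meet_properlyI[of _ _ "{{pt 9, pt 24}, {pt 20, pt 6}}" "{}"]) (use meet_A4_B1 in \<open>auto simp: edges_of_faces set_faces\<close>)
  subgoal by (rule meet_properlyI[of _ _ "{{pt 16, pt 24}}" "{}"]) (use meet_A4_B2 in \<open>auto simp: edges_of_faces set_faces\<close>)
  subgoal by (rule meet_properlyI[of _ _ "{{pt 3, pt 8}, {pt 20, pt 16}}" "{}"]) (use meet_A4_B3 in \<open>auto simp: edges_of_faces set_faces\<close>)
  subgoal by (rule meet_properlyI[of _ _ "{{pt 12, pt 4}}" "{}"]) (use meet_A4_B4 in \<open>auto simp: edges_of_faces set_faces\<close>)
  subgoal by (rule meet_properlyI[of _ _ "{{pt 24, pt 23}}" "{}"]) (use meet_B1_B2 in \<open>auto simp: edges_of_faces set_faces\<close>)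
  subgoal by (rule meet_properlyI[of _ _ "{{pt 18, pt 20}}" "{}"]) (use meet_B1_B3 in \<open>auto simp: edges_of_faces set_faces\<close>)
  subgoal by (rule meet_properlyI[of _ _ "{{pt 15, pt 14}}" "{}"]) (use meet_B1_B4 in \<open>auto simp: edges_of_faces set_faces\<close>)
  subgoal by (rule meet_properlyI[of _ _ "{{pt 16, pt 13}}" "{}"]) (use meet_B2_B3 in \<open>auto simp: edges_of_faces set_faces\<close>)
  subgoal by (rule meet_properlyI[of _ _ "{{pt 17, pt 19}}" "{}"]) (use meet_B2_B4 in \<open>auto simp: edges_of_faces set_faces\<close>)
  subgoal by (rule meet_properlyI[of _ _ "{{pt 22, pt 21}}" "{}"]) (use meet_B3_B4 in \<open>auto simp: edges_of_faces set_faces\<close>)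
  done

lemma meet_properly_nonagon_faces:
  assumes "f \<in> nonagon_faces" "g \<in> nonagon_faces" "f \<noteq> g"
  shows "meet_properly f g"
proof -
  have "\<forall>f\<in>nonagon_faces. \<forall>g\<in>nonagon_faces. f = g \<or> meet_properly f g"
    unfolding nonagon_faces_def ball_simps(5,7) simp_thms
    by (intro conjI; (rule disjI2, rule meet_properly_faces | rule disjI2, rule meet_properly_sym, rule meet_properly_faces))
  then show ?thesis using assms by blast
qed

lemma simple_polygon_faces: "f \<in> nonagon_faces \<Longrightarrow> simple_polygon f"
  unfolding nonagon_faces_def
  using simple_polygon_A1 simple_polygon_B1 half_turn_A2(3) half_turn_A3(3) half_turn_A4(3)
    half_turn_B2(3) half_turn_B3(3) half_turn_B4(3) by blast

lemma polyhedral_surface_nonagon_faces: "polyhedral_surface nonagon_faces"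
  unfolding polyhedral_surface_def
proof (intro conjI ballI impI)
  show "finite nonagon_faces" "nonagon_faces \<noteq> {}" by (simp_all add: nonagon_faces_def)
  show "connected (surface nonagon_faces)" by (rule connected_surface)
  show "region f \<inter> region g =
          (\<Union>e \<in> edges_of f \<inter> edges_of g. convex hull e) \<union> (set f \<inter> set g)"
    if "f \<in> nonagon_faces" "g \<in> nonagon_faces" "f \<noteq> g" for f g
    using meet_properly_nonagon_faces[OF that] unfolding meet_properly_def .
qed (simp_all add: simple_polygon_faces card_faces_at_edge single_cycle_at_vertex)

lemma has_genus_nonagon_faces: "has_genus nonagon_faces 3"
proof -
  have "f \<in> unoriented_cycle f" for f
    unfolding unoriented_cycle_def oriented_cycle_def by (auto intro!: exI[of _ 0])
  then have "orientable nonagon_faces"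
    unfolding orientable_def using directed_edges_disjoint by (intro exI[of _ "\<lambda>f. f"]) blast
  then show ?thesis
    by (simp add: has_genus_def euler_characteristic_def card_edges card_vertices card_nonagon_faces)
qed

text \<open>A difference of two points of the set is orthogonal to both normals, hence parallel to
  their cross product; Lagrange's identity for the double cross product expresses this as a
  vanishing cross product.\<close>

lemma collinear_two_planes:
  assumes "\<And>p. p \<in> S \<Longrightarrow> lin a b c d p = 0" "\<And>p. p \<in> S \<Longrightarrow> lin a' b' c' d' p = 0"
    and "cross3 (vector [a, b, c]) (vector [a', b', c']) \<noteq> 0"
  shows "collinear S"
  unfolding collinear_def
proof (intro exI[of _ "cross3 (vector [a, b, c]) (vector [a', b', c'])"] ballI)
  let ?n = "vector [a, b, c] :: real^3" and ?m = "vector [a', b', c'] :: real^3"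
  fix x y assume "x \<in> S" "y \<in> S"
  then have "(x - y) \<bullet> ?m = 0" "(x - y) \<bullet> ?n = 0"
    using assms(1)[of x] assms(1)[of y] assms(2)[of x] assms(2)[of y]
    by (simp_all add: lin_def inner_vec_def sum_3 algebra_simps)
  then have "cross3 (x - y) (cross3 ?n ?m) = 0" by (simp add: Lagrange)
  then have "collinear {0, cross3 ?n ?m, x - y}" by (simp add: cross_eq_0 insert_commute)
  then show "\<exists>k. x - y = k *\<^sub>R cross3 ?n ?m"
    using assms(3) unfolding collinear_lemma by (metis scale_zero_left)
qed

lemma collinear_common_edges:
  assumes "\<And>p. p \<in> region f \<Longrightarrow> lin a b c d p = 0" "\<And>p. p \<in> region g \<Longrightarrow> lin a' b' c' d' p = 0"
    and "cross3 (vector [a, b, c]) (vector [a', b', c']) \<noteq> 0"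
  shows "collinear (\<Union> (edges_of f \<inter> edges_of g))"
proof (rule collinear_two_planes[OF _ _ assms(3)])
  fix p assume "p \<in> \<Union> (edges_of f \<inter> edges_of g)"
  then obtain e where "e \<in> edges_of f" "e \<in> edges_of g" "p \<in> convex hull e" by (auto intro: hull_inc)
  then have "p \<in> region f" "p \<in> region g" unfolding region_def boundary_curve_def by blast+
  then show "lin a b c d p = 0" "lin a' b' c' d' p = 0" using assms by blast+
qed

section \<open>Outward orientation\<close>

text \<open>As a sum over the set of directed edges the normal visibly does not depend on the
  starting vertex, and it changes sign when all edges are swapped.\<close>

lemma right_hand_normal_eq_sum:
  assumes "distinct f"
  shows "right_hand_normal f = (\<Sum>(p, q)\<in>directed_edges f. cross3 p q)"
proof -
  have "directed_edges f = (\<lambda>i. (f ! i, f ! (Suc i mod length f))) ` {..<length f}"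
    unfolding directed_edges_def by auto
  moreover have "inj_on (\<lambda>i. (f ! i, f ! (Suc i mod length f))) {..<length f}"
    using assms by (auto intro!: inj_onI simp: nth_eq_iff_index_eq)
  ultimately show ?thesis
    unfolding right_hand_normal_def next_vertex_def by (simp add: sum.reindex)
qed

lemma directed_edges_rev: "directed_edges (rev f) = prod.swap ` directed_edges f"
proof -
  have *: "directed_edges (rev f) \<subseteq> prod.swap ` directed_edges f" for f
  proof
    fix e assume "e \<in> directed_edges (rev f)"
    then obtain i where i: "i < length f" "e = (rev f ! i, rev f ! (Suc i mod length f))"
      unfolding directed_edges_def by auto
    let ?n = "length f"
    \<comment> \<open>The position in \<open>f\<close> of the edge that is the reverse of edge
      \<open>i\<close> of \<open>rev f\<close>; the edge closing the cycle at the last position is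
      its own counterpart.\<close>
    define j where "j = (if Suc i = ?n then ?n - 1 else ?n - Suc (Suc i))"
    have "j < ?n" using i by (auto simp: j_def)
    moreover have "prod.swap e = (f ! j, f ! (Suc j mod ?n))"
    proof (cases "Suc i = ?n")
      case True
      have n: "Suc (?n - 1) = ?n" using i(1) by arith
      have "rev f ! 0 = f ! (?n - 1)"
        using rev_nth[of 0 f] le_less_trans[OF le0 i(1)] by (simp only: One_nat_def)
      moreover have "rev f ! i = f ! 0" using rev_nth[of i f] i(1) True by simp
      moreover have j: "j = ?n - 1" unfolding j_def using True by (rule if_P)
      moreover have "Suc i mod ?n = 0" unfolding True by (rule mod_self)
      moreover have "Suc j mod ?n = 0" unfolding j n by (rule mod_self)
      ultimately show ?thesis unfolding i(2) by (simp only: swap_simp)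
    next
      case False
      then have "Suc i < ?n" using i by simp
      have j: "j = ?n - Suc (Suc i)" unfolding j_def using False by (rule if_not_P)
      have "Suc j = ?n - Suc i" unfolding j using \<open>Suc i < ?n\<close> by (rule Suc_diff_Suc)
      moreover have "?n - Suc i < ?n" using i(1) by arith
      ultimately have "Suc j mod ?n = ?n - Suc i" by (simp only: mod_less)
      moreover have "Suc i mod ?n = Suc i" using \<open>Suc i < ?n\<close> by (rule mod_less)
      moreover have "rev f ! i = f ! (?n - Suc i)" using i(1) by (rule rev_nth)
      moreover have "rev f ! Suc i = f ! j" unfolding j using \<open>Suc i < ?n\<close> by (rule rev_nth)
      ultimately show ?thesis unfolding i(2) by (simp only: swap_simp)
    qed
    ultimately have "prod.swap e \<in> directed_edges f" unfolding directed_edges_def by blast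
    then show "e \<in> prod.swap ` directed_edges f" by (metis image_eqI swap_swap)
  qed
  have "prod.swap ` directed_edges f \<subseteq> prod.swap ` prod.swap ` directed_edges (rev f)"
    using *[of "rev f"] by (intro image_mono) simp
  then show ?thesis using *[of f] by (simp add: image_image)
qed

lemma right_hand_normal_rev: "distinct f \<Longrightarrow> right_hand_normal (rev f) = - right_hand_normal f"
proof -
  assume "distinct f"
  moreover have "inj_on prod.swap (directed_edges f)" by (auto simp: inj_on_def prod_eq_iff)
  ultimately show ?thesis
    by (simp add: right_hand_normal_eq_sum directed_edges_rev sum.reindex split_beta sum_negf[symmetric] cross_skew[symmetric])
qed

lemma directed_edges_rotate: "directed_edges (rotate k f) = directed_edges f"
  by (induction k) (simp_all add: rotate_Suc directed_edges_rotate1)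

lemma polygon_interior_rev: "polygon_interior (rev f) = polygon_interior f"
proof -
  have "edges_of (rev f) = edges_of f"
    unfolding edges_of_def directed_edges_rev by (auto simp: image_image insert_commute split_beta intro!: image_cong)
  then show ?thesis by (simp add: polygon_interior_def boundary_curve_def)
qed

text \<open>Openness keeps the condition \<open>I\<close> for small \<open>t\<close>, while along
  the normal the form grows from zero at the rate \<open>k\<close> times the squared length of
  \<open>(a, b, c)\<close>.\<close>

lemma eventually_off_plane:
  assumes "open {x. I x}" "I x" "lin a b c d x = 0" "k > 0" "(a, b, c) \<noteq> (0, 0, 0)"
  shows "\<forall>\<^sub>F t in at_right 0. I (x + t *\<^sub>R (k *\<^sub>R vector [a, b, c])) \<and>
           lin a b c d (x + t *\<^sub>R (k *\<^sub>R vector [a, b, c])) > 0"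
proof -
  let ?n = "k *\<^sub>R vector [a, b, c] :: real^3"
  have "((\<lambda>t. x + t *\<^sub>R ?n) \<longlongrightarrow> x + 0 *\<^sub>R ?n) (at_right 0)" by (intro tendsto_intros)
  then have "\<forall>\<^sub>F t in at_right 0. x + t *\<^sub>R ?n \<in> {x. I x}"
    by (rule topological_tendstoD) (use assms(1,2) in simp_all)
  moreover have "\<forall>\<^sub>F t in at_right (0::real). t > 0" by (rule eventually_at_right_less)
  ultimately show ?thesis
  proof eventually_elim
    fix t :: real assume t: "x + t *\<^sub>R ?n \<in> {x. I x}" "t > 0"
    have "a * a + b * b + c * c > 0" using assms(5)
      by (metis add_nonneg_eq_0_iff add_nonneg_nonneg mult_eq_0_iff order_le_less zero_le_square)
    moreover have "lin a b c d (x + t *\<^sub>R ?n) = lin a b c d x + (t * k) * (a * a + b * b + c * c)"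
      by (simp add: lin_def algebra_simps)
    ultimately show "I (x + t *\<^sub>R ?n) \<and> lin a b c d (x + t *\<^sub>R ?n) > 0"
      using t assms(3,4) by simp
  qed
qed

lemma outward_orientedI:
  assumes I: "polygon_interior f = {x. lin a b c d x = 0 \<and> I x}" "open {x. I x}"
    and N: "right_hand_normal f = k *\<^sub>R vector [a, b, c]" "k > 0" "(a, b, c) \<noteq> (0, 0, 0)"
    and out: "\<And>y. I y \<Longrightarrow> lin a b c d y > 0 \<Longrightarrow> y \<notin> solid F"
  shows "outward_oriented F f"
  unfolding outward_oriented_def N(1)
proof
  fix x assume "x \<in> polygon_interior f"
  then have "I x" "lin a b c d x = 0" using I by auto
  from eventually_off_plane[OF I(2) this N(2,3)]
  show "\<forall>\<^sub>F t in at_right 0. x + t *\<^sub>R (k *\<^sub>R vector [a, b, c]) \<notin> solid F"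
    by eventually_elim (use out in blast)
qed

text \<open>Needed to exclude the reversed face cycles from the outward ones: their normal points
  into the solid. A nonempty interior is required, as otherwise every polygon would count as
  outward.\<close>

lemma not_outward_orientedI:
  assumes I: "polygon_interior f = {x. lin a b c d x = 0 \<and> I x}" "open {x. I x}" "polygon_interior f \<noteq> {}"
    and N: "right_hand_normal f = - (k *\<^sub>R vector [a, b, c])" "k > 0" "(a, b, c) \<noteq> (0, 0, 0)"
    and ins: "\<And>y. I y \<Longrightarrow> lin a b c d y < 0 \<Longrightarrow> y \<in> solid F"
  shows "\<not> outward_oriented F f"
proof
  assume o: "outward_oriented F f"
  obtain x where x: "x \<in> polygon_interior f" using I(3) by auto
  \<comment> \<open>All signs are negated so that the previous estimate applies to the inward
    direction.\<close>
  then have x2: "I x" "lin (- a) (- b) (- c) (- d) x = 0" using I(1) by (auto simp: lin_def)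
  have n: "- (k *\<^sub>R vector [a, b, c]) = k *\<^sub>R (vector [- a, - b, - c] :: real^3)"
    by (simp add: vec3_eq_iff)
  have "\<forall>\<^sub>F t in at_right 0. x + t *\<^sub>R right_hand_normal f \<notin> solid F"
    using o x unfolding outward_oriented_def by blast
  moreover have "\<forall>\<^sub>F t in at_right 0. x + t *\<^sub>R right_hand_normal f \<in> solid F"
    unfolding N(1) n using eventually_off_plane[OF I(2) x2 N(2)] N(3)
    by (auto elim!: eventually_mono intro!: ins simp: lin_def)
  ultimately have "\<forall>\<^sub>F t in at_right (0::real). False" by eventually_elim simp
  then show False by (simp add: trivial_limit_at_right_real)
qed

lemma right_hand_normal_eq_sum_list: "right_hand_normal f = sum_list (map2 cross3 f (rotate1 f))"
  unfolding right_hand_normal_def next_vertex_def sum_list_sum_nth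
  by (simp add: nth_rotate1 atLeast0LessThan)

text \<open>The factor is twice the area of the face divided by the length of the gradient of its
  form. Its positivity says that the listed cycle runs counter-clockwise seen from the side where
  the form is positive.\<close>

lemma right_hand_normal_faces:
  "right_hand_normal face_A1 = (86555267 / 12113640) *\<^sub>R vector [3, - 4, - 2]"
  "right_hand_normal face_A2 = (86555267 / 12113640) *\<^sub>R vector [- 3, 4, - 2]"
  "right_hand_normal face_A3 = (86555267 / 12113640) *\<^sub>R vector [3, 4, 2]"
  "right_hand_normal face_A4 = (86555267 / 12113640) *\<^sub>R vector [- 3, - 4, 2]"
  "right_hand_normal face_B1 = (4537289 / 2018940) *\<^sub>R vector [2, - 5, 5]"
  "right_hand_normal face_B2 = (4537289 / 2018940) *\<^sub>R vector [- 2, 5, 5]"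
  "right_hand_normal face_B3 = (4537289 / 2018940) *\<^sub>R vector [2, 5, - 5]"
  "right_hand_normal face_B4 = (4537289 / 2018940) *\<^sub>R vector [- 2, - 5, - 5]"
  by (simp_all add: right_hand_normal_eq_sum_list face_A1_def face_A2_def face_A3_def face_A4_def face_B1_def face_B2_def face_B3_def face_B4_def, simp_all add: pt_simps cross3_def vec3_eq_iff)

lemma open_inside: "open {x. inside_A1 x}" "open {x. inside_B1 x}"
  unfolding inside_A1_def inside_B1_def
  by (intro open_Collect_disj open_Collect_conj open_lin_lt open_lin_gt)+

lemma (in orthogonal_involution) open_Collect: "open {x. P x} \<Longrightarrow> open {x. P (T x)}"
  using open_vimage[of "{x. P x}" T] linear
  by (simp add: vimage_def linear_continuous_on linear_conv_bounded_linear)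

lemma outward_oriented_faces:
  "outward_oriented nonagon_faces face_A1"
  "outward_oriented nonagon_faces face_A2"
  "outward_oriented nonagon_faces face_A3"
  "outward_oriented nonagon_faces face_A4"
  "outward_oriented nonagon_faces face_B1"
  "outward_oriented nonagon_faces face_B2"
  "outward_oriented nonagon_faces face_B3"
  "outward_oriented nonagon_faces face_B4"
  subgoal by (rule outward_orientedI[OF polygon_interior_A1 open_inside(1) right_hand_normal_faces(1)])
    (simp_all add: solid_nonagon_faces sides_A1(1))
  subgoal by (rule outward_orientedI[OF half_turn_A2(1) half_turn_z.open_Collect[OF open_inside(1)] right_hand_normal_faces(2)])
    (simp_all add: solid_nonagon_faces sides_A2(1))
  subgoal by (rule outward_orientedI[OF half_turn_A3(1) half_turn_x.open_Collect[OF open_inside(1)] right_hand_normal_faces(3)])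
    (simp_all add: solid_nonagon_faces sides_A3(1))
  subgoal by (rule outward_orientedI[OF half_turn_A4(1) half_turn_y.open_Collect[OF open_inside(1)] right_hand_normal_faces(4)])
    (simp_all add: solid_nonagon_faces sides_A4(1))
  subgoal by (rule outward_orientedI[OF polygon_interior_B1 open_inside(2) right_hand_normal_faces(5)])
    (simp_all add: solid_nonagon_faces sides_B1(1))
  subgoal by (rule outward_orientedI[OF half_turn_B2(1) half_turn_z.open_Collect[OF open_inside(2)] right_hand_normal_faces(6)])
    (simp_all add: solid_nonagon_faces sides_B2(1))
  subgoal by (rule outward_orientedI[OF half_turn_B3(1) half_turn_x.open_Collect[OF open_inside(2)] right_hand_normal_faces(7)])
    (simp_all add: solid_nonagon_faces sides_B3(1))
  subgoal by (rule outward_orientedI[OF half_turn_B4(1) half_turn_y.open_Collect[OF open_inside(2)] right_hand_normal_faces(8)])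
    (simp_all add: solid_nonagon_faces sides_B4(1))
  done

lemma polygon_interior_nonempty:
  "polygon_interior face_A1 \<noteq> {}"
  "polygon_interior face_A2 \<noteq> {}"
  "polygon_interior face_A3 \<noteq> {}"
  "polygon_interior face_A4 \<noteq> {}"
  "polygon_interior face_B1 \<noteq> {}"
  "polygon_interior face_B2 \<noteq> {}"
  "polygon_interior face_B3 \<noteq> {}"
  "polygon_interior face_B4 \<noteq> {}"
proof -
  have "(1/2) *\<^sub>R pt 2 + (1/2) *\<^sub>R pt 7 \<in> polygon_interior face_A1"
    unfolding polygon_interior_A1 inside_A1_def by (simp add: lin_combination, simp add: lin_def pt_simps)
  then have A: "polygon_interior face_A1 \<noteq> {}" by blast
  have "(1/2) *\<^sub>R pt 1 + (1/2) *\<^sub>R pt 24 \<in> polygon_interior face_B1"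
    unfolding polygon_interior_B1 inside_B1_def by (simp add: lin_combination, simp add: lin_def pt_simps)
  then have B: "polygon_interior face_B1 \<noteq> {}" by blast
  show "polygon_interior face_A1 \<noteq> {}"
    "polygon_interior face_A2 \<noteq> {}"
    "polygon_interior face_A3 \<noteq> {}"
    "polygon_interior face_A4 \<noteq> {}"
    "polygon_interior face_B1 \<noteq> {}"
    "polygon_interior face_B2 \<noteq> {}"
    "polygon_interior face_B3 \<noteq> {}"
    "polygon_interior face_B4 \<noteq> {}"
    unfolding face_A2_eq face_A3_eq face_A4_eq face_B2_eq face_B3_eq face_B4_eq rotate_invariants
      half_turn_x.polygon_interior_map half_turn_y.polygon_interior_map half_turn_z.polygon_interior_map
    using A B by blast+
qed

text \<open>Stated through the interior and the normal only, so that it applies to every rotation of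
  a reversed face list.\<close>

lemma not_outward_oriented_faces:
  assumes "polygon_interior g = polygon_interior f" "right_hand_normal g = - right_hand_normal f"
    and "f \<in> nonagon_faces"
  shows "\<not> outward_oriented nonagon_faces g"
proof -
  consider "f = face_A1" | "f = face_A2" | "f = face_A3" | "f = face_A4" | "f = face_B1" | "f = face_B2" | "f = face_B3" | "f = face_B4"
    using assms(3) unfolding nonagon_faces_def by blast
  then show ?thesis
  proof cases
    case 1
    note g = assms(1,2)[unfolded 1 polygon_interior_A1 right_hand_normal_faces(1)]
    show ?thesis
      by (rule not_outward_orientedI[OF g(1) open_inside(1) _ g(2)])
        (use polygon_interior_nonempty(1) in_solid_not_off_solid sides_A1(2) in
          \<open>simp_all add: solid_nonagon_faces assms(1) 1\<close>)
  next
    case 2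
    note g = assms(1,2)[unfolded 2 half_turn_A2(1) right_hand_normal_faces(2)]
    show ?thesis
      by (rule not_outward_orientedI[OF g(1) half_turn_z.open_Collect[OF open_inside(1)] _ g(2)])
        (use polygon_interior_nonempty(2) in_solid_not_off_solid sides_A2(2) in
          \<open>simp_all add: solid_nonagon_faces assms(1) 2\<close>)
  next
    case 3
    note g = assms(1,2)[unfolded 3 half_turn_A3(1) right_hand_normal_faces(3)]
    show ?thesis
      by (rule not_outward_orientedI[OF g(1) half_turn_x.open_Collect[OF open_inside(1)] _ g(2)])
        (use polygon_interior_nonempty(3) in_solid_not_off_solid sides_A3(2) in
          \<open>simp_all add: solid_nonagon_faces assms(1) 3\<close>)
  next
    case 4
    note g = assms(1,2)[unfolded 4 half_turn_A4(1) right_hand_normal_faces(4)]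
    show ?thesis
      by (rule not_outward_orientedI[OF g(1) half_turn_y.open_Collect[OF open_inside(1)] _ g(2)])
        (use polygon_interior_nonempty(4) in_solid_not_off_solid sides_A4(2) in
          \<open>simp_all add: solid_nonagon_faces assms(1) 4\<close>)
  next
    case 5
    note g = assms(1,2)[unfolded 5 polygon_interior_B1 right_hand_normal_faces(5)]
    show ?thesis
      by (rule not_outward_orientedI[OF g(1) open_inside(2) _ g(2)])
        (use polygon_interior_nonempty(5) in_solid_not_off_solid sides_B1(2) in
          \<open>simp_all add: solid_nonagon_faces assms(1) 5\<close>)
  next
    case 6
    note g = assms(1,2)[unfolded 6 half_turn_B2(1) right_hand_normal_faces(6)]
    show ?thesis
      by (rule not_outward_orientedI[OF g(1) half_turn_z.open_Collect[OF open_inside(2)] _ g(2)])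
        (use polygon_interior_nonempty(6) in_solid_not_off_solid sides_B2(2) in
          \<open>simp_all add: solid_nonagon_faces assms(1) 6\<close>)
  next
    case 7
    note g = assms(1,2)[unfolded 7 half_turn_B3(1) right_hand_normal_faces(7)]
    show ?thesis
      by (rule not_outward_orientedI[OF g(1) half_turn_x.open_Collect[OF open_inside(2)] _ g(2)])
        (use polygon_interior_nonempty(7) in_solid_not_off_solid sides_B3(2) in
          \<open>simp_all add: solid_nonagon_faces assms(1) 7\<close>)
  next
    case 8
    note g = assms(1,2)[unfolded 8 half_turn_B4(1) right_hand_normal_faces(8)]
    show ?thesis
      by (rule not_outward_orientedI[OF g(1) half_turn_y.open_Collect[OF open_inside(2)] _ g(2)])
        (use polygon_interior_nonempty(8) in_solid_not_off_solid sides_B4(2) in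
          \<open>simp_all add: solid_nonagon_faces assms(1) 8\<close>)
  qed
qed

subsection \<open>Combinatorial automorphisms\<close>

text \<open>Position \<open>a + 4 * s\<close> holds the permutation corresponding to the element \<open>(a, s)\<close> of the
  dihedral group; entry \<open>i - 1\<close> of a list is the image of the index \<open>i\<close>.\<close>

definition auts :: "nat list list" where
  "auts =
     [[1, 2, 3, 4, 5, 6, 7, 8, 9, 10, 11, 12, 13, 14, 15, 16, 17, 18, 19, 20, 21, 22, 23, 24],
      [15, 14, 13, 16, 18, 19, 20, 17, 23, 22, 21, 24, 1, 4, 3, 2, 6, 7, 8, 5, 9, 12, 11, 10],
      [3, 4, 1, 2, 7, 8, 5, 6, 11, 12, 9, 10, 15, 16, 13, 14, 19, 20, 17, 18, 23, 24, 21, 22],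
      [13, 16, 15, 14, 20, 17, 18, 19, 21, 24, 23, 22, 3, 2, 1, 4, 8, 5, 6, 7, 11, 10, 9, 12],
      [2, 1, 4, 3, 6, 5, 8, 7, 10, 9, 12, 11, 14, 13, 16, 15, 18, 17, 20, 19, 22, 21, 24, 23],
      [14, 15, 16, 13, 19, 18, 17, 20, 22, 23, 24, 21, 4, 1, 2, 3, 7, 6, 5, 8, 12, 9, 10, 11],
      [4, 3, 2, 1, 8, 7, 6, 5, 12, 11, 10, 9, 16, 15, 14, 13, 20, 19, 18, 17, 24, 23, 22, 21],
      [16, 13, 14, 15, 17, 20, 19, 18, 24, 21, 22, 23, 2, 3, 4, 1, 5, 8, 7, 6, 10, 11, 12, 9]]"

definition all_cycles :: "nat list \<Rightarrow> nat list list" where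
  "all_cycles l = map (\<lambda>k. rotate k l) [0..<length l] @ map (\<lambda>k. rotate k (rev l)) [0..<length l]"

definition act :: "nat list \<Rightarrow> nat list \<Rightarrow> nat list" where
  "act s l = map (\<lambda>i. s ! (i - 1)) l"

definition pt_index :: "real^3 \<Rightarrow> nat" where
  "pt_index p = inv_into {1..24} pt p"

text \<open>Off the vertices it is the identity, as \<open>permutes\<close> demands.\<close>

definition aut_map :: "nat list \<Rightarrow> real^3 \<Rightarrow> real^3" where
  "aut_map s p = (if p \<in> pt ` {1..24} then pt (s ! (pt_index p - 1)) else p)"

lemma pt_index_pt: "i \<in> {1..24} \<Longrightarrow> pt_index (pt i) = i"
  unfolding pt_index_def using inj_on_pt by (rule inv_into_f_f)

lemma aut_map_pt: "i \<in> {1..24} \<Longrightarrow> aut_map s (pt i) = pt (s ! (i - 1))"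
  unfolding aut_map_def by (simp add: pt_index_pt del: atLeastAtMost_iff)

lemma map_aut_map: "set l \<subseteq> {1..24} \<Longrightarrow> map (aut_map s) (map pt l) = map pt (act s l)"
  unfolding act_def map_map o_def by (intro map_cong refl aut_map_pt) blast

lemma oriented_cycle_eq: "f \<noteq> [] \<Longrightarrow> oriented_cycle f = (\<lambda>k. rotate k f) ` {0..<length f}"
proof (intro equalityI subsetI)
  fix g assume f: "f \<noteq> []" and "g \<in> oriented_cycle f"
  then obtain k where "g = rotate k f" unfolding oriented_cycle_def by blast
  then have "g = rotate (k mod length f) f" by (metis rotate_conv_mod)
  then show "g \<in> (\<lambda>k. rotate k f) ` {0..<length f}" using f by simp
qed (auto simp: oriented_cycle_def)

lemma unoriented_cycle_map_pt: "l \<noteq> [] \<Longrightarrow> unoriented_cycle (map pt l) = map pt ` set (all_cycles l)"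
  unfolding unoriented_cycle_def all_cycles_def
  by (simp add: oriented_cycle_eq rev_map rotate_map image_Un image_image)

lemma oriented_cycle_self: "f \<in> oriented_cycle f"
  unfolding oriented_cycle_def by (intro CollectI exI[of _ 0]) simp

text \<open>Reversal turns a rotation into the inverse rotation, and the class does not see
  rotations.\<close>

lemma oriented_cycle_rev: "oriented_cycle (rev (rotate k f)) = oriented_cycle (rev f)"
proof (cases "f = []")
  case False
  let ?n = "length f"
  have "rev (rotate k f) = rotate (?n - k mod ?n) (rev f)"
  proof (cases "k mod ?n = 0")
    case True
    then have "rotate k f = f" by (rule rotate_id)
    moreover have "rotate ?n (rev f) = rev f" by (rule rotate_id) simp
    ultimately show ?thesis using True by simp
  next
    case False
    have "k mod ?n < ?n" using \<open>f \<noteq> []\<close> by simp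
    then have "?n - (?n - k mod ?n) mod ?n = k mod ?n" using False by simp
    then show ?thesis by (simp add: rotate_rev rotate_conv_mod[of k f])
  qed
  then show ?thesis by (simp only: oriented_cycle_rotate)
qed simp

lemma unoriented_cycle_rotate: "unoriented_cycle (rotate k f) = unoriented_cycle f"
  by (simp add: unoriented_cycle_def oriented_cycle_rotate oriented_cycle_rev)

lemma unoriented_cycle_self: "f \<in> unoriented_cycle f"
  by (simp add: unoriented_cycle_def oriented_cycle_self)

lemma auts_facts:
  assumes "s \<in> set auts"
  shows "distinct s" "set s = {1..24}" "length s = 24"
proof -
  have "list_all (\<lambda>s. distinct s \<and> length s = 24 \<and> list_all (\<lambda>i. i \<in> set [1..<25]) s \<and> list_all (\<lambda>i. i \<in> set s) [1..<25]) auts"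
    by code_simp
  then have *: "distinct s \<and> length s = 24 \<and> list_all (\<lambda>i. i \<in> set [1..<25]) s \<and> list_all (\<lambda>i. i \<in> set s) [1..<25]"
    using assms by (simp only: list_all_iff) blast
  then show "distinct s" "length s = 24" by simp_all
  have "set s = set [1..<25]" using * unfolding list_all_iff by blast
  also have "\<dots> = {1..24}" by auto
  finally show "set s = {1..24}" .
qed

lemma aut_map_permutes:
  assumes "s \<in> set auts"
  shows "aut_map s permutes vertices nonagon_faces"
proof -
  have s: "s ! (i - 1) \<in> {1..24}" if "i \<in> {1..24}" for i
  proof -
    have "i - 1 < length s" using that unfolding auts_facts(3)[OF assms] atLeastAtMost_iff by arith
    then show ?thesis using nth_mem auts_facts(2)[OF assms] by blast
  qed
  have "inj_on (aut_map s) (pt ` {1..24})"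
  proof (rule inj_onI)
    fix p q assume "p \<in> pt ` {1..24}" "q \<in> pt ` {1..24}" "aut_map s p = aut_map s q"
    then obtain i j where i: "i \<in> {1..24}" "p = pt i" and j: "j \<in> {1..24}" "q = pt j"
      and "aut_map s (pt i) = aut_map s (pt j)" by blast
    then have "pt (s ! (i - 1)) = pt (s ! (j - 1))" by (simp only: aut_map_pt)
    then have "s ! (i - 1) = s ! (j - 1)" using pt_eq_iff[OF s[OF i(1)] s[OF j(1)]] by blast
    moreover have "i - 1 < length s" "j - 1 < length s"
      using i(1) j(1) unfolding auts_facts(3)[OF assms] atLeastAtMost_iff by arith+
    ultimately have "i - 1 = j - 1"
      using nth_eq_iff_index_eq[OF auts_facts(1)[OF assms]] by blast
    then have "i = j" using i(1) j(1) unfolding atLeastAtMost_iff by arith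
    then show "p = q" using i(2) j(2) by (simp only:)
  qed
  moreover have "aut_map s ` pt ` {1..24} \<subseteq> pt ` {1..24}" using s by (intro image_subsetI; elim imageE; hypsubst) (simp only: aut_map_pt imageI)
  ultimately have "bij_betw (aut_map s) (pt ` {1..24}) (pt ` {1..24})"
    by (simp add: bij_betw_def endo_inj_surj)
  then show ?thesis unfolding vertices_nonagon_faces
    by (rule bij_imp_permutes) (simp add: aut_map_def)
qed

definition rotations :: "nat list \<Rightarrow> nat list list" where
  "rotations l = map (\<lambda>k. rotate k l) [0..<length l]"

lemma aut_map_face:
  assumes "s \<in> set auts" "l \<in> set face_lists" "act s l \<in> set (rotations m)" "m \<in> set face_lists"
  shows "map (aut_map s) (map pt l) \<in> oriented_cycle (map pt m)"
proof -
  obtain k where "act s l = rotate k m" using assms(3) unfolding rotations_def by auto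
  then have "map (aut_map s) (map pt l) = rotate k (map pt m)"
    by (simp only: map_aut_map[OF face_lists_facts(3)[OF assms(2)]] rotate_map)
  then show ?thesis unfolding oriented_cycle_def by blast
qed

text \<open>The images are found among the rotations of a face list, never among the reversals; this
  also makes the automorphisms orientation-preserving. The two claims give the two inclusions
  between the sets of cycles.\<close>

lemma act_faces:
  assumes "s \<in> set auts"
  shows "l \<in> set face_lists \<Longrightarrow> \<exists>m\<in>set face_lists. act s l \<in> set (rotations m)"
    and "m \<in> set face_lists \<Longrightarrow> \<exists>l\<in>set face_lists. act s l \<in> set (rotations m)"
proof -
  have "list_all (\<lambda>s. list_all (\<lambda>l. list_ex (\<lambda>m. act s l \<in> set (rotations m)) face_lists) face_lists \<and>
      list_all (\<lambda>m. list_ex (\<lambda>l. act s l \<in> set (rotations m)) face_lists) face_lists) auts"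
    by code_simp
  then have "list_all (\<lambda>l. list_ex (\<lambda>m. act s l \<in> set (rotations m)) face_lists) face_lists \<and>
      list_all (\<lambda>m. list_ex (\<lambda>l. act s l \<in> set (rotations m)) face_lists) face_lists"
    using assms by (simp only: list_all_iff) blast
  then show "l \<in> set face_lists \<Longrightarrow> \<exists>m\<in>set face_lists. act s l \<in> set (rotations m)"
    and "m \<in> set face_lists \<Longrightarrow> \<exists>l\<in>set face_lists. act s l \<in> set (rotations m)"
    unfolding list_all_iff list_ex_iff by blast+
qed

lemma unoriented_cycle_oriented: "g \<in> oriented_cycle f \<Longrightarrow> unoriented_cycle g = unoriented_cycle f"
  unfolding oriented_cycle_def using unoriented_cycle_rotate by blast

lemma aut_map_automorphism:
  assumes "s \<in> set auts"
  shows "aut_map s \<in> automorphisms nonagon_faces"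
proof -
  have "unoriented_cycle (map (aut_map s) (map pt l)) = unoriented_cycle (map pt m)"
    if "l \<in> set face_lists" "act s l \<in> set (rotations m)" "m \<in> set face_lists" for l m
    using aut_map_face[OF assms that] by (rule unoriented_cycle_oriented)
  then have "(\<lambda>l. unoriented_cycle (map (aut_map s) (map pt l))) ` set face_lists =
      (\<lambda>m. unoriented_cycle (map pt m)) ` set face_lists"
    using act_faces[OF assms] by (intro equalityI image_subsetI) (metis image_eqI)+
  then show ?thesis
    unfolding automorphisms_def nonagon_faces_eq using aut_map_permutes[OF assms]
    by (simp add: image_image nonagon_faces_eq)
qed

text \<open>A necessary condition for one injective map to send the list \<open>l\<^sub>0\<close> to
  \<open>L\<^sub>0\<close> and \<open>l\<close> to \<open>L\<close>: shared entries have the image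
  already fixed, and new entries avoid the values already taken.\<close>

definition compatible :: "nat list \<Rightarrow> nat list \<Rightarrow> nat list \<Rightarrow> nat list \<Rightarrow> bool" where
  "compatible l\<^sub>0 L\<^sub>0 l L = list_all (\<lambda>(a, b).
     case map_of (zip l\<^sub>0 L\<^sub>0) a of None \<Rightarrow> b \<notin> set L\<^sub>0 | Some c \<Rightarrow> b = c) (zip l L)"

lemma compatible_map:
  assumes "inj_on \<sigma> X" "set l\<^sub>0 \<subseteq> X" "set l \<subseteq> X"
  shows "compatible l\<^sub>0 (map \<sigma> l\<^sub>0) l (map \<sigma> l)"
proof -
  have "case map_of (zip l\<^sub>0 (map \<sigma> l\<^sub>0)) a of None \<Rightarrow> \<sigma> a \<notin> set (map \<sigma> l\<^sub>0) | Some c \<Rightarrow> \<sigma> a = c"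
    if "a \<in> set l" for a
  proof (cases "a \<in> set l\<^sub>0")
    case True
    then show ?thesis by (simp add: map_of_zip_map)
  next
    case False
    then have "\<sigma> a \<notin> \<sigma> ` set l\<^sub>0"
      using assms that by (metis inj_on_image_mem_iff subsetD)
    then show ?thesis using False by (simp add: map_of_zip_map)
  qed
  moreover have "b = \<sigma> a \<and> a \<in> set l" if "(a, b) \<in> set (zip l (map \<sigma> l))" for a b
    using that by (auto simp: zip_map2 zip_same_conv_map)
  ultimately show ?thesis unfolding compatible_def list_all_iff by fastforce
qed


text \<open>If \<open>c\<close> does not occur, the list is returned unchanged; the filter in
  \<open>cycles_from\<close> then discards it.\<close>

definition cycle_from :: "nat \<Rightarrow> nat list \<Rightarrow> nat list" where
  "cycle_from c l = dropWhile ((\<noteq>) c) l @ takeWhile ((\<noteq>) c) l"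

definition cycles_from :: "nat \<Rightarrow> nat \<Rightarrow> nat list \<Rightarrow> nat list list" where
  "cycles_from c d l = filter (\<lambda>m. m ! 0 = c \<and> m ! 1 = d) [cycle_from c l, cycle_from c (rev l)]"

text \<open>Every face cycle, in either direction, that starts by traversing the edge from
  \<open>c\<close> to \<open>d\<close>; fixing the first edge leaves few lists to try.\<close>

definition candidates :: "nat \<Rightarrow> nat \<Rightarrow> nat list list" where
  "candidates c d = concat (map (cycles_from c d) face_lists)"

definition first_face :: "nat list" where
  "first_face = hd face_lists"

text \<open>The other seven faces, rotated so as to start with an edge of the first face; the positions of
  the end points of that edge in the cycle of the first face are recorded.\<close>

definition adjacent_cycles :: "(nat \<times> nat \<times> nat list) list" where
  "adjacent_cycles =
     [(1, 0, [2, 1, 6, 8, 18, 14, 22, 11, 10]),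
      (3, 2, [7, 5, 19, 15, 23, 10, 11, 3, 4]),
      (8, 7, [9, 12, 4, 3, 8, 6, 20, 16, 24]),
      (0, 8, [1, 9, 24, 23, 15, 14, 18, 20, 6]),
      (5, 4, [13, 17, 19, 5, 2, 10, 23, 24, 16]),
      (6, 5, [21, 13, 16, 20, 18, 8, 3, 11, 22]),
      (7, 6, [12, 21, 22, 14, 15, 19, 17, 7, 4])]"

definition extensions :: "nat list \<Rightarrow> nat \<times> nat \<times> nat list \<Rightarrow> nat list list" where
  "extensions L = (\<lambda>(p, q, l). filter (compatible first_face L l) (candidates (L ! p) (L ! q)))"

definition inextensible :: "nat list \<Rightarrow> bool" where
  "inextensible L \<longleftrightarrow> list_ex (\<lambda>x. extensions L x = []) adjacent_cycles"

definition first_image :: "nat list \<Rightarrow> bool" where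
  "first_image L \<longleftrightarrow> (if inextensible L then True else list_ex (\<lambda>s. L = act s first_face) auts)"

definition all_faces_cycles :: "nat list list" where
  "all_faces_cycles = concat (map all_cycles face_lists)"

text \<open>The search over images of the first face leaves the other faces open; this adds that
  each of them then has a single possible image, the one given by the listed permutation.\<close>

definition forced :: "nat list \<Rightarrow> bool" where
  "forced s \<longleftrightarrow> list_all (\<lambda>x. extensions (act s first_face) x = [act s (snd (snd x))]) adjacent_cycles"

definition has_candidate :: "nat list \<Rightarrow> bool" where
  "has_candidate L \<longleftrightarrow> L \<in> set (candidates (L ! 0) (L ! 1))"

text \<open>All faces are adjacent to the first one, so the image of its cycle determines the image of
  every other cycle; only eight of the 144 conceivable images of the first cycle extend.\<close>

lemma automorphism_search:
  "list_all has_candidate all_faces_cycles" "list_all first_image all_faces_cycles" "list_all forced auts"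
  by code_simp+

lemma all_cycles_set: "L \<in> set (all_cycles m) \<Longrightarrow> set L = set m"
  unfolding all_cycles_def by auto

lemma adjacent_cycles_facts:
  assumes "x \<in> set adjacent_cycles"
  obtains p q l m k where "x = (p, q, l)" "m \<in> set face_lists" "l = rotate k m" "length l = 9" "p < 9" "q < 9"
    "l ! 0 = first_face ! p" "l ! 1 = first_face ! q"
proof -
  have "list_all (\<lambda>(p, q, l). p < 9 \<and> q < 9 \<and> length l = 9 \<and> l ! 0 = first_face ! p \<and> l ! 1 = first_face ! q \<and>
      list_ex (\<lambda>m. l \<in> set (rotations m)) face_lists) adjacent_cycles"
    by code_simp
  then have "case x of (p, q, l) \<Rightarrow> p < 9 \<and> q < 9 \<and> length l = 9 \<and> l ! 0 = first_face ! p \<and> l ! 1 = first_face ! q \<and>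
      list_ex (\<lambda>m. l \<in> set (rotations m)) face_lists"
    using assms unfolding list_all_iff by blast
  then show thesis using that unfolding list_ex_iff rotations_def by (cases x) auto
qed

text \<open>The automorphism is transferred to a map \<open>\<sigma>\<close> of indices. Its values
  on the first face survive the search, hence agree with a listed permutation; the other faces
  follow one by one, and together the faces contain all 24 indices.\<close>

lemma automorphism_eq_aut_map:
  assumes "\<pi> \<in> automorphisms nonagon_faces"
  shows "\<exists>s\<in>set auts. \<pi> = aut_map s"
proof -
  define \<sigma> where "\<sigma> i = pt_index (\<pi> (pt i))" for i
  have perm: "\<pi> permutes pt ` {1..24}"
    using assms unfolding automorphisms_def vertices_nonagon_faces by simp
  have \<sigma>: "\<sigma> i \<in> {1..24}" "pt (\<sigma> i) = \<pi> (pt i)" if "i \<in> {1..24}" for i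
  proof -
    have "\<pi> (pt i) \<in> pt ` {1..24}" using that permutes_in_image[OF perm] by blast
    then show "\<sigma> i \<in> {1..24}" "pt (\<sigma> i) = \<pi> (pt i)"
      unfolding \<sigma>_def pt_index_def by (rule inv_into_into, rule f_inv_into_f)
  qed
  have inj: "inj_on \<sigma> {1..24}"
  proof (rule inj_onI)
    fix i j :: nat assume ij: "i \<in> {1..24}" "j \<in> {1..24}" "\<sigma> i = \<sigma> j"
    then have "\<pi> (pt i) = \<pi> (pt j)" by (metis \<sigma>(2))
    then have "pt i = pt j" using permutes_inj[OF perm] by (simp add: inj_eq)
    then show "i = j" using pt_eq_iff[OF ij(1,2)] by blast
  qed
  have map\<sigma>: "map \<pi> (map pt l) = map pt (map \<sigma> l)" "set (map \<sigma> l) \<subseteq> {1..24}" if "set l \<subseteq> {1..24}" for l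
    using that \<sigma> by (auto simp del: atLeastAtMost_iff)
  have cycles: "map \<sigma> (rotate k l) \<in> set all_faces_cycles" if l: "l \<in> set face_lists" for l k
  proof -
    have "unoriented_cycle (map \<pi> (map pt l)) \<in> (\<lambda>f. unoriented_cycle (map \<pi> f)) ` nonagon_faces"
      using l unfolding nonagon_faces_eq by blast
    also have "\<dots> = unoriented_cycle ` nonagon_faces" using assms unfolding automorphisms_def by simp
    finally obtain m where m: "m \<in> set face_lists"
      "unoriented_cycle (map \<pi> (map pt l)) = unoriented_cycle (map pt m)"
      unfolding nonagon_faces_eq by blast
    have "m \<noteq> []" using face_lists_facts(1)[OF m(1)] by auto
    have sub: "set (rotate k l) \<subseteq> {1..24}" using face_lists_facts(3)[OF l] by simp
    have "map pt (map \<sigma> (rotate k l)) = rotate k (map \<pi> (map pt l))"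
      using map\<sigma>(1)[OF sub] by (simp only: rotate_map)
    moreover have "rotate k f \<in> unoriented_cycle f" for f
      unfolding unoriented_cycle_def oriented_cycle_def by blast
    ultimately have "map pt (map \<sigma> (rotate k l)) \<in> unoriented_cycle (map pt m)"
      unfolding m(2)[symmetric] by (simp only:)
    then obtain L where L: "L \<in> set (all_cycles m)" "map pt (map \<sigma> (rotate k l)) = map pt L"
      unfolding unoriented_cycle_map_pt[OF \<open>m \<noteq> []\<close>] by blast
    then have "map \<sigma> (rotate k l) = L"
      using map_pt_eq_iff map\<sigma>(2)[OF sub] all_cycles_set[OF L(1)] face_lists_facts(3)[OF m(1)] by metis
    then show ?thesis using L(1) m(1) unfolding all_faces_cycles_def by auto
  qed
  have ff: "first_face \<in> set face_lists" "length first_face = 9" by code_simp+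
  let ?L = "map \<sigma> first_face"
  \<comment> \<open>The true image of an adjacent face is a face cycle starting with the image of
    the shared edge and is compatible with the image of the first face, so the search cannot miss
    it.\<close>
  have ext: "map \<sigma> (snd (snd x)) \<in> set (extensions ?L x)" if x_adj: "x \<in> set adjacent_cycles" for x
  proof -
    obtain p q l m k where x: "x = (p, q, l)" "m \<in> set face_lists" "l = rotate k m" "length l = 9" "p < 9" "q < 9"
      "l ! 0 = first_face ! p" "l ! 1 = first_face ! q"
      by (rule adjacent_cycles_facts[OF x_adj]) (rule that)
    have "has_candidate (map \<sigma> l)"
      using automorphism_search(1) cycles[OF x(2)] unfolding list_all_iff x(3) by blast
    moreover have "map \<sigma> l ! 0 = ?L ! p" "map \<sigma> l ! 1 = ?L ! q"
      using x(4-8) ff(2) by simp_all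
    ultimately have "map \<sigma> l \<in> set (candidates (?L ! p) (?L ! q))" unfolding has_candidate_def by simp
    moreover have "compatible first_face ?L l (map \<sigma> l)"
      using face_lists_facts(3)[OF ff(1)] face_lists_facts(3)[OF x(2)]
      by (intro compatible_map[OF inj]) (simp_all add: x(3))
    ultimately show ?thesis unfolding extensions_def x(1) by simp
  qed
  \<comment> \<open>Every adjacent face has at least its true image as an extension.\<close>
  have "\<not> inextensible ?L" unfolding inextensible_def list_ex_iff using ext by fastforce
  moreover have "first_image ?L"
    using automorphism_search(2) cycles[OF ff(1), of 0] unfolding list_all_iff by simp
  ultimately obtain s where s: "s \<in> set auts" "?L = act s first_face"
    unfolding first_image_def list_ex_iff by auto
  have "map \<sigma> (snd (snd x)) = act s (snd (snd x))" if "x \<in> set adjacent_cycles" for x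
  proof -
    have "extensions ?L x = [act s (snd (snd x))]"
      using automorphism_search(3) s that unfolding list_all_iff forced_def by simp
    then show ?thesis using ext[OF that] by simp
  qed
  then have eq: "\<sigma> i = s ! (i - 1)" if "i \<in> set (concat (first_face # map (snd \<circ> snd) adjacent_cycles))" for i
    using that s(2) unfolding act_def by auto
  have "list_all (\<lambda>i. i \<in> set (concat (first_face # map (snd \<circ> snd) adjacent_cycles))) [1..<25]" by code_simp
  then have cover: "i \<in> set (concat (first_face # map (snd \<circ> snd) adjacent_cycles))" if "i \<in> {1..24}" for i
    using that unfolding list_all_iff by simp
  have "\<pi> p = aut_map s p" for p
  proof (cases "p \<in> pt ` {1..24}")
    case True
    then obtain i where i: "i \<in> {1..24}" "p = pt i" by blast
    show ?thesis unfolding i(2) aut_map_pt[OF i(1)] using \<sigma>(2)[OF i(1)] eq[OF cover[OF i(1)]] by simp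
  next
    case False
    then show ?thesis using perm unfolding permutes_def aut_map_def by simp
  qed
  then show ?thesis using s(1) by blast
qed

lemma automorphisms_nonagon_faces: "automorphisms nonagon_faces = aut_map ` set auts"
  using automorphism_eq_aut_map aut_map_automorphism by blast

text \<open>The faces are already distinguished by their vertex sets, which a cycle
  determines.\<close>

lemma inj_on_unoriented_cycle: "inj_on unoriented_cycle nonagon_faces"
proof (rule inj_onI)
  fix f g assume fg: "f \<in> nonagon_faces" "g \<in> nonagon_faces" "unoriented_cycle f = unoriented_cycle g"
  then obtain l m where lm: "l \<in> set face_lists" "f = map pt l" "m \<in> set face_lists" "g = map pt m"
    unfolding nonagon_faces_eq by blast
  have "f \<in> unoriented_cycle g" using unoriented_cycle_self[of f] fg(3) by simp
  then have "set f = set g" unfolding unoriented_cycle_def oriented_cycle_def by auto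
  then have "set l = set m"
    unfolding lm set_map by (metis inj_on_image_eq_iff[OF inj_on_pt] face_lists_facts(3) lm(1,3))
  moreover have "list_all (\<lambda>l. list_all (\<lambda>m. l = m \<or> list_ex (\<lambda>i. i \<notin> set m) l) face_lists) face_lists"
    by code_simp
  ultimately have "l = m" using lm(1,3) unfolding list_all_iff list_ex_iff by blast
  then show "f = g" using lm by simp
qed

text \<open>Transitivity is evaluated. Uniqueness is then a count: eight permutations are mapped
  onto eight face cycles, so the map is injective.\<close>

lemma simply_transitive:
  assumes "f \<in> nonagon_faces" "g \<in> nonagon_faces"
  shows "\<exists>!\<pi>. \<pi> \<in> automorphisms nonagon_faces \<and> unoriented_cycle (map \<pi> f) = unoriented_cycle g"
proof -
  obtain l where l: "l \<in> set face_lists" "f = map pt l"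
    using assms unfolding nonagon_faces_eq by auto
  let ?h = "\<lambda>s. unoriented_cycle (map (aut_map s) f)"
  have h: "?h s = unoriented_cycle (map pt m)" if "s \<in> set auts" "act s l \<in> set (rotations m)" "m \<in> set face_lists" for s m
    unfolding l(2) using aut_map_face[OF that(1) l(1) that(2,3)] by (rule unoriented_cycle_oriented)
  have "list_all (\<lambda>l. list_all (\<lambda>m. list_ex (\<lambda>s. act s l \<in> set (rotations m)) auts) face_lists) face_lists"
    by code_simp
  then have ex: "\<exists>s\<in>set auts. act s l \<in> set (rotations m)" if "m \<in> set face_lists" for m
    using l(1) that unfolding list_all_iff list_ex_iff by blast
  have image: "?h ` set auts = unoriented_cycle ` nonagon_faces"
  proof (intro subset_antisym image_subsetI)
    show "?h s \<in> unoriented_cycle ` nonagon_faces" if "s \<in> set auts" for s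
      using act_faces(1)[OF that l(1)] h[OF that] unfolding nonagon_faces_eq by blast
    show "unoriented_cycle f' \<in> ?h ` set auts" if f': "f' \<in> nonagon_faces" for f'
    proof -
      obtain m where m: "m \<in> set face_lists" "f' = map pt m" using f' unfolding nonagon_faces_eq by blast
      obtain s where s: "s \<in> set auts" "act s l \<in> set (rotations m)" using ex[OF m(1)] by blast
      show ?thesis unfolding m(2) h[OF s m(1), symmetric] using s(1) by (rule imageI)
    qed
  qed
  have "card (?h ` set auts) = 8"
    unfolding image card_image[OF inj_on_unoriented_cycle] by (rule card_nonagon_faces)
  moreover have "card (set auts) = 8"
  proof -
    have "distinct auts \<and> length auts = 8" by code_simp
    then show ?thesis by (simp add: distinct_card)
  qed
  ultimately have inj: "inj_on ?h (set auts)" by (intro eq_card_imp_inj_on) simp_all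
  have "unoriented_cycle g \<in> ?h ` set auts" unfolding image using assms(2) by (rule imageI)
  then obtain s where s: "unoriented_cycle g = ?h s" "s \<in> set auts" by (rule imageE)
  show ?thesis unfolding automorphisms_nonagon_faces
  proof (rule ex1I[of _ "aut_map s"])
    show "aut_map s \<in> aut_map ` set auts \<and> ?h s = unoriented_cycle g" using s by simp
    fix \<pi> assume \<pi>: "\<pi> \<in> aut_map ` set auts \<and> unoriented_cycle (map \<pi> f) = unoriented_cycle g"
    then have "\<pi> \<in> aut_map ` set auts" by (rule conjunct1)
    then obtain t where t: "\<pi> = aut_map t" "t \<in> set auts" by (rule imageE)
    have "?h t = ?h s" using conjunct2[OF \<pi>] unfolding t(1) s(1) .
    then show "\<pi> = aut_map s" using inj_onD[OF inj _ t(2) s(2)] t(1) by simp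
  qed
qed

lemma outward_oriented_rotate:
  assumes "outward_oriented F f" "distinct f"
  shows "outward_oriented F (rotate k f)"
  using assms unfolding outward_oriented_def
  by (simp add: rotate_invariants right_hand_normal_eq_sum directed_edges_rotate)

lemma outward_oriented_nonagon_faces: "f \<in> nonagon_faces \<Longrightarrow> outward_oriented nonagon_faces f"
proof -
  assume "f \<in> nonagon_faces"
  then have "f = face_A1 \<or> f = face_A2 \<or> f = face_A3 \<or> f = face_A4 \<or> f = face_B1 \<or> f = face_B2 \<or> f = face_B3 \<or> f = face_B4"
    unfolding nonagon_faces_def by blast
  then show ?thesis by (elim disjE) (simp_all only: outward_oriented_faces)
qed

lemma distinct_faces: "f \<in> nonagon_faces \<Longrightarrow> distinct f"
  using simple_polygon_faces unfolding simple_polygon_def by blast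

text \<open>Rotations keep the normal of a face and stay outward; reversals negate it while keeping
  the interior.\<close>

lemma outward_cycles_nonagon_faces:
  "outward_cycles nonagon_faces = (\<Union>f\<in>nonagon_faces. oriented_cycle f)"
proof (intro equalityI subsetI)
  fix g assume "g \<in> outward_cycles nonagon_faces"
  then obtain f where f: "f \<in> nonagon_faces" "g \<in> unoriented_cycle f" "outward_oriented nonagon_faces g"
    unfolding outward_cycles_def by blast
  have "g \<notin> oriented_cycle (rev f)"
  proof
    assume "g \<in> oriented_cycle (rev f)"
    then obtain k where g: "g = rotate k (rev f)" unfolding oriented_cycle_def by blast
    have "distinct f" using f(1) by (rule distinct_faces)
    then have "right_hand_normal g = - right_hand_normal f"
      using right_hand_normal_rev[of f] by (simp add: g right_hand_normal_eq_sum directed_edges_rotate)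
    moreover have "polygon_interior g = polygon_interior f"
      unfolding g rotate_invariants polygon_interior_rev ..
    ultimately show False using not_outward_oriented_faces f(1,3) by blast
  qed
  then show "g \<in> (\<Union>f\<in>nonagon_faces. oriented_cycle f)" using f unfolding unoriented_cycle_def by blast
next
  fix g assume "g \<in> (\<Union>f\<in>nonagon_faces. oriented_cycle f)"
  then obtain f k where f: "f \<in> nonagon_faces" "g = rotate k f" unfolding oriented_cycle_def by blast
  then show "g \<in> outward_cycles nonagon_faces"
    unfolding outward_cycles_def unoriented_cycle_def oriented_cycle_def
    using outward_oriented_rotate[OF outward_oriented_nonagon_faces distinct_faces] by blast
qed

lemma orientation_preserving_automorphisms:
  assumes "\<pi> \<in> automorphisms nonagon_faces"
  shows "orientation_preserving nonagon_faces \<pi>"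
  unfolding orientation_preserving_def outward_cycles_nonagon_faces
proof
  obtain s where s: "s \<in> set auts" "\<pi> = aut_map s" using automorphism_eq_aut_map[OF assms] by blast
  fix g assume "g \<in> (\<Union>f\<in>nonagon_faces. oriented_cycle f)"
  then obtain l k where l: "l \<in> set face_lists" "g = rotate k (map pt l)"
    unfolding nonagon_faces_eq oriented_cycle_def by blast
  obtain m where m: "m \<in> set face_lists" "act s l \<in> set (rotations m)" using act_faces(1)[OF s(1) l(1)] by blast
  obtain j where "map (aut_map s) (map pt l) = rotate j (map pt m)"
    using aut_map_face[OF s(1) l(1) m(2,1)] unfolding oriented_cycle_def by blast
  then have "map \<pi> g = rotate (k + j) (map pt m)"
    unfolding s(2) l(2) by (simp only: rotate_map[symmetric] rotate_rotate)
  then show "map \<pi> g \<in> (\<Union>f\<in>nonagon_faces. oriented_cycle f)"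
    using m(1) unfolding nonagon_faces_eq oriented_cycle_def by blast
qed

text \<open>Positions 0, 2, 4 and 6 of \<open>auts\<close> act as the identity and as
  \<open>half_turn_x\<close>, \<open>half_turn_z\<close> and \<open>half_turn_y\<close>. The four
  odd positions exchange the \<open>A\<close> faces with the \<open>B\<close> faces; for example
  position 1 carries the cycle of \<open>A\<close> 1 to that of \<open>B\<close> 1.\<close>

definition dihedral_aut :: "int \<times> bool \<Rightarrow> nat list" where
  "dihedral_aut = (\<lambda>(a, s). auts ! (nat a + (if s then 4 else 0)))"

definition dihedral_elements :: "(int \<times> bool) list" where
  "dihedral_elements = [(0, False), (1, False), (2, False), (3, False), (0, True), (1, True), (2, True), (3, True)]"

text \<open>A computable copy of the group operation for \<open>n = 4\<close>, used to evaluate the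
  multiplication table.\<close>

definition dihedral_mult :: "int \<times> bool \<Rightarrow> int \<times> bool \<Rightarrow> int \<times> bool" where
  "dihedral_mult = (\<lambda>(a, s) (b, t). ((a + (if s then - b else b)) mod 4, s \<noteq> t))"

lemma automorphism_group_iso: "automorphism_group nonagon_faces \<cong> dihedral_group 4"
proof -
  let ?h = "\<lambda>x. aut_map (dihedral_aut x)" and ?D = "set dihedral_elements"
  have carrier: "carrier (dihedral_group 4) = ?D"
  proof -
    have "{0..<4} = {0, 1, 2, 3 :: int}" by auto
    then show ?thesis unfolding dihedral_group_def dihedral_elements_def by (auto simp: UNIV_bool)
  qed
  have mult: "x \<otimes>\<^bsub>dihedral_group 4\<^esub> y = dihedral_mult x y" for x y
    by (simp add: dihedral_group_def dihedral_mult_def split_beta)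
  have "map dihedral_aut dihedral_elements = auts" by code_simp
  then have image: "dihedral_aut ` ?D = set auts" by (metis set_map)
  have inj_auts: "inj_on aut_map (set auts)"
  proof (rule inj_onI)
    fix s t assume st: "s \<in> set auts" "t \<in> set auts" "aut_map s = aut_map t"
    show "s = t"
    proof (rule nth_equalityI)
      show "length s = length t" using auts_facts(3) st(1,2) by simp
      fix i assume i: "i < length s"
      then have Si: "Suc i \<in> {1..24}" using auts_facts(3)[OF st(1)] by simp
      have "s ! i \<in> {1..24}" "t ! i \<in> {1..24}"
        using i auts_facts(2,3)[OF st(1)] auts_facts(2,3)[OF st(2)] nth_mem by metis+
      moreover have "pt (s ! i) = pt (t ! i)"
        using aut_map_pt[OF Si, of s] aut_map_pt[OF Si, of t] st(3) by simp
      ultimately show "s ! i = t ! i" using pt_eq_iff by blast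
    qed
  qed
  have "distinct (map dihedral_aut dihedral_elements)" by code_simp
  then have "inj_on dihedral_aut ?D" by (simp only: distinct_map)
  then have inj: "inj_on ?h ?D"
    using comp_inj_on[of dihedral_aut ?D aut_map] inj_auts image by (simp add: o_def)
  have bij: "bij_betw ?h ?D (automorphisms nonagon_faces)"
    unfolding bij_betw_def automorphisms_nonagon_faces image[symmetric] using inj by (simp add: image_image)
  have comp: "dihedral_mult x y \<in> ?D \<and> ?h (dihedral_mult x y) = ?h x \<circ> ?h y" if "x \<in> ?D" "y \<in> ?D" for x y
  proof -
    have "list_all (\<lambda>x. list_all (\<lambda>y. dihedral_mult x y \<in> set dihedral_elements \<and>
        dihedral_aut (dihedral_mult x y) = act (dihedral_aut x) (dihedral_aut y)) dihedral_elements) dihedral_elements"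
      by code_simp
    then have xy: "dihedral_mult x y \<in> ?D"
      "dihedral_aut (dihedral_mult x y) = act (dihedral_aut x) (dihedral_aut y)"
      using that unfolding list_all_iff by blast+
    have s: "dihedral_aut x \<in> set auts" "dihedral_aut y \<in> set auts" using that image by blast+
    have "?h (dihedral_mult x y) p = ?h x (?h y p)" for p
    proof (cases "p \<in> pt ` {1..24}")
      case True
      then obtain i where i: "i \<in> {1..24}" "p = pt i" by blast
      then have l: "i - 1 < length (dihedral_aut y)"
        unfolding auts_facts(3)[OF s(2)] atLeastAtMost_iff by arith
      then have "dihedral_aut y ! (i - 1) \<in> {1..24}" using nth_mem auts_facts(2)[OF s(2)] by blast
      then show ?thesis unfolding i(2) xy(2) using l by (simp only: aut_map_pt[OF i(1)] aut_map_pt act_def nth_map)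
    qed (simp add: aut_map_def)
    then show ?thesis using xy(1) by auto
  qed
  \<comment> \<open>The isomorphism is required in the direction towards the dihedral group, so the
    inverse of the parametrisation is used.\<close>
  let ?g = "inv_into ?D ?h"
  have "?g \<in> hom (automorphism_group nonagon_faces) (dihedral_group 4)"
  proof (rule homI)
    show "?g \<pi> \<in> carrier (dihedral_group 4)" if "\<pi> \<in> carrier (automorphism_group nonagon_faces)" for \<pi>
      using that bij_betw_imp_surj_on[OF bij] unfolding carrier automorphism_group_def
      by (simp add: inv_into_into)
    fix \<pi> \<rho> assume "\<pi> \<in> carrier (automorphism_group nonagon_faces)" "\<rho> \<in> carrier (automorphism_group nonagon_faces)"
    then have "\<pi> \<in> ?h ` ?D" "\<rho> \<in> ?h ` ?D"
      unfolding bij_betw_imp_surj_on[OF bij] automorphism_group_def by simp_all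
    then obtain x y where xy: "x \<in> ?D" "\<pi> = ?h x" "y \<in> ?D" "\<rho> = ?h y" by blast
    have "\<pi> \<otimes>\<^bsub>automorphism_group nonagon_faces\<^esub> \<rho> = ?h (dihedral_mult x y)"
      using comp[OF xy(1,3)] unfolding xy(2,4) automorphism_group_def by simp
    then show "?g (\<pi> \<otimes>\<^bsub>automorphism_group nonagon_faces\<^esub> \<rho>) = ?g \<pi> \<otimes>\<^bsub>dihedral_group 4\<^esub> ?g \<rho>"
    proof -
      have "?g (?h (dihedral_mult x y)) = dihedral_mult x y"
        by (rule inv_into_f_f[OF inj]) (use comp[OF xy(1,3)] in blast)
      moreover have "?g \<pi> = x" "?g \<rho> = y"
        unfolding xy(2,4) by (rule inv_into_f_f[OF inj xy(1)], rule inv_into_f_f[OF inj xy(3)])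
      ultimately show ?thesis
        unfolding \<open>\<pi> \<otimes>\<^bsub>automorphism_group nonagon_faces\<^esub> \<rho> = ?h (dihedral_mult x y)\<close> mult by (simp only:)
    qed
  qed
  moreover have "bij_betw ?g (carrier (automorphism_group nonagon_faces)) (carrier (dihedral_group 4))"
    unfolding carrier automorphism_group_def using bij_betw_inv_into[OF bij] by simp
  ultimately show ?thesis unfolding is_iso_def iso_def by blast
qed

subsection \<open>Convex hull and symmetries\<close>

text \<open>Each form vanishes on the face opposite to one vertex; divided by its value at that
  vertex it is a barycentric coordinate. The constants \<open>k\<close>, \<open>k'\<close>,
  \<open>k''\<close> and \<open>l\<close> are these values.\<close>

lemma tetrahedron_iff:
  assumes det: "det3 a b c a' b' c' a'' b'' c'' \<noteq> 0"
    and sum: "\<And>x. lin a b c d x / k + lin a' b' c' d' x / k' + lin a'' b'' c'' d'' x / k'' + lin e f g h x / l = 1"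
    and pos: "k > 0" "k' > 0" "k'' > 0" "l > 0"
    and p: "lin a b c d p = k" "lin a' b' c' d' p = 0" "lin a'' b'' c'' d'' p = 0" "lin e f g h p = 0"
    and p': "lin a b c d p' = 0" "lin a' b' c' d' p' = k'" "lin a'' b'' c'' d'' p' = 0" "lin e f g h p' = 0"
    and p'': "lin a b c d p'' = 0" "lin a' b' c' d' p'' = 0" "lin a'' b'' c'' d'' p'' = k''" "lin e f g h p'' = 0"
    and q: "lin a b c d q = 0" "lin a' b' c' d' q = 0" "lin a'' b'' c'' d'' q = 0" "lin e f g h q = l"
  shows "convex hull {p, p', p'', q} = {x. lin a b c d x \<ge> 0 \<and> lin a' b' c' d' x \<ge> 0 \<and> lin a'' b'' c'' d'' x \<ge> 0 \<and> lin e f g h x \<ge> 0}"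
    (is "_ = ?S")
proof
  have "convex ?S" by (intro convex_Collect_conj convex_lin)
  moreover have "{p, p', p'', q} \<subseteq> ?S" using pos p p' p'' q by auto
  ultimately show "convex hull {p, p', p'', q} \<subseteq> ?S" by (intro hull_minimal)
next
  have combination: "lin \<alpha> \<beta> \<gamma> \<delta> (u *\<^sub>R p + u' *\<^sub>R p' + u'' *\<^sub>R p'' + w *\<^sub>R q) =
      u * lin \<alpha> \<beta> \<gamma> \<delta> p + u' * lin \<alpha> \<beta> \<gamma> \<delta> p' + u'' * lin \<alpha> \<beta> \<gamma> \<delta> p'' + w * lin \<alpha> \<beta> \<gamma> \<delta> q"
    if "u + u' + u'' + w = 1" for \<alpha> \<beta> \<gamma> \<delta> u u' u'' w
  proof -
    have w: "w = 1 - u - u' - u''" using that by simp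
    show ?thesis unfolding w lin_def by (simp add: algebra_simps)
  qed
  show "?S \<subseteq> convex hull {p, p', p'', q}"
  proof
    fix x assume x: "x \<in> ?S"
    let ?u = "lin a b c d x / k" and ?u' = "lin a' b' c' d' x / k'" and ?u'' = "lin a'' b'' c'' d'' x / k''" and ?w = "lin e f g h x / l"
    let ?y = "?u *\<^sub>R p + ?u' *\<^sub>R p' + ?u'' *\<^sub>R p'' + ?w *\<^sub>R q"
    note c = combination[OF sum[of x]]
    have "x = ?y"
    proof (rule lin_eq_imp_eq[OF det])
      show "lin a b c d x = lin a b c d ?y" unfolding c p p' p'' q using pos by simp
      show "lin a' b' c' d' x = lin a' b' c' d' ?y" unfolding c p p' p'' q using pos by simp
      show "lin a'' b'' c'' d'' x = lin a'' b'' c'' d'' ?y" unfolding c p p' p'' q using pos by simp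
    qed
    moreover have "?y \<in> convex hull {p, p', p'', q}"
    proof -
      have pts: "p \<in> convex hull {p, p', p'', q}" "p' \<in> convex hull {p, p', p'', q}"
        "p'' \<in> convex hull {p, p', p'', q}" "q \<in> convex hull {p, p', p'', q}" by (simp_all add: hull_inc)
      \<comment> \<open>The four weights and the four points are indexed by 0 to 3, as
        \<open>convex_sum\<close> expects a family.\<close>
      let ?f = "\<lambda>i::nat. if i = 0 then ?u else if i = 1 then ?u' else if i = 2 then ?u'' else ?w"
      let ?g = "\<lambda>i::nat. if i = 0 then p else if i = 1 then p' else if i = 2 then p'' else q"
      have "(\<Sum>i\<in>{0, 1, 2, 3}. ?f i *\<^sub>R ?g i) \<in> convex hull {p, p', p'', q}"
        by (rule convex_sum) (use sum[of x] x pos pts in \<open>auto simp: add.assoc\<close>)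
      then show ?thesis by (simp add: add.assoc)
    qed
    ultimately show "x \<in> convex hull {p, p', p'', q}" by simp
  qed
qed

text \<open>The centroid of the four corners is the origin, so with constant term 1 each form takes
  the value 4 at the opposite corner: its barycentric coordinate at the origin is 1/4.\<close>

lemma corners_hull:
  "convex hull {pt 1, pt 2, pt 3, pt 4} =
    {x. lin (- 7/38) (- 14/57) (- 2/5) 1 x \<ge> 0 \<and> lin (7/38) (14/57) (- 2/5) 1 x \<ge> 0 \<and>
        lin (- 7/38) (14/57) (2/5) 1 x \<ge> 0 \<and> lin (7/38) (- 14/57) (2/5) 1 x \<ge> 0}"
  by (rule tetrahedron_iff[of _ _ _ _ _ _ _ _ _ _ 4 _ 4 _ 4 _ _ _ _ 4])
    (simp_all add: lin_def pt_simps det3_def field_simps)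

lemma surface_subset_corners_hull: "surface nonagon_faces \<subseteq> convex hull {pt 1, pt 2, pt 3, pt 4}"
proof
  fix x assume "x \<in> surface nonagon_faces"
  then have "\<not> off_solid x" by (simp add: surface_iff)
  then have "lin (- 7/38) (- 14/57) (- 2/5) 1 x \<ge> 0 \<and> lin (7/38) (14/57) (- 2/5) 1 x \<ge> 0 \<and>
        lin (- 7/38) (14/57) (2/5) 1 x \<ge> 0 \<and> lin (7/38) (- 14/57) (2/5) 1 x \<ge> 0"
    unfolding off_solid_def lin_def by argo
  then show "x \<in> convex hull {pt 1, pt 2, pt 3, pt 4}" unfolding corners_hull by simp
qed

lemma convex_hull_surface: "convex hull (surface nonagon_faces) = convex hull {pt 1, pt 2, pt 3, pt 4}"
proof (rule subset_antisym)
  show "convex hull (surface nonagon_faces) \<subseteq> convex hull {pt 1, pt 2, pt 3, pt 4}"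
    using surface_subset_corners_hull by (simp add: hull_minimal)
  have "pt i \<in> surface nonagon_faces" if "i \<in> {1..24}" for i
  proof -
    have "pt i \<in> vertices nonagon_faces" using that unfolding vertices_nonagon_faces by blast
    then show ?thesis unfolding vertices_def surface_def using vertex_in_region by blast
  qed
  then have "{pt 1, pt 2, pt 3, pt 4} \<subseteq> surface nonagon_faces" by simp
  then show "convex hull {pt 1, pt 2, pt 3, pt 4} \<subseteq> convex hull (surface nonagon_faces)" by (rule hull_mono)
qed

lemma affine_hull_lin: "(\<And>p. p \<in> S \<Longrightarrow> lin a b c d p = 0) \<Longrightarrow> x \<in> affine hull S \<Longrightarrow> lin a b c d x = 0"
proof -
  assume *: "\<And>p. p \<in> S \<Longrightarrow> lin a b c d p = 0" and x: "x \<in> affine hull S"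
  have "affine {p. lin a b c d p = 0}" unfolding lin_0_hyperplane by (rule affine_hyperplane)
  then have "affine hull S \<subseteq> {p. lin a b c d p = 0}" using * by (intro hull_minimal) auto
  then show ?thesis using x by blast
qed

text \<open>Each facet form of the tetrahedron vanishes at three corners, hence on their affine
  hull, but not at the fourth.\<close>

lemma corners_affine_independent: "\<not> affine_dependent {pt 1, pt 2, pt 3, pt 4}"
proof
  assume "affine_dependent {pt 1, pt 2, pt 3, pt 4}"
  then obtain p where p: "p \<in> {pt 1, pt 2, pt 3, pt 4}" "p \<in> affine hull ({pt 1, pt 2, pt 3, pt 4} - {p})"
    unfolding affine_dependent_def by blast
  consider "p = pt 1" | "p = pt 2" | "p = pt 3" | "p = pt 4" using p(1) by blast
  then show False
  proof cases
    case 1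
    have "lin (- 7/38) (- 14/57) (- 2/5) 1 p = 0"
      by (rule affine_hull_lin[OF _ p(2)]) (auto simp: 1 lin_def pt_simps)
    then show False by (simp add: 1 lin_def pt_simps)
  next
    case 2
    have "lin (7/38) (14/57) (- 2/5) 1 p = 0"
      by (rule affine_hull_lin[OF _ p(2)]) (auto simp: 2 lin_def pt_simps)
    then show False by (simp add: 2 lin_def pt_simps)
  next
    case 3
    have "lin (- 7/38) (14/57) (2/5) 1 p = 0"
      by (rule affine_hull_lin[OF _ p(2)]) (auto simp: 3 lin_def pt_simps)
    then show False by (simp add: 3 lin_def pt_simps)
  next
    case 4
    have "lin (7/38) (- 14/57) (2/5) 1 p = 0"
      by (rule affine_hull_lin[OF _ p(2)]) (auto simp: 4 lin_def pt_simps)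
    then show False by (simp add: 4 lin_def pt_simps)
  qed
qed

text \<open>An isometry is a translation after a linear isometry, so it commutes with convex hulls
  and carries open segments to open segments.\<close>

lemma isometry_extreme_points:
  assumes "isometry \<phi>" and S: "\<phi> ` S = S" and x: "x extreme_point_of (convex hull S)"
  shows "\<phi> x extreme_point_of (convex hull (S :: (real^3) set))"
proof -
  define T where "T x = \<phi> x - \<phi> 0" for x
  have "orthogonal_transformation T"
    using assms(1) by (simp add: orthogonal_transformation_isometry T_def isometry_def dist_norm)
  then have T: "linear T" "inj T"
    by (auto intro: orthogonal_transformation_linear orthogonal_transformation_inj)
  have \<phi>: "\<phi> = (\<lambda>x. \<phi> 0 + x) \<circ> T" by (auto simp: T_def)
  have hull: "\<phi> ` (convex hull S) = convex hull S"
  proof -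
    have "\<phi> ` (convex hull S) = (\<lambda>x. \<phi> 0 + x) ` T ` (convex hull S)" by (subst \<phi>) (rule image_comp[symmetric])
    also have "\<dots> = convex hull ((\<lambda>x. \<phi> 0 + x) ` T ` S)"
      by (simp only: convex_hull_linear_image[OF T(1)] convex_hull_translation)
    also have "(\<lambda>x. \<phi> 0 + x) ` T ` S = \<phi> ` S" by (subst (2) \<phi>) (rule image_comp)
    finally show ?thesis unfolding S .
  qed
  have seg: "\<phi> ` open_segment a b = open_segment (\<phi> a) (\<phi> b)" for a b
  proof -
    have "\<phi> ` open_segment a b = (\<lambda>x. \<phi> 0 + x) ` T ` open_segment a b" by (subst \<phi>) (rule image_comp[symmetric])
    also have "\<dots> = open_segment (\<phi> 0 + T a) (\<phi> 0 + T b)"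
      by (simp only: open_segment_linear_image[OF T] open_segment_translation)
    finally show ?thesis by (simp add: T_def)
  qed
  have inj: "inj \<phi>" using T(2) by (auto simp: inj_def T_def)
  show ?thesis unfolding extreme_point_of_def
  proof (intro conjI ballI)
    have "x \<in> convex hull S" using x unfolding extreme_point_of_def by blast
    then have "\<phi> x \<in> \<phi> ` (convex hull S)" by (rule imageI)
    then show "\<phi> x \<in> convex hull S" unfolding hull .
    fix a b assume "a \<in> convex hull S" "b \<in> convex hull S"
    then have "a \<in> \<phi> ` (convex hull S)" "b \<in> \<phi> ` (convex hull S)" unfolding hull .
    then obtain a' b' where ab: "a' \<in> convex hull S" "a = \<phi> a'" "b' \<in> convex hull S" "b = \<phi> b'" by blast
    then have "x \<notin> open_segment a' b'" using x unfolding extreme_point_of_def by blast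
    then show "\<phi> x \<notin> open_segment a b"
      unfolding ab seg[symmetric] using inj by (simp add: inj_image_mem_iff)
  qed
qed

lemma dist_corners:
  "dist (pt 1) (pt 2) ^ 2 = 9025/49" "dist (pt 1) (pt 3) ^ 2 = 4474/49" "dist (pt 1) (pt 4) ^ 2 = 7001/49"
  by (simp_all add: dist_norm power2_norm_eq_inner inner_vec_def sum_3 pt_simps)

text \<open>The other corners have different distances from \<open>pt 1\<close> and are thus fixed
  as well; a point is then determined by its distances from four affinely independent fixed
  points.\<close>

lemma isometry_fixing_corners:
  assumes "isometry \<psi>" and V: "\<psi> ` {pt 1, pt 2, pt 3, pt 4} \<subseteq> {pt 1, pt 2, pt 3, pt 4}" and 1: "\<psi> (pt 1) = pt 1"
  shows "\<psi> = id"
proof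
  have d: "dist (\<psi> x) (\<psi> y) = dist x y" for x y using assms(1) unfolding isometry_def by blast
  have ne: "dist (pt 1) (pt 2) ^ 2 \<noteq> dist (pt 1) (pt 3) ^ 2" "dist (pt 1) (pt 2) ^ 2 \<noteq> dist (pt 1) (pt 4) ^ 2"
    "dist (pt 1) (pt 3) ^ 2 \<noteq> dist (pt 1) (pt 4) ^ 2" "dist (pt 1) (pt 2) ^ 2 \<noteq> 0"
    "dist (pt 1) (pt 3) ^ 2 \<noteq> 0" "dist (pt 1) (pt 4) ^ 2 \<noteq> 0"
    unfolding dist_corners by simp_all
  have e: "dist (pt 1) (\<psi> y) = dist (pt 1) y" for y using d[of "pt 1" y] unfolding 1 .
  have "\<psi> (pt 2) \<in> {pt 1, pt 2, pt 3, pt 4}" "\<psi> (pt 3) \<in> {pt 1, pt 2, pt 3, pt 4}"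
    "\<psi> (pt 4) \<in> {pt 1, pt 2, pt 3, pt 4}" using V by blast+
  then have fixed: "\<psi> (pt 2) = pt 2" "\<psi> (pt 3) = pt 3" "\<psi> (pt 4) = pt 4"
    using e[of "pt 2"] e[of "pt 3"] e[of "pt 4"] ne
    by (metis insert_iff empty_iff dist_self power_zero_numeral)+
  fix x
  have n: "(\<psi> x - p) \<bullet> (\<psi> x - p) = (x - p) \<bullet> (x - p)" if "\<psi> p = p" for p
    using d[of x p] unfolding that dist_norm by (metis power2_norm_eq_inner)
  have "\<psi> x = x"
    \<comment> \<open>Expanding the inner products makes the squares of the coordinates comparable;
      differences of the four equations are linear in the coordinates of the two points.\<close>
    using n[OF 1] n[OF fixed(1)] n[OF fixed(2)] n[OF fixed(3)]
    unfolding vec3_eq_iff by (simp add: inner_vec_def sum_3 pt_simps algebra_simps)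
  then show "\<psi> x = id x" by simp
qed

lemma isometry_half_turn:
  "isometry half_turn_x" "isometry half_turn_y" "isometry half_turn_z"
  using orthogonal_transformation_half_turn unfolding orthogonal_transformation_isometry isometry_def by blast+

lemma surface_isometry:
  assumes "isometry \<phi>" "\<phi> ` surface nonagon_faces = surface nonagon_faces"
  shows "\<phi> \<in> {id, half_turn_x, half_turn_y, half_turn_z}"
proof -
  let ?V = "{pt 1, pt 2, pt 3, pt 4}"
  have V: "\<phi> p \<in> ?V" if "p \<in> ?V" for p
  proof -
    have "p extreme_point_of (convex hull surface nonagon_faces)"
      unfolding convex_hull_surface extreme_point_of_convex_hull_affine_independent[OF corners_affine_independent]
      using that .
    from isometry_extreme_points[OF assms this] show ?thesis
      unfolding convex_hull_surface extreme_point_of_convex_hull_affine_independent[OF corners_affine_independent] .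
  qed
  \<comment> \<open>A half-turn moving the image of \<open>pt 1\<close> back to \<open>pt 1\<close>
    reduces the isometry to one fixing that corner; being an involution, the half-turn is then the
    isometry itself.\<close>
  have fix1: "\<phi> = R" if R: "isometry R" "\<And>x. R (R x) = x" "R ` ?V \<subseteq> ?V" "R (\<phi> (pt 1)) = pt 1" for R
  proof -
    have "R \<circ> \<phi> = id"
    proof (rule isometry_fixing_corners)
      show "isometry (R \<circ> \<phi>)" using R(1) assms(1) unfolding isometry_def by simp
      have "\<phi> ` ?V \<subseteq> ?V" using V by (rule image_subsetI)
      then show "(R \<circ> \<phi>) ` ?V \<subseteq> ?V"
        unfolding image_comp[symmetric] by (rule order_trans[OF image_mono R(3)])
    qed (use R(4) in simp)
    then have "R (\<phi> x) = x" for x by (metis comp_apply id_apply)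
    then show "\<phi> = R" using R(2) by (metis ext)
  qed
  consider "\<phi> (pt 1) = pt 1" | "\<phi> (pt 1) = pt 2" | "\<phi> (pt 1) = pt 3" | "\<phi> (pt 1) = pt 4"
    using V[of "pt 1"] by blast
  then show ?thesis
  proof cases
    case 1
    then show ?thesis using isometry_fixing_corners[OF assms(1)] V by blast
  next
    case 2
    then have "\<phi> = half_turn_z"
      by (intro fix1 isometry_half_turn half_turn_z.involution) (simp_all add: half_turn_pt)
    then show ?thesis by simp
  next
    case 3
    then have "\<phi> = half_turn_x"
      by (intro fix1 isometry_half_turn half_turn_x.involution) (simp_all add: half_turn_pt)
    then show ?thesis by simp
  next
    case 4
    then have "\<phi> = half_turn_y"
      by (intro fix1 isometry_half_turn half_turn_y.involution) (simp_all add: half_turn_pt)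
    then show ?thesis by simp
  qed
qed

lemma half_turn_comp:
  "half_turn_x (half_turn_y p) = half_turn_z p" "half_turn_y (half_turn_x p) = half_turn_z p"
  "half_turn_x (half_turn_z p) = half_turn_y p" "half_turn_z (half_turn_x p) = half_turn_y p"
  "half_turn_y (half_turn_z p) = half_turn_x p" "half_turn_z (half_turn_y p) = half_turn_x p"
  by (simp_all add: half_turn_x_def half_turn_y_def half_turn_z_def vec3_eq_iff)

lemma half_turn_faces:
  "half_turn_x ` region face_A1 = region face_A3" "half_turn_x ` region face_A2 = region face_A4" "half_turn_x ` region face_A3 = region face_A1" "half_turn_x ` region face_A4 = region face_A2" "half_turn_x ` region face_B1 = region face_B3" "half_turn_x ` region face_B2 = region face_B4" "half_turn_x ` region face_B3 = region face_B1" "half_turn_x ` region face_B4 = region face_B2"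
  "half_turn_y ` region face_A1 = region face_A4" "half_turn_y ` region face_A2 = region face_A3" "half_turn_y ` region face_A3 = region face_A2" "half_turn_y ` region face_A4 = region face_A1" "half_turn_y ` region face_B1 = region face_B4" "half_turn_y ` region face_B2 = region face_B3" "half_turn_y ` region face_B3 = region face_B2" "half_turn_y ` region face_B4 = region face_B1"
  "half_turn_z ` region face_A1 = region face_A2" "half_turn_z ` region face_A2 = region face_A1" "half_turn_z ` region face_A3 = region face_A4" "half_turn_z ` region face_A4 = region face_A3" "half_turn_z ` region face_B1 = region face_B2" "half_turn_z ` region face_B2 = region face_B1" "half_turn_z ` region face_B3 = region face_B4" "half_turn_z ` region face_B4 = region face_B3"
  unfolding half_turn_x.image_eq_vimage half_turn_y.image_eq_vimage half_turn_z.image_eq_vimage region_faces mem_Collect_eq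
  by (simp_all add: lin_half_turn half_turn_comp half_turn_x.involution half_turn_y.involution half_turn_z.involution)

lemma half_turn_symmetry:
  assumes "R \<in> {half_turn_x, half_turn_y, half_turn_z}"
  shows "R \<in> symmetries nonagon_faces"
proof -
  have reg: "(\<lambda>f. R ` region f) ` nonagon_faces = region ` nonagon_faces"
    using assms unfolding nonagon_faces_def by (elim insertE emptyE) (auto simp: half_turn_faces)
  have "R ` surface nonagon_faces = (\<Union>S\<in>(\<lambda>f. R ` region f) ` nonagon_faces. S)" unfolding surface_def by blast
  then have "R ` surface nonagon_faces = surface nonagon_faces" unfolding reg surface_def by blast
  moreover have "R ` pt ` {1..24} = pt ` {1..24}"
  proof -
    have "{1..24::nat} = {1, 2, 3, 4, 5, 6, 7, 8, 9, 10, 11, 12, 13, 14, 15, 16, 17, 18, 19, 20, 21, 22, 23, 24}"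
    proof -
      have "{1..24::nat} = set [1..<25]" by auto
      also have "[1..<25] = [1::nat, 2, 3, 4, 5, 6, 7, 8, 9, 10, 11, 12, 13, 14, 15, 16, 17, 18, 19, 20, 21, 22, 23, 24]" by code_simp
      finally show ?thesis by simp
    qed
    then show ?thesis using assms by (elim insertE emptyE) (simp_all only: image_insert image_empty half_turn_pt, blast+)
  qed
  ultimately show ?thesis
    unfolding symmetries_def vertices_nonagon_faces using reg isometry_half_turn assms by blast
qed

lemma symmetries_nonagon_faces: "symmetries nonagon_faces = {id, half_turn_x, half_turn_y, half_turn_z}"
proof
  show "symmetries nonagon_faces \<subseteq> {id, half_turn_x, half_turn_y, half_turn_z}"
  proof
    fix \<phi> assume "\<phi> \<in> symmetries nonagon_faces"
    then have "isometry \<phi>" "\<phi> ` surface nonagon_faces = surface nonagon_faces"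
      unfolding symmetries_def by simp_all
    then show "\<phi> \<in> {id, half_turn_x, half_turn_y, half_turn_z}" by (rule surface_isometry)
  qed
  have "id \<in> symmetries nonagon_faces" unfolding symmetries_def isometry_def by simp
  then show "{id, half_turn_x, half_turn_y, half_turn_z} \<subseteq> symmetries nonagon_faces"
    using half_turn_symmetry by simp
qed

lemma det_matrix_half_turn:
  "det (matrix half_turn_x) = 1" "det (matrix half_turn_y) = 1" "det (matrix half_turn_z) = 1"
  "det (matrix (\<lambda>x. x :: real^3)) = 1"
proof -
  have *: "det (matrix T) = a * b * c"
    if "T = (\<lambda>p. vector [a * p $ 1, b * p $ 2, c * p $ 3])" for T :: "real^3 \<Rightarrow> real^3" and a b c
  proof -
    let ?M = "vector [vector [a, 0, 0], vector [0, b, 0], vector [0, 0, c]] :: real^3^3"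
    have "T = (*v) ?M" unfolding that
      by (rule ext) (simp add: vec3_eq_iff matrix_vector_mult_def sum_3)
    then have "matrix T = ?M" by (simp only: matrix_of_matrix_vector_mul)
    then show ?thesis by (simp add: det_3)
  qed
  show "det (matrix half_turn_x) = 1" using *[of half_turn_x 1 "- 1" "- 1"] by (simp add: half_turn_x_def fun_eq_iff)
  show "det (matrix half_turn_y) = 1" using *[of half_turn_y "- 1" 1 "- 1"] by (simp add: half_turn_y_def fun_eq_iff)
  show "det (matrix half_turn_z) = 1" using *[of half_turn_z "- 1" "- 1" 1] by (simp add: half_turn_z_def fun_eq_iff)
  show "det (matrix (\<lambda>x. x :: real^3)) = 1" using *[of "\<lambda>x. x" 1 1 1] by (simp add: fun_eq_iff vec3_eq_iff)
qed

text \<open>All isometries preserving the point set are already known to be the identity and the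
  half-turns, whose linear parts have determinant 1.\<close>

lemma chiral_nonagon_faces: "chiral nonagon_faces"
  unfolding chiral_def
proof
  assume "\<exists>\<phi>. orientation_reversing_isometry \<phi> \<and> \<phi> ` surface nonagon_faces = surface nonagon_faces"
  then obtain \<phi> where \<phi>: "isometry \<phi>" "det (matrix (\<lambda>x. \<phi> x - \<phi> 0)) < 0" "\<phi> ` surface nonagon_faces = surface nonagon_faces"
    unfolding orientation_reversing_isometry_def by blast
  have "\<phi> \<in> {id, half_turn_x, half_turn_y, half_turn_z}" using \<phi>(1,3) by (rule surface_isometry)
  then have "\<phi> = id \<or> \<phi> = half_turn_x \<or> \<phi> = half_turn_y \<or> \<phi> = half_turn_z" by blast
  then have "det (matrix (\<lambda>x. \<phi> x - \<phi> 0)) = 1"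
    using half_turn_x.linear half_turn_y.linear half_turn_z.linear
    by (elim disjE) (simp_all add: linear_0 det_matrix_half_turn id_def)
  then show False using \<phi>(2) by simp
qed

subsection \<open>Volume\<close>

text \<open>Turns the determinant in the volume formula for a simplex into a triple product, which
  evaluates directly from coordinates.\<close>

lemma det_columns: "det (\<chi> i j. (vector [u, v, w] :: real^3^3) $ j $ i) = u \<bullet> cross3 v w"
proof -
  have "det (\<chi> i j. (vector [u, v, w] :: real^3^3) $ j $ i) =
      u $ 1 * v $ 2 * w $ 3 + v $ 1 * w $ 2 * u $ 3 + w $ 1 * u $ 2 * v $ 3 -
      u $ 1 * w $ 2 * v $ 3 - v $ 1 * u $ 2 * w $ 3 - w $ 1 * v $ 2 * u $ 3"
    by (simp only: det_3 vec_lambda_beta vector_3)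
  also have "\<dots> = u \<bullet> cross3 v w"
    by (simp only: cross3_def inner_vec_def sum_3 vector_3 inner_real_def) (simp add: algebra_simps)
  finally show ?thesis .
qed

lemma measure_tetrahedron:
  fixes p p' p'' q :: "real^3"
  assumes "distinct [p, p', p'', q]"
  shows "measure lebesgue (convex hull {p, p', p'', q}) = \<bar>(p' - p) \<bullet> cross3 (p'' - p) (q - p)\<bar> / 6"
proof -
  let ?X = "{p, p', p'', q}" and ?W = "vector [p', p'', q] :: real^3^3"
  let ?V = "vector [p' - p, p'' - p, q - p] :: real^3^3"
  have "inj (($) ?W)"
    unfolding inj_def forall_3 vector_3 using assms by (intro conjI impI) (simp_all only: distinct.simps set_simps insert_iff empty_iff simp_thms)
  moreover have "range (($) ?W) = ?X - {p}"
    unfolding UNIV_3 image_insert image_empty vector_3 using assms by auto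
  ultimately have bij: "bij_betw (($) ?W) UNIV (?X - {p})" by (simp only: bij_betw_def)
  have "measure lborel (convex hull ?X) = \<bar>det (\<chi> i j. ?W $ j $ i - p $ i)\<bar> / fact (CARD(3))"
    by (rule content_simplex[OF _ _ _ bij]) (use assms in simp_all)
  also have "(\<chi> i j. ?W $ j $ i - p $ i) = (\<chi> i j. ?V $ j $ i)"
    unfolding vec_eq_iff vec_lambda_beta forall_3 vector_3 vector_minus_component by (intro conjI refl)
  also have "det (\<chi> i j. ?V $ j $ i) = (p' - p) \<bullet> cross3 (p'' - p) (q - p)" by (rule det_columns)
  also have "fact (CARD(3)) = (6 :: real)" by (simp add: fact_numeral)
  finally have "measure lborel (convex hull ?X) = \<bar>(p' - p) \<bullet> cross3 (p'' - p) (q - p)\<bar> / 6" .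
  moreover have "convex hull ?X \<in> sets lborel"
    using finite_imp_compact_convex_hull[of ?X] by (simp add: borel_compact)
  then have "measure lebesgue (convex hull ?X) = measure lborel (convex hull ?X)" by (rule measure_completion)
  ultimately show ?thesis by (simp only:)
qed

lemma lmeasurable_tetrahedron: "finite S \<Longrightarrow> convex hull S \<in> lmeasurable" for S :: "(real^3) set"
  by (intro lmeasurable_compact finite_imp_compact_convex_hull)

text \<open>The big tetrahedron, on the negative side of the planes of all \<open>A\<close>
  faces.\<close>

definition cell_A :: "(real^3) set" where
  "cell_A = {x. lin (- 3) 4 2 5 x \<ge> 0 \<and> lin 3 (- 4) 2 5 x \<ge> 0 \<and> lin (- 3) (- 4) (- 2) 5 x \<ge> 0 \<and> lin 3 4 (- 2) 5 x \<ge> 0}"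

lemma measure_cell_A: "cell_A \<in> lmeasurable" "measure lebesgue cell_A = 125 / 9"
proof -
  have *: "convex hull {vector [- 5/3, 5/4, 5/2], vector [5/3, - 5/4, 5/2], vector [- 5/3, - 5/4, - 5/2], vector [5/3, 5/4, - 5/2]} = cell_A"
    unfolding cell_A_def
    by (rule tetrahedron_iff[where k = "20" and k' = "20" and k'' = "20" and l = "20"])
      (simp_all add: lin_def det3_def field_simps)
  show "cell_A \<in> lmeasurable" unfolding *[symmetric] by (rule lmeasurable_tetrahedron) simp
  show "measure lebesgue cell_A = 125 / 9" unfolding *[symmetric]
    by (subst measure_tetrahedron) (simp_all add: vec3_eq_iff cross3_def inner_vec_def sum_3)
qed

text \<open>The closed cavity tetrahedron, to be subtracted.\<close>

definition cell_B :: "(real^3) set" where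
  "cell_B = {x. lin 2 (- 5) 5 3 x \<ge> 0 \<and> lin (- 2) 5 5 3 x \<ge> 0 \<and> lin 2 5 (- 5) 3 x \<ge> 0 \<and> lin (- 2) (- 5) (- 5) 3 x \<ge> 0}"

lemma measure_cell_B: "cell_B \<in> lmeasurable" "measure lebesgue cell_B = 36 / 25"
proof -
  have *: "convex hull {vector [3/2, - 3/5, 3/5], vector [- 3/2, 3/5, 3/5], vector [3/2, 3/5, - 3/5], vector [- 3/2, - 3/5, - 3/5]} = cell_B"
    unfolding cell_B_def
    by (rule tetrahedron_iff[where k = "12" and k' = "12" and k'' = "12" and l = "12"])
      (simp_all add: lin_def det3_def field_simps)
  show "cell_B \<in> lmeasurable" unfolding *[symmetric] by (rule lmeasurable_tetrahedron) simp
  show "measure lebesgue cell_B = 36 / 25" unfolding *[symmetric]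
    by (subst measure_tetrahedron) (simp_all add: vec3_eq_iff cross3_def inner_vec_def sum_3)
qed

text \<open>The spike with tip \<open>pt 2\<close>: it stands on the plane of \<open>A\<close> 3
  outside the big tetrahedron and is bounded by the planes of \<open>A\<close> 1, \<open>A\<close> 2
  and \<open>B\<close> 2.\<close>

definition cell_T :: "(real^3) set" where
  "cell_T = {x. lin (- 3) 4 2 5 x \<ge> 0 \<and> lin 3 (- 4) 2 5 x \<ge> 0 \<and> lin 3 4 2 (- 5) x \<ge> 0 \<and> lin 2 (- 5) (- 5) (- 3) x \<ge> 0}"

lemma measure_cell_T: "cell_T \<in> lmeasurable" "measure lebesgue cell_T = 493039 / 287280"
proof -
  have *: "convex hull {vector [37/38, 5/4, - 111/76], vector [5/3, - 1/15, 2/15], vector [38/7, 57/14, - 5/2], vector [5/3, 5/4, - 5/2]} = cell_T"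
    unfolding cell_T_def
    \<comment> \<open>The values of the four forms at the opposite vertices.\<close>
    by (rule tetrahedron_iff[where k = "79/19" and k' = "158/15" and k'' = "158/7" and l = "79/12"])
      (simp_all add: lin_def det3_def field_simps)
  show "cell_T \<in> lmeasurable" unfolding *[symmetric] by (rule lmeasurable_tetrahedron) simp
  show "measure lebesgue cell_T = 493039 / 287280" unfolding *[symmetric]
    by (subst measure_tetrahedron) (simp_all add: vec3_eq_iff cross3_def inner_vec_def sum_3)
qed

text \<open>The corner of the cavity tetrahedron that pokes out through the plane of
  \<open>A\<close> 1. It has to be added to the big tetrahedron before the whole cavity tetrahedron
  can be subtracted.\<close>

definition cell_U :: "(real^3) set" where
  "cell_U = {x. lin 3 (- 4) (- 2) (- 5) x \<ge> 0 \<and> lin (- 2) 5 5 3 x \<ge> 0 \<and> lin 2 5 (- 5) 3 x \<ge> 0 \<and> lin (- 2) (- 5) (- 5) 3 x \<ge> 0}"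

lemma measure_cell_U: "cell_U \<in> lmeasurable" "measure lebesgue cell_U = 343 / 151800"
proof -
  have *: "convex hull {vector [3/2, - 3/5, 3/5], vector [31/23, - 62/115, 3/5], vector [3/2, - 1/4, 1/4], vector [13/11, - 3/5, 26/55]} = cell_U"
    unfolding cell_U_def
    by (rule tetrahedron_iff[where k = "7/10" and k' = "14/23" and k'' = "7/2" and l = "14/11"])
      (simp_all add: lin_def det3_def field_simps)
  show "cell_U \<in> lmeasurable" unfolding *[symmetric] by (rule lmeasurable_tetrahedron) simp
  show "measure lebesgue cell_U = 343 / 151800" unfolding *[symmetric]
    by (subst measure_tetrahedron) (simp_all add: vec3_eq_iff cross3_def inner_vec_def sum_3)
qed

lemma (in orthogonal_involution) measure_vimage:
  assumes "S \<in> lmeasurable"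
  shows "{x. T x \<in> S} \<in> lmeasurable" "measure lebesgue {x. T x \<in> S} = measure lebesgue S"
  using measurable_orthogonal_image[OF orthogonal assms] measure_orthogonal_image[OF orthogonal assms]
  by (simp_all add: image_eq_vimage)

definition cell :: "nat \<Rightarrow> (real^3) set" where
  "cell i = [cell_A, cell_T, {x. half_turn_z x \<in> cell_T}, {x. half_turn_x x \<in> cell_T}, {x. half_turn_y x \<in> cell_T}, cell_U, {x. half_turn_z x \<in> cell_U}, {x. half_turn_x x \<in> cell_U}, {x. half_turn_y x \<in> cell_U}] ! i"

lemma cell_simps:
  "cell 0 = cell_A"
  "cell 1 = cell_T"
  "cell 2 = {x. half_turn_z x \<in> cell_T}"
  "cell 3 = {x. half_turn_x x \<in> cell_T}"
  "cell 4 = {x. half_turn_y x \<in> cell_T}"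
  "cell 5 = cell_U"
  "cell 6 = {x. half_turn_z x \<in> cell_U}"
  "cell 7 = {x. half_turn_x x \<in> cell_U}"
  "cell 8 = {x. half_turn_y x \<in> cell_U}"
  by (simp_all add: cell_def One_nat_def)

text \<open>A null set containing all points where closed cells touch; away from it weak and strict
  inequalities agree.\<close>

definition face_planes :: "(real^3) set" where
  "face_planes = {x. fa1 x = 0} \<union> {x. fa2 x = 0} \<union> {x. fa3 x = 0} \<union> {x. fa4 x = 0} \<union> {x. fb1 x = 0} \<union> {x. fb2 x = 0} \<union> {x. fb3 x = 0} \<union> {x. fb4 x = 0}"

lemma negligible_face_planes: "negligible face_planes"
proof -
  have "negligible {x. lin a b c d x = 0}" if "(a, b, c) \<noteq> (0, 0, 0)" for a b c d
    unfolding lin_0_hyperplane by (rule negligible_hyperplane) (use that in \<open>auto simp: vec3_eq_iff\<close>)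
  then show ?thesis unfolding face_planes_def by (intro negligible_Un) simp_all
qed

lemmas cell_signs = cell_simps cell_A_def cell_B_def cell_T_def cell_U_def mem_Collect_eq lin_half_turn minus_minus

lemma cells_disjoint_pairs:
  assumes "x \<notin> face_planes"
  shows "x \<in> cell 0 \<Longrightarrow> x \<in> cell 1 \<Longrightarrow> False"
    "x \<in> cell 0 \<Longrightarrow> x \<in> cell 2 \<Longrightarrow> False"
    "x \<in> cell 0 \<Longrightarrow> x \<in> cell 3 \<Longrightarrow> False"
    "x \<in> cell 0 \<Longrightarrow> x \<in> cell 4 \<Longrightarrow> False"
    "x \<in> cell 0 \<Longrightarrow> x \<in> cell 5 \<Longrightarrow> False"
    "x \<in> cell 0 \<Longrightarrow> x \<in> cell 6 \<Longrightarrow> False"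
    "x \<in> cell 0 \<Longrightarrow> x \<in> cell 7 \<Longrightarrow> False"
    "x \<in> cell 0 \<Longrightarrow> x \<in> cell 8 \<Longrightarrow> False"
    "x \<in> cell 1 \<Longrightarrow> x \<in> cell 2 \<Longrightarrow> False"
    "x \<in> cell 1 \<Longrightarrow> x \<in> cell 3 \<Longrightarrow> False"
    "x \<in> cell 1 \<Longrightarrow> x \<in> cell 4 \<Longrightarrow> False"
    "x \<in> cell 1 \<Longrightarrow> x \<in> cell 5 \<Longrightarrow> False"
    "x \<in> cell 1 \<Longrightarrow> x \<in> cell 6 \<Longrightarrow> False"
    "x \<in> cell 1 \<Longrightarrow> x \<in> cell 7 \<Longrightarrow> False"
    "x \<in> cell 1 \<Longrightarrow> x \<in> cell 8 \<Longrightarrow> False"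
    "x \<in> cell 2 \<Longrightarrow> x \<in> cell 3 \<Longrightarrow> False"
    "x \<in> cell 2 \<Longrightarrow> x \<in> cell 4 \<Longrightarrow> False"
    "x \<in> cell 2 \<Longrightarrow> x \<in> cell 5 \<Longrightarrow> False"
    "x \<in> cell 2 \<Longrightarrow> x \<in> cell 6 \<Longrightarrow> False"
    "x \<in> cell 2 \<Longrightarrow> x \<in> cell 7 \<Longrightarrow> False"
    "x \<in> cell 2 \<Longrightarrow> x \<in> cell 8 \<Longrightarrow> False"
    "x \<in> cell 3 \<Longrightarrow> x \<in> cell 4 \<Longrightarrow> False"
    "x \<in> cell 3 \<Longrightarrow> x \<in> cell 5 \<Longrightarrow> False"
    "x \<in> cell 3 \<Longrightarrow> x \<in> cell 6 \<Longrightarrow> False"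
    "x \<in> cell 3 \<Longrightarrow> x \<in> cell 7 \<Longrightarrow> False"
    "x \<in> cell 3 \<Longrightarrow> x \<in> cell 8 \<Longrightarrow> False"
    "x \<in> cell 4 \<Longrightarrow> x \<in> cell 5 \<Longrightarrow> False"
    "x \<in> cell 4 \<Longrightarrow> x \<in> cell 6 \<Longrightarrow> False"
    "x \<in> cell 4 \<Longrightarrow> x \<in> cell 7 \<Longrightarrow> False"
    "x \<in> cell 4 \<Longrightarrow> x \<in> cell 8 \<Longrightarrow> False"
    "x \<in> cell 5 \<Longrightarrow> x \<in> cell 6 \<Longrightarrow> False"
    "x \<in> cell 5 \<Longrightarrow> x \<in> cell 7 \<Longrightarrow> False"
    "x \<in> cell 5 \<Longrightarrow> x \<in> cell 8 \<Longrightarrow> False"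
    "x \<in> cell 6 \<Longrightarrow> x \<in> cell 7 \<Longrightarrow> False"
    "x \<in> cell 6 \<Longrightarrow> x \<in> cell 8 \<Longrightarrow> False"
    "x \<in> cell 7 \<Longrightarrow> x \<in> cell 8 \<Longrightarrow> False"
  using assms unfolding cell_signs face_planes_def Un_iff unfolding lin_def by argo+

text \<open>Both orders of every pair are listed, because \<open>pairwise\<close> ranges over
  ordered pairs; a common point of two cells can only lie on a face plane.\<close>

lemma cells_negligible:
  "negligible (cell 0 \<inter> cell 1)"
  "negligible (cell 0 \<inter> cell 2)"
  "negligible (cell 0 \<inter> cell 3)"
  "negligible (cell 0 \<inter> cell 4)"
  "negligible (cell 0 \<inter> cell 5)"
  "negligible (cell 0 \<inter> cell 6)"
  "negligible (cell 0 \<inter> cell 7)"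
  "negligible (cell 0 \<inter> cell 8)"
  "negligible (cell 1 \<inter> cell 0)"
  "negligible (cell 1 \<inter> cell 2)"
  "negligible (cell 1 \<inter> cell 3)"
  "negligible (cell 1 \<inter> cell 4)"
  "negligible (cell 1 \<inter> cell 5)"
  "negligible (cell 1 \<inter> cell 6)"
  "negligible (cell 1 \<inter> cell 7)"
  "negligible (cell 1 \<inter> cell 8)"
  "negligible (cell 2 \<inter> cell 0)"
  "negligible (cell 2 \<inter> cell 1)"
  "negligible (cell 2 \<inter> cell 3)"
  "negligible (cell 2 \<inter> cell 4)"
  "negligible (cell 2 \<inter> cell 5)"
  "negligible (cell 2 \<inter> cell 6)"
  "negligible (cell 2 \<inter> cell 7)"
  "negligible (cell 2 \<inter> cell 8)"
  "negligible (cell 3 \<inter> cell 0)"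
  "negligible (cell 3 \<inter> cell 1)"
  "negligible (cell 3 \<inter> cell 2)"
  "negligible (cell 3 \<inter> cell 4)"
  "negligible (cell 3 \<inter> cell 5)"
  "negligible (cell 3 \<inter> cell 6)"
  "negligible (cell 3 \<inter> cell 7)"
  "negligible (cell 3 \<inter> cell 8)"
  "negligible (cell 4 \<inter> cell 0)"
  "negligible (cell 4 \<inter> cell 1)"
  "negligible (cell 4 \<inter> cell 2)"
  "negligible (cell 4 \<inter> cell 3)"
  "negligible (cell 4 \<inter> cell 5)"
  "negligible (cell 4 \<inter> cell 6)"
  "negligible (cell 4 \<inter> cell 7)"
  "negligible (cell 4 \<inter> cell 8)"
  "negligible (cell 5 \<inter> cell 0)"
  "negligible (cell 5 \<inter> cell 1)"
  "negligible (cell 5 \<inter> cell 2)"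
  "negligible (cell 5 \<inter> cell 3)"
  "negligible (cell 5 \<inter> cell 4)"
  "negligible (cell 5 \<inter> cell 6)"
  "negligible (cell 5 \<inter> cell 7)"
  "negligible (cell 5 \<inter> cell 8)"
  "negligible (cell 6 \<inter> cell 0)"
  "negligible (cell 6 \<inter> cell 1)"
  "negligible (cell 6 \<inter> cell 2)"
  "negligible (cell 6 \<inter> cell 3)"
  "negligible (cell 6 \<inter> cell 4)"
  "negligible (cell 6 \<inter> cell 5)"
  "negligible (cell 6 \<inter> cell 7)"
  "negligible (cell 6 \<inter> cell 8)"
  "negligible (cell 7 \<inter> cell 0)"
  "negligible (cell 7 \<inter> cell 1)"
  "negligible (cell 7 \<inter> cell 2)"
  "negligible (cell 7 \<inter> cell 3)"
  "negligible (cell 7 \<inter> cell 4)"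
  "negligible (cell 7 \<inter> cell 5)"
  "negligible (cell 7 \<inter> cell 6)"
  "negligible (cell 7 \<inter> cell 8)"
  "negligible (cell 8 \<inter> cell 0)"
  "negligible (cell 8 \<inter> cell 1)"
  "negligible (cell 8 \<inter> cell 2)"
  "negligible (cell 8 \<inter> cell 3)"
  "negligible (cell 8 \<inter> cell 4)"
  "negligible (cell 8 \<inter> cell 5)"
  "negligible (cell 8 \<inter> cell 6)"
  "negligible (cell 8 \<inter> cell 7)"
  by (rule negligible_subset[OF negligible_face_planes], rule subsetI, elim IntE, rule ccontr,
      erule (2) cells_disjoint_pairs)+

text \<open>The solid with its cavity filled is the big tetrahedron with the four spikes and the
  four protruding cavity corners. The second claim says that filling the cavity adds its full
  volume.\<close>

lemma cells_cover:
  "x \<notin> face_planes \<Longrightarrow> \<not> off_solid x \<or> x \<in> cell_B \<longleftrightarrow> x \<in> cell 0 \<or> x \<in> cell 1 \<or> x \<in> cell 2 \<or> x \<in> cell 3 \<or> x \<in> cell 4 \<or> x \<in> cell 5 \<or> x \<in> cell 6 \<or> x \<in> cell 7 \<or> x \<in> cell 8"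
  "x \<notin> face_planes \<Longrightarrow> \<not> off_solid x \<Longrightarrow> x \<in> cell_B \<Longrightarrow> False"
  unfolding cell_signs face_planes_def Un_iff off_solid_def unfolding lin_def by argo+

lemma measure_cells:
  "i < 9 \<Longrightarrow> cell i \<in> lmeasurable"
  "(\<Sum>i<9. measure lebesgue (cell i)) = 125 / 9 + 4 * (493039 / 287280) + 4 * (343 / 151800)"
proof -
  note T = half_turn_x.measure_vimage half_turn_y.measure_vimage half_turn_z.measure_vimage
  show "i < 9 \<Longrightarrow> cell i \<in> lmeasurable"
    unfolding less_9_iff by (elim disjE; hypsubst; unfold cell_simps; intro T measure_cell_A measure_cell_T measure_cell_U)
  have "{..<9::nat} = {0, 1, 2, 3, 4, 5, 6, 7, 8}" using less_9_iff by blast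
  then show "(\<Sum>i<9. measure lebesgue (cell i)) = 125 / 9 + 4 * (493039 / 287280) + 4 * (343 / 151800)"
    by (simp add: cell_simps T measure_cell_A measure_cell_T measure_cell_U)
qed

lemma solid_lmeasurable: "solid nonagon_faces \<in> lmeasurable"
proof (rule lmeasurable_compact)
  have "\<bar>x $ 1\<bar> \<le> 10 \<and> \<bar>x $ 2\<bar> \<le> 10 \<and> \<bar>x $ 3\<bar> \<le> 10" if "\<not> off_solid x" for x
    using that unfolding off_solid_def lin_def abs_le_iff by argo
  then have "bounded {x. \<not> off_solid x}" by (intro bounded_coordinates[of _ 10]) simp
  moreover have "closed {x. \<not> off_solid x}" using open_off_solid by (simp add: closed_def Compl_eq)
  ultimately show "compact (solid nonagon_faces)" unfolding solid_nonagon_faces compact_eq_bounded_closed by simp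
qed

text \<open>Up to the face planes, the solid and the tetrahedron cut out by the four planes of the faces \<open>B\<^sub>i\<close>
  together fill the same space as the nine tetrahedra \<open>cell i\<close>.\<close>

lemma measure_solid: "measure lebesgue (solid nonagon_faces) = 351105133 / 18170460"
proof -
  let ?S = "solid nonagon_faces" and ?C = "\<Union>(cell ` {..<9})"
  have S: "x \<in> ?S \<longleftrightarrow> \<not> off_solid x" for x by (simp add: solid_nonagon_faces)
  have neg: "negligible X" if "X \<subseteq> face_planes" for X using negligible_face_planes that by (rule negligible_subset)
  have C: "x \<in> ?C \<longleftrightarrow> x \<in> cell 0 \<or> x \<in> cell 1 \<or> x \<in> cell 2 \<or> x \<in> cell 3 \<or> x \<in> cell 4 \<or> x \<in> cell 5 \<or> x \<in> cell 6 \<or> x \<in> cell 7 \<or> x \<in> cell 8" for x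
  proof -
    have "{..<9::nat} = {0, 1, 2, 3, 4, 5, 6, 7, 8}" using less_9_iff by blast
    then show ?thesis by simp
  qed
  have "x \<in> ?S \<union> cell_B \<longleftrightarrow> x \<in> ?C" if "x \<notin> face_planes" for x
    unfolding C Un_iff S by (rule cells_cover(1)[OF that])
  then have "negligible (?S \<union> cell_B - ?C \<union> (?C - (?S \<union> cell_B)))" by (intro neg) blast
  from measure_negligible_symdiff[OF _ this]
  have "measure lebesgue ?C = measure lebesgue (?S \<union> cell_B)"
    using solid_lmeasurable measure_cell_B(1) by (simp add: fmeasurable.Un)
  moreover have "measure lebesgue ?C = (\<Sum>i<9. measure lebesgue (cell i))"
  proof (rule measure_negligible_finite_Union_image)
    have "{..<9::nat} = {0, 1, 2, 3, 4, 5, 6, 7, 8}" using less_9_iff by blast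
    then show "pairwise (\<lambda>i j. negligible (cell i \<inter> cell j)) {..<9}"
      by (simp add: pairwise_def cells_negligible)
  qed (simp_all add: measure_cells(1))
  moreover have "measure lebesgue (?S \<inter> cell_B) = 0"
  proof (rule negligible_imp_measure0, rule neg, rule subsetI)
    fix x assume "x \<in> ?S \<inter> cell_B"
    then show "x \<in> face_planes" using cells_cover(2)[of x] S by blast
  qed
  moreover have "measure lebesgue (?S \<union> cell_B) = measure lebesgue ?S + measure lebesgue cell_B - measure lebesgue (?S \<inter> cell_B)"
    using solid_lmeasurable measure_cell_B(1) by (rule measure_Un3)
  ultimately show ?thesis unfolding measure_cells(2) measure_cell_B(2) by simp
qed

theorem theorem1:
  fixes v :: "nat \<Rightarrow> real^3"
    and A B :: "nat \<Rightarrow> polygon"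
    and P :: "polygon set"
    and D :: "polygon set set"
  assumes v1: "v 1 = vector [- 38/7, - 57/14, - 5/2]"
    and v5: "v 5 = vector [5/3, - 1/15, 2/15]"
    and v9: "v 9 = vector [- 37/38, - 5/4, - 111/76]"
    and v13: "v 13 = vector [13/11, - 3/5, 26/55]"
    and v17: "v 17 = vector [3/2, - 1/4, 1/4]"
    and v21: "v 21 = vector [31/23, - 62/115, 3/5]"
    and orbits: "\<forall>i\<in>{1, 5, 9, 13, 17, 21}.
                   v (i + 1) = half_turn_z (v i) \<and>
                   v (i + 2) = half_turn_x (v i) \<and>
                   v (i + 3) = half_turn_y (v i)"
    and A1: "A 1 = map v [1, 2, 5, 7, 17, 13, 21, 12, 9]"
    and A2: "A 2 = map v [6, 8, 18, 14, 22, 11, 10, 2, 1]"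
    and A3: "A 3 = map v [7, 5, 19, 15, 23, 10, 11, 3, 4]"
    and A4: "A 4 = map v [4, 3, 8, 6, 20, 16, 24, 9, 12]"
    and B1: "B 1 = map v [1, 9, 24, 23, 15, 14, 18, 20, 6]"
    and B2: "B 2 = map v [13, 17, 19, 5, 2, 10, 23, 24, 16]"
    and B3: "B 3 = map v [21, 13, 16, 20, 18, 8, 3, 11, 22]"
    and B4: "B 4 = map v [4, 12, 21, 22, 14, 15, 19, 17, 7]"
    and P: "P = A ` {1..4} \<union> B ` {1..4}"
    and D: "D = {{A 1, B 2}, {A 1, B 4}, {A 3, B 2}, {A 3, B 4},
                 {A 2, B 1}, {A 2, B 3}, {A 4, B 1}, {A 4, B 3}}"
  shows
    "region (A 1) \<subseteq> {p. 3 * p $ 1 - 4 * p $ 2 - 2 * p $ 3 = 5}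
     \<and> region (A 2) \<subseteq> {p. - 3 * p $ 1 + 4 * p $ 2 - 2 * p $ 3 = 5}
     \<and> region (A 3) \<subseteq> {p. 3 * p $ 1 + 4 * p $ 2 + 2 * p $ 3 = 5}
     \<and> region (A 4) \<subseteq> {p. - 3 * p $ 1 - 4 * p $ 2 + 2 * p $ 3 = 5}
     \<and> region (B 1) \<subseteq> {p. - 2 * p $ 1 + 5 * p $ 2 - 5 * p $ 3 = 3}
     \<and> region (B 2) \<subseteq> {p. 2 * p $ 1 - 5 * p $ 2 - 5 * p $ 3 = 3}
     \<and> region (B 3) \<subseteq> {p. - 2 * p $ 1 - 5 * p $ 2 + 5 * p $ 3 = 3}
     \<and> region (B 4) \<subseteq> {p. 2 * p $ 1 + 5 * p $ 2 + 5 * p $ 3 = 3}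
     \<and> oriented_cycle (A 2) = oriented_cycle (map half_turn_z (A 1))
     \<and> oriented_cycle (A 3) = oriented_cycle (map half_turn_x (A 1))
     \<and> oriented_cycle (A 4) = oriented_cycle (map half_turn_y (A 1))
     \<and> oriented_cycle (B 2) = oriented_cycle (map half_turn_z (B 1))
     \<and> oriented_cycle (B 3) = oriented_cycle (map half_turn_x (B 1))
     \<and> oriented_cycle (B 4) = oriented_cycle (map half_turn_y (B 1))
     \<and> (\<forall>f\<in>P. outward_oriented P f)
     \<and> polyhedral_surface P \<and> has_genus P 3
     \<and> card P = 8 \<and> card (edges P) = 36 \<and> card (vertices P) = 24
     \<and> (\<forall>f\<in>P. simple_polygon f \<and> length f = 9 \<and> \<not> convex (region f))
     \<and> (\<forall>x\<in>vertices P. card {f \<in> P. x \<in> set f} = 3)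
     \<and> (\<forall>f\<in>P. \<forall>g\<in>P. f \<noteq> g \<longrightarrow> edges_of f \<inter> edges_of g \<noteq> {})
     \<and> (\<forall>f\<in>P. \<forall>g\<in>P. f \<noteq> g \<and> {f, g} \<in> D \<longrightarrow>
     card (edges_of f \<inter> edges_of g) = 2 \<and> collinear (\<Union> (edges_of f \<inter> edges_of g)))
     \<and> (\<forall>f\<in>P. \<forall>g\<in>P. f \<noteq> g \<and> {f, g} \<notin> D \<longrightarrow> card (edges_of f \<inter> edges_of g) = 1)
     \<and> card {{f, g} | f g. f \<in> P \<and> g \<in> P \<and> f \<noteq> g \<and> {f, g} \<notin> D} = 20
     \<and> (\<forall>i\<in>{1..4}. card (reflex_corners (A i)) = 3)
     \<and> (\<forall>i\<in>{1..4}. card (reflex_corners (B i)) = 2)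
     \<and> symmetries P = {id, half_turn_x, half_turn_y, half_turn_z} \<and> chiral P
     \<and> automorphism_group P \<cong> dihedral_group 4
     \<and> (\<forall>f\<in>P. \<forall>g\<in>P. \<exists>!\<pi>. \<pi> \<in> automorphisms P \<and>
     unoriented_cycle (map \<pi> f) = unoriented_cycle g)
     \<and> (\<forall>\<pi>\<in>automorphisms P. orientation_preserving P \<pi>)
     \<and> solid P \<in> lmeasurable \<and> measure lebesgue (solid P) = 351105133 / 18170460
     \<and> convex hull (surface P) = convex hull {v 1, v 2, v 3, v 4}
     \<and> \<not> affine_dependent {v 1, v 2, v 3, v 4}"
proof -
  have turns: "v 2 = half_turn_z (v 1)" "v 3 = half_turn_x (v 1)" "v 4 = half_turn_y (v 1)" "v 6 = half_turn_z (v 5)" "v 7 = half_turn_x (v 5)" "v 8 = half_turn_y (v 5)"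
    "v 10 = half_turn_z (v 9)" "v 11 = half_turn_x (v 9)" "v 12 = half_turn_y (v 9)" "v 14 = half_turn_z (v 13)" "v 15 = half_turn_x (v 13)" "v 16 = half_turn_y (v 13)"
    "v 18 = half_turn_z (v 17)" "v 19 = half_turn_x (v 17)" "v 20 = half_turn_y (v 17)" "v 22 = half_turn_z (v 21)" "v 23 = half_turn_x (v 21)" "v 24 = half_turn_y (v 21)"
    using orbits by simp_all
  \<comment> \<open>The hypotheses leave \<open>v\<close> arbitrary outside the indices 1 to 24, so
    \<open>v\<close> and \<open>pt\<close> are identified point by point and not as
    functions.\<close>
  have base: "v 1 = pt 1" "v 5 = pt 5" "v 9 = pt 9" "v 13 = pt 13" "v 17 = pt 17" "v 21 = pt 21"
    by (simp_all add: v1 v5 v9 v13 v17 v21 pt_simps)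
  note points = base turns[unfolded base half_turn_pt]
  have A: "A 1 = face_A1" "A 2 = face_A2" "A 3 = face_A3" "A 4 = face_A4"
    by (simp_all add: A1 A2 A3 A4 points face_A1_def face_A2_def face_A3_def face_A4_def)
  have B: "B 1 = face_B1" "B 2 = face_B2" "B 3 = face_B3" "B 4 = face_B4"
    by (simp_all add: B1 B2 B3 B4 points face_B1_def face_B2_def face_B3_def face_B4_def)
  have four: "{1..4::nat} = {1, 2, 3, 4}"
  proof -
    have "{1..4::nat} = set [1..<5]" by auto
    also have "[1..<5] = [1::nat, 2, 3, 4]" by code_simp
    finally show ?thesis by simp
  qed
  have PF: "P = nonagon_faces"
    unfolding P four nonagon_faces_def by (simp add: A B, blast)
  have nth: "nth_face 0 = face_A1" "nth_face 1 = face_A2" "nth_face 2 = face_A3" "nth_face 3 = face_A4" "nth_face 4 = face_B1" "nth_face 5 = face_B2" "nth_face 6 = face_B3" "nth_face 7 = face_B4"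
    by (simp_all add: nth_face_def face_lists_def One_nat_def face_A1_def face_A2_def face_A3_def face_A4_def face_B1_def face_B2_def face_B3_def face_B4_def)
  \<comment> \<open>Puts the pairs of faces into the indexed form in which the numbers of common
    edges were evaluated.\<close>
  have D': "D = (\<lambda>(i, j). {nth_face i, nth_face j}) ` set double_pairs"
    by (simp add: D A B double_pairs_def nth)
  have common: "card (edges_of f \<inter> edges_of g) = (if {f, g} \<in> D then 2 else 1)"
    if fg: "f \<in> P" "g \<in> P" "f \<noteq> g" for f g
  proof -
    obtain i j where ij: "i < 8" "f = nth_face i" "j < 8" "g = nth_face j"
      using fg(1,2) unfolding PF nonagon_faces_nth by auto
    have "i \<noteq> j" using fg(3) ij(2,4) by blast
    then consider "i < j" | "j < i" by linarith
    then show ?thesis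
    proof cases
      case 1
      show ?thesis unfolding ij card_common_edges[OF 1 ij(3)] card_simple_pairs(1)[OF D' 1 ij(3)] ..
    next
      case 2
      show ?thesis unfolding ij Int_commute[of "edges_of (nth_face i)"] insert_commute[of "nth_face i"]
        card_common_edges[OF 2 ij(1)] card_simple_pairs(1)[OF D' 2 ij(1)] ..
    qed
  qed
  have line: "collinear (\<Union> (edges_of face_A1 \<inter> edges_of face_B2))"
    "collinear (\<Union> (edges_of face_A1 \<inter> edges_of face_B4))"
    "collinear (\<Union> (edges_of face_A3 \<inter> edges_of face_B2))"
    "collinear (\<Union> (edges_of face_A3 \<inter> edges_of face_B4))"
    "collinear (\<Union> (edges_of face_A2 \<inter> edges_of face_B1))"
    "collinear (\<Union> (edges_of face_A2 \<inter> edges_of face_B3))"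
    "collinear (\<Union> (edges_of face_A4 \<inter> edges_of face_B1))"
    "collinear (\<Union> (edges_of face_A4 \<inter> edges_of face_B3))"
    \<comment> \<open>All common edges of two faces lie on the line in which their planes meet; the
      numbers are the coefficients of the two forms.\<close>
    subgoal by (rule collinear_common_edges[of _ 3 "- 4" "- 2" "- 5" _ "- 2" 5 5 3]) (simp_all add: region_faces cross3_def vec3_eq_iff)
    subgoal by (rule collinear_common_edges[of _ 3 "- 4" "- 2" "- 5" _ "- 2" "- 5" "- 5" 3]) (simp_all add: region_faces cross3_def vec3_eq_iff)
    subgoal by (rule collinear_common_edges[of _ 3 4 2 "- 5" _ "- 2" 5 5 3]) (simp_all add: region_faces cross3_def vec3_eq_iff)
    subgoal by (rule collinear_common_edges[of _ 3 4 2 "- 5" _ "- 2" "- 5" "- 5" 3]) (simp_all add: region_faces cross3_def vec3_eq_iff)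
    subgoal by (rule collinear_common_edges[of _ "- 3" 4 "- 2" "- 5" _ 2 "- 5" 5 3]) (simp_all add: region_faces cross3_def vec3_eq_iff)
    subgoal by (rule collinear_common_edges[of _ "- 3" 4 "- 2" "- 5" _ 2 5 "- 5" 3]) (simp_all add: region_faces cross3_def vec3_eq_iff)
    subgoal by (rule collinear_common_edges[of _ "- 3" "- 4" 2 "- 5" _ 2 "- 5" 5 3]) (simp_all add: region_faces cross3_def vec3_eq_iff)
    subgoal by (rule collinear_common_edges[of _ "- 3" "- 4" 2 "- 5" _ 2 5 "- 5" 3]) (simp_all add: region_faces cross3_def vec3_eq_iff)
    done
  have line': "collinear (\<Union> (edges_of f \<inter> edges_of g))" if "{f, g} \<in> D" for f g
    using that unfolding D A B
    by (elim insertE emptyE; elim doubleton_eq_iff[THEN iffD1, elim_format] disjE conjE; hypsubst)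
      (use line in \<open>simp_all only: Int_commute\<close>)
  show ?thesis
    unfolding PF A B points
  proof (intro conjI)
    show "region face_A1 \<subseteq> {p. 3 * p $ 1 - 4 * p $ 2 - 2 * p $ 3 = 5}" unfolding region_faces lin_def by auto
    show "region face_A2 \<subseteq> {p. - 3 * p $ 1 + 4 * p $ 2 - 2 * p $ 3 = 5}" unfolding region_faces lin_def by auto
    show "region face_A3 \<subseteq> {p. 3 * p $ 1 + 4 * p $ 2 + 2 * p $ 3 = 5}" unfolding region_faces lin_def by auto
    show "region face_A4 \<subseteq> {p. - 3 * p $ 1 - 4 * p $ 2 + 2 * p $ 3 = 5}" unfolding region_faces lin_def by auto
    show "region face_B1 \<subseteq> {p. - 2 * p $ 1 + 5 * p $ 2 - 5 * p $ 3 = 3}" unfolding region_faces lin_def by auto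
    show "region face_B2 \<subseteq> {p. 2 * p $ 1 - 5 * p $ 2 - 5 * p $ 3 = 3}" unfolding region_faces lin_def by auto
    show "region face_B3 \<subseteq> {p. - 2 * p $ 1 - 5 * p $ 2 + 5 * p $ 3 = 3}" unfolding region_faces lin_def by auto
    show "region face_B4 \<subseteq> {p. 2 * p $ 1 + 5 * p $ 2 + 5 * p $ 3 = 3}" unfolding region_faces lin_def by auto
    show "oriented_cycle face_A2 = oriented_cycle (map half_turn_z face_A1)"
      unfolding face_A2_eq by (rule oriented_cycle_rotate)
    show "oriented_cycle face_A3 = oriented_cycle (map half_turn_x face_A1)"
      unfolding face_A3_eq by (rule oriented_cycle_rotate)
    show "oriented_cycle face_A4 = oriented_cycle (map half_turn_y face_A1)"
      unfolding face_A4_eq by (rule oriented_cycle_rotate)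
    show "oriented_cycle face_B2 = oriented_cycle (map half_turn_z face_B1)"
      unfolding face_B2_eq by (rule oriented_cycle_rotate)
    show "oriented_cycle face_B3 = oriented_cycle (map half_turn_x face_B1)"
      unfolding face_B3_eq by (rule oriented_cycle_rotate)
    show "oriented_cycle face_B4 = oriented_cycle (map half_turn_y face_B1)"
      unfolding face_B4_eq by (rule oriented_cycle_rotate)
    show "\<forall>f\<in>nonagon_faces. outward_oriented nonagon_faces f" using outward_oriented_nonagon_faces by blast
    show "polyhedral_surface nonagon_faces" by (rule polyhedral_surface_nonagon_faces)
    show "has_genus nonagon_faces 3" by (rule has_genus_nonagon_faces)
    show "card nonagon_faces = 8" by (rule card_nonagon_faces)
    show "card (edges nonagon_faces) = 36" by (rule card_edges)
    show "card (vertices nonagon_faces) = 24" by (rule card_vertices)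
    show "\<forall>f\<in>nonagon_faces. simple_polygon f \<and> length f = 9 \<and> \<not> convex (region f)"
    proof (intro ballI conjI)
      fix f assume f: "f \<in> nonagon_faces"
      then show "simple_polygon f" by (rule simple_polygon_faces)
      show "length f = 9" using f face_lists_facts(1) unfolding nonagon_faces_eq by auto
      show "\<not> convex (region f)" using f not_convex_faces unfolding nonagon_faces_def by blast
    qed
    show "\<forall>x\<in>vertices nonagon_faces. card {f \<in> nonagon_faces. x \<in> set f} = 3" using card_faces_at_vertex by blast
    show "\<forall>f\<in>nonagon_faces. \<forall>g\<in>nonagon_faces. f \<noteq> g \<longrightarrow> edges_of f \<inter> edges_of g \<noteq> {}"
    proof (intro ballI impI notI)
      fix f g assume "f \<in> nonagon_faces" "g \<in> nonagon_faces" "f \<noteq> g" "edges_of f \<inter> edges_of g = {}"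
      then show False using common[of f g] unfolding PF by (simp split: if_splits)
    qed
    show "\<forall>f\<in>nonagon_faces. \<forall>g\<in>nonagon_faces. f \<noteq> g \<and> {f, g} \<in> D \<longrightarrow>
      card (edges_of f \<inter> edges_of g) = 2 \<and> collinear (\<Union> (edges_of f \<inter> edges_of g))"
      using common line' unfolding PF by simp
    show "\<forall>f\<in>nonagon_faces. \<forall>g\<in>nonagon_faces. f \<noteq> g \<and> {f, g} \<notin> D \<longrightarrow> card (edges_of f \<inter> edges_of g) = 1"
      using common unfolding PF by simp
    show "card {{f, g} | f g. f \<in> nonagon_faces \<and> g \<in> nonagon_faces \<and> f \<noteq> g \<and> {f, g} \<notin> D} = 20"
      by (rule card_simple_pairs(2)[OF D'])
    show "\<forall>i\<in>{1..4}. card (reflex_corners (A i)) = 3" unfolding four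
      by (simp add: A half_turn_A2(4) half_turn_A3(4) half_turn_A4(4) reflex_corners_A1)
    show "\<forall>i\<in>{1..4}. card (reflex_corners (B i)) = 2" unfolding four
      by (simp add: B half_turn_B2(4) half_turn_B3(4) half_turn_B4(4) reflex_corners_B1)
    show "symmetries nonagon_faces = {id, half_turn_x, half_turn_y, half_turn_z}" by (rule symmetries_nonagon_faces)
    show "chiral nonagon_faces" by (rule chiral_nonagon_faces)
    show "automorphism_group nonagon_faces \<cong> dihedral_group 4" by (rule automorphism_group_iso)
    show "\<forall>f\<in>nonagon_faces. \<forall>g\<in>nonagon_faces. \<exists>!\<pi>. \<pi> \<in> automorphisms nonagon_faces \<and>
      unoriented_cycle (map \<pi> f) = unoriented_cycle g" using simply_transitive by blast
    show "\<forall>\<pi>\<in>automorphisms nonagon_faces. orientation_preserving nonagon_faces \<pi>"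
      using orientation_preserving_automorphisms by blast
    show "solid nonagon_faces \<in> lmeasurable" by (rule solid_lmeasurable)
    show "measure lebesgue (solid nonagon_faces) = 351105133 / 18170460" by (rule measure_solid)
    show "convex hull (surface nonagon_faces) = convex hull {pt 1, pt 2, pt 3, pt 4}" by (rule convex_hull_surface)
    show "\<not> affine_dependent {pt 1, pt 2, pt 3, pt 4}" by (rule corners_affine_independent)
  qed
qed

end
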